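(* Let $\omega,t_o>0$, $h=2\pi/t_o$, and let $\ell\ge1$ be an integer with $\frac{\omega}{\ell}<h<\frac{\omega}{\ell-1/2}$. Let $\Phi=\{\varphi_j:1\le j\le 2\ell\}\subset B_\omega$ and set $I_-=(0,-\omega+\ell h)$, $I=(-\omega+\ell h,\omega-(\ell-1)h)$, $I_+=(\omega-(\ell-1)h,h)$. If $E_{\Phi,t_o}=\{\tau_{nt_o}\varphi_j:n\in\mathbb Z,\ 1\le j\le 2\ell\}$ is a frame for $B_\omega$, then $$G_{\Phi,\Phi^*,t_o}=I_{2\ell}\quad\text{a.e. in }I,\qquad G_{\Phi,\Phi^*,t_o}=I_{2\ell}-P_W\quad\text{a.e. in }I_-\cup I_+,$$ where $W(x)\in\mathbb C^{2\ell}$ is the cross product of the $2\ell-1$ vectors $\big(\widehat{\varphi_1}(x+jh),\dots,\widehat{\varphi_{2\ell}}(x+jh)\big)$, with $j=-\ell+1,\dots,\ell-1$ if $x\in I_-$ and with $j=-\ell,\dots,\ell-2$ if $x\in I_+$.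
   Context: Fourier transform: $\widehat f(\xi)=\frac1{\sqrt{2\pi}}\int f(t)e^{-it\xi}\,dt$. $B_\omega$ is the space of $f\in L^2(\mathbb R)$ whose Fourier transform is supported in $[-\omega,\omega]$. $\tau_af(x)=f(x+a)$. The family $E_{\Phi,t_o}$ is a frame for $B_\omega$ if there are constants $0<A\le B$ with $A\|f\|^2\le\sum_{j}\sum_{n\in\mathbb Z}|\langle f,\tau_{nt_o}\varphi_j\rangle|^2\le B\|f\|^2$ for all $f\in B_\omega$. In this case the frame operator $S f=\sum_j\sum_{n\in\mathbb Z}\langle f,\tau_{nt_o}\varphi_j\rangle\tau_{nt_o}\varphi_j$ is invertible on $B_\omega$, and the dual generators $\Phi^*=\{\varphi_j^*\}$ are $\varphi_j^*=S^{-1}\varphi_j$. The mixed Gramian $G_{\Phi,\Phi^*,t_o}$ is the $h$-periodic matrix-valued function with entries $\big(G_{\Phi,\Phi^*,t_o}\big)_{jk}(x)=h\sum_{m\in\mathbb Z}\widehat{\varphi_k^*}(x+mh)\,\overline{\widehat{\varphi_j}(x+mh)}$. $I_n$ (with integer subscript) is the $n\times n$ identity matrix; for $v\in\mathbb C^n$, $P_v$ is the orthogonal projection of $\mathbb C^n$ onto the span of $v$ (standard Hermitian inner product). Cross product: for $v_1,\dots,v_{n-1}\in\mathbb C^n$, the cross product is the vector in $\mathbb C^n$ whose $k$-th component is $(-1)^{k+1}$ times the determinant of the $(n-1)\times(n-1)$ matrix obtained by deleting the $k$-th column from the matrix with rows $v_1,\dots,v_{n-1}$ (no complex conjugation). 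*)

theory Defs
  imports "HOL-Analysis.Analysis" "Jordan_Normal_Form.Determinant" "Jordan_Normal_Form.Conjugate"
begin

text \<open>
  Elements of \<open>L\<^sup>2(\<real>)\<close> are represented by square-integrable Borel functions; operations that are
  determined only up to null sets (Fourier transform, frame operator, dual generators) choose an
  arbitrary representative by Hilbert choice.  The type \<open>complex mat\<close> is that of
  Jordan_Normal_Form, so matrices and vectors are indexed from 0, while the generators
  \<open>\<phi> 1, \<dots>, \<phi> N\<close> are indexed from 1.
\<close>

definition L2 :: "(real \<Rightarrow> complex) set" where
  "L2 = {f. f \<in> borel_measurable borel \<and> integrable lborel (\<lambda>x. (cmod (f x))\<^sup>2)}"

definition L2_inner :: "(real \<Rightarrow> complex) \<Rightarrow> (real \<Rightarrow> complex) \<Rightarrow> complex" where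
  "L2_inner f g = (LINT x|lborel. f x * cnj (g x))"

definition L2_norm_sq :: "(real \<Rightarrow> complex) \<Rightarrow> real" where
  "L2_norm_sq f = (LINT x|lborel. (cmod (f x))\<^sup>2)"

definition L2_tendsto ::
  "('i \<Rightarrow> real \<Rightarrow> complex) \<Rightarrow> (real \<Rightarrow> complex) \<Rightarrow> 'i filter \<Rightarrow> bool" where
  "L2_tendsto u g F \<longleftrightarrow>
     ((\<lambda>i. \<integral>\<^sup>+x. ennreal ((cmod (u i x - g x))\<^sup>2) \<partial>lborel) \<longlongrightarrow> 0) F"

text \<open>
  The Fourier transform on \<open>L\<^sup>2\<close>: the integral need not converge absolutely, so it is read, as in
  Plancherel's theorem, as the \<open>L\<^sup>2\<close>-limit of the integrals over \<open>[-R, R]\<close>.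
\<close>

definition fourier_trunc :: "(real \<Rightarrow> complex) \<Rightarrow> real \<Rightarrow> real \<Rightarrow> complex" where
  "fourier_trunc f R \<xi> =
     complex_of_real (1 / sqrt (2 * pi)) *
       (LINT t:{-R..R}|lborel. f t * exp (- (\<i> * complex_of_real (t * \<xi>))))"

definition fourier :: "(real \<Rightarrow> complex) \<Rightarrow> real \<Rightarrow> complex" where
  "fourier f = (SOME g. g \<in> L2 \<and> L2_tendsto (fourier_trunc f) g at_top)"

text \<open>The support of an \<open>L\<^sup>2\<close> function lies in a closed set iff it vanishes a.e. outside it.\<close>

definition bandlimited :: "real \<Rightarrow> (real \<Rightarrow> complex) set" where
  "bandlimited \<omega> = {f \<in> L2. AE \<xi> in lborel. \<xi> \<notin> {-\<omega>..\<omega>} \<longrightarrow> fourier f \<xi> = 0}"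

definition translate :: "real \<Rightarrow> (real \<Rightarrow> complex) \<Rightarrow> real \<Rightarrow> complex" where
  "translate a f = (\<lambda>x. f (x + a))"

text \<open>
  Summability is required explicitly since \<open>infsum\<close> of a non-summable family is 0.
\<close>

definition is_frame :: "real \<Rightarrow> real \<Rightarrow> nat \<Rightarrow> (nat \<Rightarrow> real \<Rightarrow> complex) \<Rightarrow> bool" where
  "is_frame \<omega> t\<^sub>0 N \<phi> \<longleftrightarrow>
     (\<exists>A B. 0 < A \<and> A \<le> B \<and>
       (\<forall>f\<in>bandlimited \<omega>.
          (\<forall>j\<in>{1..N}. (\<lambda>n::int. (cmod (L2_inner f (translate (of_int n * t\<^sub>0) (\<phi> j))))\<^sup>2)
              summable_on UNIV) \<and>
          A * L2_norm_sq f
            \<le> (\<Sum>j=1..N. \<Sum>\<^sub>\<infinity>n::int. (cmod (L2_inner f (translate (of_int n * t\<^sub>0) (\<phi> j))))\<^sup>2) \<and>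
          (\<Sum>j=1..N. \<Sum>\<^sub>\<infinity>n::int. (cmod (L2_inner f (translate (of_int n * t\<^sub>0) (\<phi> j))))\<^sup>2)
            \<le> B * L2_norm_sq f))"

text \<open>The series defining the frame operator converges unconditionally in \<open>L\<^sup>2\<close>.\<close>

definition frame_operator ::
  "real \<Rightarrow> nat \<Rightarrow> (nat \<Rightarrow> real \<Rightarrow> complex) \<Rightarrow> (real \<Rightarrow> complex) \<Rightarrow> real \<Rightarrow> complex" where
  "frame_operator t\<^sub>0 N \<phi> f = (SOME g. g \<in> L2 \<and>
     L2_tendsto
       (\<lambda>F x. \<Sum>(j, n)\<in>F. L2_inner f (translate (of_int n * t\<^sub>0) (\<phi> j)) *
                             translate (of_int n * t\<^sub>0) (\<phi> j) x)
       g (finite_subsets_at_top ({1..N} \<times> (UNIV :: int set))))"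

definition dual_generator ::
  "real \<Rightarrow> real \<Rightarrow> nat \<Rightarrow> (nat \<Rightarrow> real \<Rightarrow> complex) \<Rightarrow> nat \<Rightarrow> real \<Rightarrow> complex" where
  "dual_generator \<omega> t\<^sub>0 N \<phi> j =
     (SOME g. g \<in> bandlimited \<omega> \<and> (AE x in lborel. frame_operator t\<^sub>0 N \<phi> g x = \<phi> j x))"

definition mixed_gramian ::
  "real \<Rightarrow> nat \<Rightarrow> (nat \<Rightarrow> real \<Rightarrow> complex) \<Rightarrow> (nat \<Rightarrow> real \<Rightarrow> complex) \<Rightarrow> real \<Rightarrow> complex mat" where
  "mixed_gramian t\<^sub>0 N \<phi> \<psi> x =
     (let h = 2 * pi / t\<^sub>0 in
      Matrix.mat N N (\<lambda>(j, k).
        complex_of_real h *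
          (\<Sum>\<^sub>\<infinity>m::int. fourier (\<psi> (Suc k)) (x + of_int m * h) *
                        cnj (fourier (\<phi> (Suc j)) (x + of_int m * h)))))"

definition delete_col :: "'a mat \<Rightarrow> nat \<Rightarrow> 'a mat" where
  "delete_col A k =
     Matrix.mat (dim_row A) (dim_col A - 1) (\<lambda>(i, j). A $$ (i, if j < k then j else Suc j))"

text \<open>
  With indices starting at 0 the sign \<open>(-1)\<^bsup>k+1\<^esup>\<close> of the \<open>k\<close>-th component becomes \<open>(-1)\<^bsup>k\<^esup>\<close>.
\<close>

definition cross_product :: "nat \<Rightarrow> complex Matrix.vec list \<Rightarrow> complex Matrix.vec" where
  "cross_product n vs =
     Matrix.vec n (\<lambda>k. (-1) ^ k * Determinant.det (delete_col (mat_of_rows n vs) k))"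

definition is_orth_proj_span :: "complex Matrix.vec \<Rightarrow> complex mat \<Rightarrow> bool" where
  "is_orth_proj_span v P \<longleftrightarrow>
     P \<in> carrier_mat (dim_vec v) (dim_vec v) \<and>
     (\<forall>u\<in>carrier_vec (dim_vec v).
        (\<exists>c. P *\<^sub>v u = c \<cdot>\<^sub>v v) \<and> (u - P *\<^sub>v u) \<bullet>c v = 0)"

definition orth_proj_span :: "complex Matrix.vec \<Rightarrow> complex mat" where
  "orth_proj_span v = (THE P. is_orth_proj_span v P)"

definition fourier_cross ::
  "real \<Rightarrow> nat \<Rightarrow> (nat \<Rightarrow> real \<Rightarrow> complex) \<Rightarrow> int list \<Rightarrow> real \<Rightarrow> complex Matrix.vec" where
  "fourier_cross h N \<phi> js x =
     cross_product N
       (map (\<lambda>j. Matrix.vec N (\<lambda>k. fourier (\<phi> (Suc k)) (x + of_int j * h))) js)"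

end

theory Submission imports Defs
begin

text \<open>
  Let \<open>A(x)\<close> be the matrix of the values \<open>\<phi>\<^sub>j\<close>-hat\<open>(x + mh)\<close>, with a row for each generator and a column
  for each integer \<open>m\<close> such that \<open>x + mh\<close> lies in the band. Since \<open>t\<^sub>0 h = 2\<pi>\<close>, the inner products of a
  band-limited \<open>f\<close> with the translates of \<open>\<phi>\<^sub>j\<close> are the Fourier coefficients, on a period of length \<open>h\<close>,
  of the \<open>j\<close>-th entry of \<open>cnj A(x) v(x)\<close>, where \<open>v(x)\<close> is the fiber \<open>(f\<close>-hat\<open>(x + mh))\<^sub>m\<close>
  (lemma \<open>frame_coeff\<close>). By Parseval's theorem the frame inequality compares the integrals over a period
  of \<open>h |cnj A(x) v(x)|\<^sup>2\<close> and of \<open>|v(x)|\<^sup>2\<close>, and letting the spectrum of \<open>f\<close> live over arbitrary small sets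
  makes this an inequality at almost every \<open>x\<close> (\<open>frame_bounds_AE\<close>): \<open>A(x)\<close> is bounded and its columns
  are independent, with a uniform lower bound.

  On fibers the frame operator is multiplication by \<open>h A\<^sup>T cnj A\<close> (\<open>frame_operator_eq\<close>), so the fiber \<open>g\<^sub>k\<close> of
  the \<open>k\<close>-th dual generator satisfies \<open>A\<^sup>T (h cnj A g\<^sub>k) = A\<^sup>T e\<^sub>k\<close> (\<open>dual_generator_spectrum\<close>). The vector
  \<open>h cnj A g\<^sub>k\<close> is the \<open>k\<close>-th column of the mixed Gramian. Hence this column lies in the range of \<open>cnj A\<close>
  and differs from \<open>e\<^sub>k\<close> by an element of the kernel of \<open>A\<^sup>T\<close>, which is the orthogonal complement of that
  range: the Gramian is the orthogonal projection onto the range of \<open>cnj A\<close>.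

  It remains to count columns. The hypotheses on \<open>h\<close> say that \<open>A(x)\<close> has \<open>2l\<close> columns in the middle
  interval, where it is therefore invertible and the Gramian is the identity (\<open>gramian_full\<close>). In the two
  outer intervals exactly one of the \<open>2l\<close> points leaves the band, so the kernel of \<open>A\<^sup>T\<close> is a line. It is
  spanned by the cross product \<open>W\<close> of the columns (\<open>cross_product_spans_annihilator\<close>), which gives
  \<open>I - P\<^sub>W\<close> (\<open>gramian_projection\<close>).

  The Fourier transform being a limit in \<open>L\<^sup>2\<close>, all this rests on Plancherel's theorem. It is derived from
  Parseval's theorem on intervals (\<open>parseval\<close>, \<open>plancherel_bounded_support\<close>), which in turn
  follows from the density of trigonometric polynomials by the Stone-Weierstrass theorem on the circle.
  Fourier inversion is established for compactly supported spectra (\<open>fourier_inv_FT\<close>); from there on,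
  band-limited functions are handled as inverse transforms of their spectra.
\<close>

unbundle no vec_syntax

section \<open>Square-integrable functions on the line\<close>

lemma L2_measurable [measurable_dest]: "f \<in> L2 \<Longrightarrow> f \<in> borel_measurable borel"
  by (simp add: L2_def)

lemma borel_measurable_cnj [measurable]:
  "f \<in> borel_measurable M \<Longrightarrow> (\<lambda>x. cnj (f x)) \<in> borel_measurable M"
  by (rule borel_measurable_continuous_on[where f = cnj]) (auto intro: continuous_intros)

lemma L2_integrable: "f \<in> L2 \<Longrightarrow> integrable lborel (\<lambda>x. (cmod (f x))\<^sup>2)"
  by (simp add: L2_def)

lemma nn_integral_eq_L2_norm_sq:
  "f \<in> L2 \<Longrightarrow> (\<integral>\<^sup>+x. ennreal ((cmod (f x))\<^sup>2) \<partial>lborel) = ennreal (L2_norm_sq f)"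
  unfolding L2_norm_sq_def by (intro nn_integral_eq_integral L2_integrable) auto

lemma L2_I_nn:
  assumes [measurable]: "f \<in> borel_measurable borel"
    and "(\<integral>\<^sup>+x. ennreal ((cmod (f x))\<^sup>2) \<partial>lborel) < \<infinity>"
  shows "f \<in> L2"
  using assms by (auto simp: L2_def integrable_iff_bounded)

lemma L2_I_eq:
  assumes "f \<in> borel_measurable borel"
    and "(\<integral>\<^sup>+x. ennreal ((cmod (f x))\<^sup>2) \<partial>lborel) = ennreal r" "r \<ge> 0"
  shows "f \<in> L2" "L2_norm_sq f = r"
proof -
  show f: "f \<in> L2" using assms by (intro L2_I_nn) auto
  show "L2_norm_sq f = r"
    using nn_integral_eq_L2_norm_sq[OF f] assms
    by (metis L2_norm_sq_def ennreal_inj integral_nonneg_AE AE_I2 zero_le_power2)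
qed

lemma L2_norm_sq_nonneg [simp]: "L2_norm_sq f \<ge> 0"
  unfolding L2_norm_sq_def by simp

lemma L2_zero [simp]: "(\<lambda>x. 0) \<in> L2"
  by (simp add: L2_def)

lemma L2_bounded_by:
  assumes "f \<in> L2" and [measurable]: "g \<in> borel_measurable borel"
    and "\<And>x. cmod (g x) \<le> C * cmod (f x)"
  shows "g \<in> L2"
proof -
  have "integrable lborel (\<lambda>x. (cmod (g x))\<^sup>2)"
  proof (rule Bochner_Integration.integrable_bound)
    show "integrable lborel (\<lambda>x. C\<^sup>2 * (cmod (f x))\<^sup>2)"
      by (intro integrable_mult_right L2_integrable assms)
    show "AE x in lborel. norm ((cmod (g x))\<^sup>2) \<le> norm (C\<^sup>2 * (cmod (f x))\<^sup>2)"
    proof (rule AE_I2)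
      fix x
      have "(cmod (g x))\<^sup>2 \<le> (C * cmod (f x))\<^sup>2"
        using assms(3) by (intro power_mono) auto
      then show "norm ((cmod (g x))\<^sup>2) \<le> norm (C\<^sup>2 * (cmod (f x))\<^sup>2)"
        by (simp add: power_mult_distrib)
    qed
  qed auto
  then show ?thesis by (simp add: L2_def)
qed

lemma L2_mult_bounded:
  assumes "f \<in> L2" and [measurable]: "g \<in> borel_measurable borel"
    and "\<And>x. cmod (g x) \<le> C"
  shows "(\<lambda>x. g x * f x) \<in> L2"
proof (rule L2_bounded_by[OF assms(1)])
  show "(\<lambda>x. g x * f x) \<in> borel_measurable borel"
    using assms(1) by measurable
  show "cmod (g x * f x) \<le> C * cmod (f x)" for x
    using assms(3)[of x] by (simp add: norm_mult mult_right_mono)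
qed

lemma L2_scale: "f \<in> L2 \<Longrightarrow> (\<lambda>x. c * f x) \<in> L2"
  by (rule L2_mult_bounded[where C = "cmod c"]) auto

lemma L2_indicator:
  "f \<in> L2 \<Longrightarrow> A \<in> sets borel \<Longrightarrow> (\<lambda>x. indicator A x * f x) \<in> L2"
  by (rule L2_mult_bounded[where C = 1]) (auto simp: indicator_def)

lemma L2_inner_integrable:
  assumes "f \<in> L2" "g \<in> L2"
  shows "integrable lborel (\<lambda>x. f x * cnj (g x))"
proof (rule Bochner_Integration.integrable_bound)
  show "integrable lborel (\<lambda>x. (cmod (f x))\<^sup>2 + (cmod (g x))\<^sup>2)"
    by (intro Bochner_Integration.integrable_add L2_integrable assms)
  show "(\<lambda>x. f x * cnj (g x)) \<in> borel_measurable lborel"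
    using assms by measurable
  show "AE x in lborel. norm (f x * cnj (g x)) \<le> norm ((cmod (f x))\<^sup>2 + (cmod (g x))\<^sup>2)"
  proof (rule AE_I2)
    fix x
    have "2 * (cmod (f x) * cmod (g x)) \<le> (cmod (f x))\<^sup>2 + (cmod (g x))\<^sup>2"
      using sum_squares_bound[of "cmod (f x)" "cmod (g x)"] by simp
    then have "cmod (f x) * cmod (g x) \<le> (cmod (f x))\<^sup>2 + (cmod (g x))\<^sup>2"
      using mult_nonneg_nonneg[OF norm_ge_zero[of "f x"] norm_ge_zero[of "g x"]] by linarith
    then show "norm (f x * cnj (g x)) \<le> norm ((cmod (f x))\<^sup>2 + (cmod (g x))\<^sup>2)"
      by (simp add: norm_mult)
  qed
qed

lemma cmod_add_sq: "(cmod (a + b))\<^sup>2 = (cmod a)\<^sup>2 + 2 * Re (a * cnj b) + (cmod b)\<^sup>2"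
  unfolding cmod_power2 by (simp add: power2_eq_square algebra_simps)

lemma cmod_add_sq_le: "(cmod (a + b))\<^sup>2 \<le> 2 * (cmod a)\<^sup>2 + 2 * (cmod b)\<^sup>2"
proof -
  have "(cmod (a + b))\<^sup>2 \<le> (cmod a + cmod b)\<^sup>2"
    by (intro power_mono norm_triangle_ineq) auto
  also have "\<dots> \<le> 2 * (cmod a)\<^sup>2 + 2 * (cmod b)\<^sup>2"
    using sum_squares_bound[of "cmod a" "cmod b"] by (simp add: power2_sum)
  finally show ?thesis .
qed

lemma L2_add:
  assumes "f \<in> L2" "g \<in> L2"
  shows "(\<lambda>x. f x + g x) \<in> L2"
proof -
  have [measurable]: "f \<in> borel_measurable borel" "g \<in> borel_measurable borel"
    using assms by (auto simp: L2_def)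
  have "integrable lborel (\<lambda>x. (cmod (f x + g x))\<^sup>2)"
    unfolding cmod_add_sq
    by (intro Bochner_Integration.integrable_add integrable_mult_right integrable_Re
        L2_integrable L2_inner_integrable assms)
  then show ?thesis by (simp add: L2_def)
qed

lemma L2_diff: "f \<in> L2 \<Longrightarrow> g \<in> L2 \<Longrightarrow> (\<lambda>x. f x - g x) \<in> L2"
  using L2_add[of f "\<lambda>x. (- 1) * g x"] L2_scale[of g "- 1"] by simp

lemma L2_sum: "(\<And>i. i \<in> A \<Longrightarrow> f i \<in> L2) \<Longrightarrow> (\<lambda>x. \<Sum>i\<in>A. f i x) \<in> L2"
  by (induction A rule: infinite_finite_induct) (auto intro: L2_add)

lemma L2_norm_sq_add:
  assumes "f \<in> L2" "g \<in> L2"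
  shows "L2_norm_sq (\<lambda>x. f x + g x) = L2_norm_sq f + 2 * Re (L2_inner f g) + L2_norm_sq g"
  unfolding L2_norm_sq_def L2_inner_def cmod_add_sq
  using L2_integrable[OF assms(1)] L2_integrable[OF assms(2)]
    integrable_Re[OF L2_inner_integrable[OF assms]] integral_Re[OF L2_inner_integrable[OF assms]]
  by (simp del: times_complex.sel)

lemma L2_norm_sq_scale: "L2_norm_sq (\<lambda>x. c * f x) = (cmod c)\<^sup>2 * L2_norm_sq f"
  unfolding L2_norm_sq_def by (simp add: norm_mult power_mult_distrib)

lemma L2_inner_scale_left: "L2_inner (\<lambda>x. c * f x) g = c * L2_inner f g"
  unfolding L2_inner_def by (simp add: mult.assoc)

lemma L2_inner_scale_right: "L2_inner f (\<lambda>x. c * g x) = cnj c * L2_inner f g"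
  unfolding L2_inner_def by (simp add: mult.left_commute)

lemma L2_inner_add_left:
  "f \<in> L2 \<Longrightarrow> f' \<in> L2 \<Longrightarrow> g \<in> L2 \<Longrightarrow>
     L2_inner (\<lambda>x. f x + f' x) g = L2_inner f g + L2_inner f' g"
  unfolding L2_inner_def by (simp add: distrib_right L2_inner_integrable)

lemma L2_inner_diff_left:
  "f \<in> L2 \<Longrightarrow> f' \<in> L2 \<Longrightarrow> g \<in> L2 \<Longrightarrow>
     L2_inner (\<lambda>x. f x - f' x) g = L2_inner f g - L2_inner f' g"
  unfolding L2_inner_def by (simp add: left_diff_distrib L2_inner_integrable)

lemma L2_norm_sq_diff:
  assumes "f \<in> L2" "g \<in> L2"
  shows "L2_norm_sq (\<lambda>x. f x - g x) = L2_norm_sq f - 2 * Re (L2_inner f g) + L2_norm_sq g"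
  using L2_norm_sq_add[OF assms(1) L2_scale[OF assms(2), of "- 1"]]
    L2_norm_sq_scale[of "- 1" g] L2_inner_scale_right[of f "- 1" g]
  by simp

lemma L2_norm_sq_add_le:
  assumes "f \<in> L2" "g \<in> L2"
  shows "L2_norm_sq (\<lambda>x. f x + g x) \<le> 2 * L2_norm_sq f + 2 * L2_norm_sq g"
proof -
  have "L2_norm_sq (\<lambda>x. f x + g x) \<le> (LINT x|lborel. 2 * (cmod (f x))\<^sup>2 + 2 * (cmod (g x))\<^sup>2)"
    unfolding L2_norm_sq_def
    by (intro integral_mono L2_integrable L2_add assms Bochner_Integration.integrable_add
        integrable_mult_right cmod_add_sq_le)
  also have "\<dots> = 2 * L2_norm_sq f + 2 * L2_norm_sq g"
    unfolding L2_norm_sq_def using L2_integrable assms by simp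
  finally show ?thesis .
qed

lemma L2_norm_sq_diff_le:
  assumes "f \<in> L2" "g \<in> L2"
  shows "L2_norm_sq (\<lambda>x. f x - g x) \<le> 2 * L2_norm_sq f + 2 * L2_norm_sq g"
  using L2_norm_sq_add_le[OF assms(1) L2_scale[OF assms(2), of "- 1"]]
    L2_norm_sq_scale[of "- 1" g] by simp

lemma L2_norm_sq_sum_le:
  assumes "\<And>i. i \<in> A \<Longrightarrow> f i \<in> L2"
  shows "L2_norm_sq (\<lambda>x. \<Sum>i\<in>A. f i x) \<le> 2 ^ card A * (\<Sum>i\<in>A. L2_norm_sq (f i))"
  using assms
proof (induction A rule: infinite_finite_induct)
  case (insert a A)
  have "L2_norm_sq (\<lambda>x. f a x + (\<Sum>i\<in>A. f i x))
      \<le> 2 * L2_norm_sq (f a) + 2 * (2 ^ card A * (\<Sum>i\<in>A. L2_norm_sq (f i)))"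
    using L2_norm_sq_add_le[of "f a" "\<lambda>x. \<Sum>i\<in>A. f i x"] insert by (force intro: L2_sum)
  also have "\<dots> \<le> 2 ^ Suc (card A) * L2_norm_sq (f a)
      + 2 * (2 ^ card A * (\<Sum>i\<in>A. L2_norm_sq (f i)))"
    by (intro add_right_mono mult_right_mono) auto
  finally show ?case using insert by (simp add: algebra_simps)
qed (auto simp: L2_norm_sq_def)

lemma L2_norm_sq_cong_AE:
  assumes "AE x in lborel. f x = g x" "f \<in> borel_measurable borel" "g \<in> borel_measurable borel"
  shows "L2_norm_sq f = L2_norm_sq g"
  unfolding L2_norm_sq_def using assms by (intro integral_cong_AE) auto

lemma L2_inner_cong_AE:
  assumes "AE x in lborel. f x = f' x" "AE x in lborel. g x = g' x"
    and "f \<in> borel_measurable borel" "g \<in> borel_measurable borel"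
    and "f' \<in> borel_measurable borel" "g' \<in> borel_measurable borel"
  shows "L2_inner f g = L2_inner f' g'"
  unfolding L2_inner_def using assms by (intro integral_cong_AE) auto

lemma L2_norm_sq_eq_0:
  assumes "f \<in> L2" "L2_norm_sq f = 0"
  shows "AE x in lborel. f x = 0"
  using assms integral_nonneg_eq_0_iff_AE[OF L2_integrable[OF assms(1)]]
  unfolding L2_norm_sq_def by simp

lemma L2_inner_self: "L2_inner f f = of_real (L2_norm_sq f)"
  unfolding L2_inner_def L2_norm_sq_def
  by (simp only: complex_norm_square[symmetric] integral_complex_of_real)

lemma L2_tendsto_iff:
  assumes "\<forall>\<^sub>F i in F. u i \<in> L2" "g \<in> L2"
  shows "L2_tendsto u g F \<longleftrightarrow> ((\<lambda>i. L2_norm_sq (\<lambda>x. u i x - g x)) \<longlongrightarrow> 0) F"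
proof -
  have "L2_tendsto u g F \<longleftrightarrow> ((\<lambda>i. ennreal (L2_norm_sq (\<lambda>x. u i x - g x))) \<longlongrightarrow> ennreal 0) F"
    unfolding L2_tendsto_def ennreal_0
    by (rule tendsto_cong, rule eventually_mono[OF assms(1)])
      (simp add: nn_integral_eq_L2_norm_sq[OF L2_diff] assms(2))
  also have "\<dots> \<longleftrightarrow> ((\<lambda>i. L2_norm_sq (\<lambda>x. u i x - g x)) \<longlongrightarrow> 0) F"
    by (rule tendsto_ennreal_iff) auto
  finally show ?thesis .
qed

lemma L2_tendsto_unique:
  assumes "F \<noteq> bot" "\<forall>\<^sub>F i in F. u i \<in> L2" "f \<in> L2" "g \<in> L2"
    and "L2_tendsto u f F" "L2_tendsto u g F"
  shows "AE x in lborel. f x = g x"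
proof -
  have "((\<lambda>i. 2 * L2_norm_sq (\<lambda>x. u i x - g x) + 2 * L2_norm_sq (\<lambda>x. u i x - f x))
      \<longlongrightarrow> 2 * 0 + 2 * 0) F"
    using assms by (intro tendsto_intros) (auto simp: L2_tendsto_iff)
  moreover have "\<forall>\<^sub>F i in F. L2_norm_sq (\<lambda>x. f x - g x)
      \<le> 2 * L2_norm_sq (\<lambda>x. u i x - g x) + 2 * L2_norm_sq (\<lambda>x. u i x - f x)"
    using assms(2)
  proof eventually_elim
    case (elim i)
    then show ?case
      using L2_norm_sq_diff_le[of "\<lambda>x. u i x - g x" "\<lambda>x. u i x - f x"] assms
      by (simp add: L2_diff)
  qed
  ultimately have "L2_norm_sq (\<lambda>x. f x - g x) \<le> 2 * 0 + 2 * 0"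
    using assms(1) by (intro tendsto_lowerbound)
  then have "L2_norm_sq (\<lambda>x. f x - g x) = 0"
    using L2_norm_sq_nonneg[of "\<lambda>x. f x - g x"] by linarith
  then show ?thesis
    using L2_norm_sq_eq_0[OF L2_diff[OF assms(3,4)]] by simp
qed

text \<open>
  Riesz-Fischer. The weighted sum \<open>\<Sum>n. 2\<^sup>n |u\<^sub>n\<^sub>+\<^sub>1 - u\<^sub>n|\<^sup>2\<close> has a finite integral, so it is finite almost
  everywhere and the differences are dominated there by a geometric sequence. Fatou's lemma turns the
  pointwise limit into a limit in norm, with the same rate.
\<close>

lemma L2_complete:
  fixes u :: "nat \<Rightarrow> real \<Rightarrow> complex"
  assumes u: "\<And>n. u n \<in> L2"
    and cauchy: "\<And>m n. n \<le> m \<Longrightarrow> L2_norm_sq (\<lambda>x. u m x - u n x) \<le> (1 / 4) ^ n"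
  shows "\<exists>g\<in>L2. \<forall>n. L2_norm_sq (\<lambda>x. u n x - g x) \<le> (1 / 4) ^ n"
proof -
  have [measurable]: "u n \<in> borel_measurable borel" for n using u by (auto simp: L2_def)
  define d where "d n x = (cmod (u (Suc n) x - u n x))\<^sup>2" for n x
  have [measurable]: "d n \<in> borel_measurable borel" for n unfolding d_def by measurable
  have "(\<integral>\<^sup>+x. (\<Sum>n. ennreal (2 ^ n * d n x)) \<partial>lborel)
      = (\<Sum>n. \<integral>\<^sup>+x. ennreal (2 ^ n * d n x) \<partial>lborel)"
    by (rule nn_integral_suminf) simp
  also have "\<dots> = (\<Sum>n. ennreal (2 ^ n * L2_norm_sq (\<lambda>x. u (Suc n) x - u n x)))"
  proof (rule suminf_cong)
    fix n
    have "(\<integral>\<^sup>+x. ennreal (2 ^ n * d n x) \<partial>lborel)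
        = (\<integral>\<^sup>+x. ennreal (2 ^ n) * ennreal (d n x) \<partial>lborel)"
      by (intro nn_integral_cong ennreal_mult) (simp_all add: d_def)
    also have "\<dots> = ennreal (2 ^ n) * (\<integral>\<^sup>+x. ennreal (d n x) \<partial>lborel)"
      by (rule nn_integral_cmult) measurable
    also have "(\<integral>\<^sup>+x. ennreal (d n x) \<partial>lborel) = ennreal (L2_norm_sq (\<lambda>x. u (Suc n) x - u n x))"
      unfolding d_def by (rule nn_integral_eq_L2_norm_sq[OF L2_diff[OF u u]])
    also have "ennreal (2 ^ n) * \<dots> = ennreal (2 ^ n * L2_norm_sq (\<lambda>x. u (Suc n) x - u n x))"
      by (rule ennreal_mult[symmetric]) auto
    finally show "(\<integral>\<^sup>+x. ennreal (2 ^ n * d n x) \<partial>lborel) = \<dots>" .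
  qed
  also have "\<dots> \<le> (\<Sum>n. ennreal ((1 / 2) ^ n))"
  proof (intro suminf_le allI ennreal_leI)
    fix n
    have "2 ^ n * L2_norm_sq (\<lambda>x. u (Suc n) x - u n x) \<le> 2 ^ n * (1 / 4) ^ n"
      by (intro mult_left_mono cauchy) auto
    also have "\<dots> = (1 / 2 :: real) ^ n" by (simp flip: power_mult_distrib)
    finally show "2 ^ n * L2_norm_sq (\<lambda>x. u (Suc n) x - u n x) \<le> (1 / 2) ^ n" .
  qed auto
  also have "\<dots> < \<infinity>"
    by (subst suminf_ennreal2) (auto intro!: summable_geometric)
  finally have "AE x in lborel. (\<Sum>n. ennreal (2 ^ n * d n x)) \<noteq> \<infinity>"
    by (intro nn_integral_PInf_AE) auto
  then have conv: "AE x in lborel. convergent (\<lambda>n. u n x)"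
  proof eventually_elim
    case (elim x)
    define C where "C = (\<Sum>n. ennreal (2 ^ n * d n x))"
    obtain c where c: "C = ennreal c" "c \<ge> 0"
      using elim unfolding C_def by (cases "\<Sum>n. ennreal (2 ^ n * d n x)") auto
    have le: "2 ^ n * d n x \<le> c" for n
    proof -
      have "ennreal (2 ^ n * d n x) \<le> C"
        unfolding C_def using sum_le_suminf[of "\<lambda>n. ennreal (2 ^ n * d n x)" "{n}"] by simp
      then show ?thesis using c by (simp add: ennreal_le_iff)
    qed
    have geometric: "cmod (u (Suc n) x - u n x) \<le> sqrt c * (1 / sqrt 2) ^ n" for n
    proof -
      have "cmod (u (Suc n) x - u n x) = sqrt (d n x)" by (simp add: d_def)
      also have "\<dots> \<le> sqrt (c / 2 ^ n)"
        using le[of n] by (simp add: field_simps)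
      also have "\<dots> = sqrt c * (1 / sqrt 2) ^ n"
        by (simp add: real_sqrt_divide real_sqrt_power power_one_over)
      finally show ?thesis .
    qed
    have "summable (\<lambda>n. sqrt c * (1 / sqrt 2) ^ n)"
      by (intro summable_mult summable_geometric) simp
    then have "summable (\<lambda>n. u (Suc n) x - u n x)"
      by (rule summable_comparison_test') (rule geometric)
    then have "(\<lambda>n. \<Sum>i<n. u (Suc i) x - u i x) \<longlonglongrightarrow> (\<Sum>i. u (Suc i) x - u i x)"
      by (rule summable_LIMSEQ)
    then have "(\<lambda>n. (\<Sum>i<n. u (Suc i) x - u i x) + u 0 x)
        \<longlonglongrightarrow> (\<Sum>i. u (Suc i) x - u i x) + u 0 x"
      by (intro tendsto_add tendsto_const)
    then show ?case unfolding sum_lessThan_telescope[of "\<lambda>i. u i x"]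
      by (auto simp: convergent_def)
  qed
  define g where "g x = lim (\<lambda>n. u n x)" for x
  have [measurable]: "g \<in> borel_measurable borel"
    unfolding g_def by (rule borel_measurable_lim_metric) measurable
  have lim: "AE x in lborel. (\<lambda>n. u n x) \<longlonglongrightarrow> g x"
    using conv by eventually_elim (simp add: g_def convergent_LIMSEQ_iff)
  have bound: "(\<integral>\<^sup>+x. ennreal ((cmod (u n x - g x))\<^sup>2) \<partial>lborel) \<le> ennreal ((1 / 4) ^ n)" for n
  proof -
    have "(\<integral>\<^sup>+x. ennreal ((cmod (u n x - g x))\<^sup>2) \<partial>lborel)
        = (\<integral>\<^sup>+x. liminf (\<lambda>m. ennreal ((cmod (u m x - u n x))\<^sup>2)) \<partial>lborel)"
    proof (rule nn_integral_cong_AE, use lim in eventually_elim)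
      case (elim x)
      have "(\<lambda>m. ennreal ((cmod (u m x - u n x))\<^sup>2)) \<longlonglongrightarrow> ennreal ((cmod (g x - u n x))\<^sup>2)"
        by (intro tendsto_intros elim tendsto_ennrealI)
      from lim_imp_Liminf[OF trivial_limit_sequentially this] show ?case
        by (simp add: norm_minus_commute)
    qed
    also have "\<dots> \<le> liminf (\<lambda>m. \<integral>\<^sup>+x. ennreal ((cmod (u m x - u n x))\<^sup>2) \<partial>lborel)"
      by (rule nn_integral_liminf) measurable
    also have "\<dots> \<le> liminf (\<lambda>m. ennreal ((1 / 4) ^ n))"
      by (rule Liminf_mono, rule eventually_mono[OF eventually_ge_at_top[of n]])
        (auto simp: nn_integral_eq_L2_norm_sq L2_diff u intro!: ennreal_leI cauchy)
    also have "\<dots> = ennreal ((1 / 4) ^ n)" by (simp add: Liminf_const)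
    finally show ?thesis .
  qed
  have diff: "(\<lambda>x. u n x - g x) \<in> L2" for n
    by (rule L2_I_nn) (use le_less_trans[OF bound[of n]] in auto)
  have "g \<in> L2" using L2_diff[OF u[of 0] diff[of 0]] by simp
  moreover have "L2_norm_sq (\<lambda>x. u n x - g x) \<le> (1 / 4) ^ n" for n
    using bound[of n] diff[of n] by (simp add: nn_integral_eq_L2_norm_sq)
  ultimately show ?thesis by blast
qed

section \<open>Density of trigonometric polynomials\<close>

lemma L2_dominated_convergence:
  fixes u :: "nat \<Rightarrow> real \<Rightarrow> complex"
  assumes w: "w \<in> L2"
    and [measurable]: "\<And>i. u i \<in> borel_measurable borel" "f \<in> borel_measurable borel"
    and dom: "\<And>i x. cmod (u i x) \<le> cmod (w x)"
    and lim: "AE x in lborel. (\<lambda>i. u i x) \<longlonglongrightarrow> f x"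
  shows "(\<lambda>i. L2_norm_sq (\<lambda>x. f x - u i x)) \<longlonglongrightarrow> 0"
proof -
  have [measurable]: "w \<in> borel_measurable borel" using w by (simp add: L2_def)
  have "(\<lambda>i. LINT x|lborel. (cmod (f x - u i x))\<^sup>2) \<longlonglongrightarrow> (LINT x|(lborel::real measure). 0)"
  proof (rule integral_dominated_convergence[where w = "\<lambda>x. 4 * (cmod (w x))\<^sup>2"])
    show "integrable lborel (\<lambda>x. 4 * (cmod (w x))\<^sup>2)"
      by (intro integrable_mult_right L2_integrable w)
    show "AE x in lborel. (\<lambda>i. (cmod (f x - u i x))\<^sup>2) \<longlonglongrightarrow> 0"
      using lim
    proof eventually_elim
      case (elim x)
      have "(\<lambda>i. (cmod (f x - u i x))\<^sup>2) \<longlonglongrightarrow> (cmod (f x - f x))\<^sup>2"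
        by (intro tendsto_intros elim)
      then show ?case by simp
    qed
    show "AE x in lborel. norm ((cmod (f x - u i x))\<^sup>2) \<le> 4 * (cmod (w x))\<^sup>2" for i
      using lim
    proof eventually_elim
      case (elim x)
      have "cmod (f x) \<le> cmod (w x)"
        by (rule tendsto_upperbound[OF tendsto_norm[OF elim]]) (auto simp: dom)
      then have "cmod (f x - u i x) \<le> 2 * cmod (w x)"
        using norm_triangle_ineq4[of "f x" "u i x"] dom[of i x] by linarith
      then have "(cmod (f x - u i x))\<^sup>2 \<le> (2 * cmod (w x))\<^sup>2"
        by (intro power_mono) auto
      then show ?case by (simp add: power_mult_distrib)
    qed
  qed measurable
  then show ?thesis by (simp add: L2_norm_sq_def)
qed

lemma integrable_indicator_Ico: "integrable lborel (indicator {a..<b :: real} :: real \<Rightarrow> real)"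
  by (cases "a \<le> b") (auto intro!: integrable_real_indicator)

lemma L2_bounded_on_interval:
  fixes f :: "real \<Rightarrow> complex"
  assumes [measurable]: "f \<in> borel_measurable borel"
    and "\<And>x. x \<in> {a..<a + T} \<Longrightarrow> cmod (f x) \<le> C"
  shows "(\<lambda>x. indicator {a..<a + T} x * f x) \<in> L2"
proof -
  have one: "(\<lambda>x. indicator {a..<a + T} x :: complex) \<in> L2"
  proof -
    have "(\<lambda>x. (cmod (indicator {a..<a + T} x))\<^sup>2) = (indicator {a..<a + T} :: real \<Rightarrow> real)"
      by (auto simp: indicator_def)
    moreover have "integrable lborel (indicator {a..<a + T} :: real \<Rightarrow> real)"
      by (rule integrable_indicator_Ico)
    ultimately show ?thesis by (simp add: L2_def)
  qed
  show ?thesis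
  proof (rule L2_bounded_by[OF one])
    show "cmod (indicator {a..<a + T} x * f x) \<le> C * cmod (indicator {a..<a + T} x)" for x
      using assms(2)[of x] by (auto simp: indicator_def)
  qed measurable
qed

lemma L2_norm_sq_le_on_interval:
  fixes f :: "real \<Rightarrow> complex"
  assumes [measurable]: "f \<in> borel_measurable borel"
    and "\<And>x. x \<in> {a..<a + T} \<Longrightarrow> cmod (f x) \<le> C" "T \<ge> 0"
  shows "L2_norm_sq (\<lambda>x. indicator {a..<a + T} x * f x) \<le> C\<^sup>2 * T"
proof -
  have "L2_norm_sq (\<lambda>x. indicator {a..<a + T} x * f x)
      \<le> (LINT x|lborel. C\<^sup>2 * indicator {a..<a + T} x)"
    unfolding L2_norm_sq_def
  proof (intro integral_mono)
    show "integrable lborel (\<lambda>x. (cmod (indicator {a..<a + T} x * f x))\<^sup>2)"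
      by (intro L2_integrable L2_bounded_on_interval) (use assms in auto)
    show "(cmod (indicator {a..<a + T} x * f x))\<^sup>2 \<le> C\<^sup>2 * indicator {a..<a + T} x" for x
      using power_mono[OF assms(2)[of x], of 2] by (auto simp: indicator_def)
  next
    show "integrable lborel (\<lambda>x. C\<^sup>2 * indicator {a..<a + T} x)"
      by (intro integrable_mult_right integrable_indicator_Ico)
  qed
  also have "(LINT x|lborel. C\<^sup>2 * indicator {a..<a + T} x) = C\<^sup>2 * T" using assms(3) by simp
  finally show ?thesis .
qed

definition trig :: "real \<Rightarrow> int \<Rightarrow> real \<Rightarrow> complex" where
  "trig T n x = cis (2 * pi * real_of_int n * x / T)"

lemma trig_measurable [measurable]: "trig T n \<in> borel_measurable borel"
  unfolding trig_def cis_conv_exp by measurable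

lemma cmod_trig [simp]: "cmod (trig T n x) = 1"
  by (simp add: trig_def)

lemma trig_mult: "trig T n x * trig T m x = trig T (n + m) x"
  by (simp add: trig_def cis_mult ring_distribs add_divide_distrib)

lemma cnj_trig: "cnj (trig T n x) = trig T (- n) x"
  by (simp add: trig_def cis_cnj)

lemma trig_0 [simp]: "trig T 0 x = 1"
  by (simp add: trig_def)

definition trig_poly :: "real \<Rightarrow> (real \<Rightarrow> complex) \<Rightarrow> bool" where
  "trig_poly T p \<longleftrightarrow> (\<exists>F d. finite F \<and> p = (\<lambda>x. \<Sum>n\<in>F. d n * trig T n x))"

lemma trig_poly_trig: "trig_poly T (\<lambda>x. c * trig T n x)"
  unfolding trig_poly_def by (intro exI[of _ "{n}"] exI[of _ "\<lambda>_. c"]) auto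

lemma trig_poly_const: "trig_poly T (\<lambda>x. c)"
  using trig_poly_trig[of T c 0] by simp

lemma trig_poly_add:
  assumes "trig_poly T p" "trig_poly T q"
  shows "trig_poly T (\<lambda>x. p x + q x)"
proof -
  obtain F d where F: "finite F" "p = (\<lambda>x. \<Sum>n\<in>F. d n * trig T n x)"
    using assms(1) unfolding trig_poly_def by blast
  obtain G e where G: "finite G" "q = (\<lambda>x. \<Sum>n\<in>G. e n * trig T n x)"
    using assms(2) unfolding trig_poly_def by blast
  have "(\<Sum>n\<in>F. d n * trig T n x) = (\<Sum>n\<in>F \<union> G. (if n \<in> F then d n else 0) * trig T n x)" for x
    by (rule sum.mono_neutral_cong_left) (use F G in auto)
  moreover have "(\<Sum>n\<in>G. e n * trig T n x) = (\<Sum>n\<in>F \<union> G. (if n \<in> G then e n else 0) * trig T n x)" for x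
    by (rule sum.mono_neutral_cong_left) (use F G in auto)
  ultimately have "(\<lambda>x. p x + q x)
      = (\<lambda>x. \<Sum>n\<in>F \<union> G. ((if n \<in> F then d n else 0) + (if n \<in> G then e n else 0)) * trig T n x)"
    unfolding F(2) G(2) by (simp add: distrib_right sum.distrib)
  then show ?thesis
    unfolding trig_poly_def using F G by (intro exI[of _ "F \<union> G"] exI conjI) auto
qed

lemma trig_poly_sum:
  "(\<And>i. i \<in> A \<Longrightarrow> trig_poly T (p i)) \<Longrightarrow> trig_poly T (\<lambda>x. \<Sum>i\<in>A. p i x)"
  by (induction A rule: infinite_finite_induct) (auto intro: trig_poly_add trig_poly_const)

lemma trig_poly_mult:
  assumes "trig_poly T p" "trig_poly T q"
  shows "trig_poly T (\<lambda>x. p x * q x)"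
proof -
  obtain F d where F: "finite F" "p = (\<lambda>x. \<Sum>n\<in>F. d n * trig T n x)"
    using assms(1) unfolding trig_poly_def by blast
  obtain G e where G: "finite G" "q = (\<lambda>x. \<Sum>n\<in>G. e n * trig T n x)"
    using assms(2) unfolding trig_poly_def by blast
  have "(\<lambda>x. p x * q x) = (\<lambda>x. \<Sum>n\<in>F. \<Sum>m\<in>G. (d n * e m) * trig T (n + m) x)"
    unfolding F(2) G(2) sum_product by (simp add: mult_ac flip: trig_mult)
  then show ?thesis by (simp only:) (intro trig_poly_sum trig_poly_trig)
qed

lemma trig_poly_scale: "trig_poly T p \<Longrightarrow> trig_poly T (\<lambda>x. c * p x)"
  using trig_poly_mult[OF trig_poly_const] .

lemma trig_poly_measurable [measurable_dest]: "trig_poly T p \<Longrightarrow> p \<in> borel_measurable borel"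
  unfolding trig_poly_def by auto

lemma trig_poly_L2:
  assumes "trig_poly T p"
  shows "(\<lambda>x. indicator {a..<a + R} x * p x) \<in> L2"
proof -
  obtain F d where F: "finite F" "p = (\<lambda>x. \<Sum>n\<in>F. d n * trig T n x)"
    using assms unfolding trig_poly_def by blast
  have "cmod (p x) \<le> (\<Sum>n\<in>F. cmod (d n))" for x
    unfolding F(2) by (rule order_trans[OF norm_sum]) (simp add: norm_mult)
  then show ?thesis
    by (intro L2_bounded_on_interval trig_poly_measurable[OF assms])
qed

text \<open>
  On the circle the coordinates of \<open>z\<close> are combinations of \<open>z\<close> and \<open>cnj z\<close>, the characters of index \<open>1\<close>
  and \<open>- 1\<close>, and trigonometric polynomials are closed under products. This connects the Stone-Weierstrass
  theorem, which provides real polynomials, with Fourier series.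
\<close>

lemma trig_poly_real_polynomial:
  assumes "real_polynomial_function (g :: complex \<Rightarrow> real)"
  shows "trig_poly T (\<lambda>x. of_real (g (trig T 1 x)))"
  using assms
proof (induction rule: real_polynomial_function.induct)
  case (linear f)
  have "f z = Re z * f 1 + Im z * f \<i>" for z
  proof -
    have "z = Re z *\<^sub>R 1 + Im z *\<^sub>R \<i>"
      by (simp add: complex_eq_iff)
    then have "f z = f (Re z *\<^sub>R 1 + Im z *\<^sub>R \<i>)" by (rule arg_cong)
    then show ?thesis
      using bounded_linear.linear[OF linear] by (simp add: linear_add linear_scale)
  qed
  moreover have "complex_of_real (Re z) = (z + cnj z) * (1 / 2)" for z
    by (simp add: complex_add_cnj)
  moreover have "complex_of_real (Im z) = (z - cnj z) * (- \<i> / 2)" for z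
    by (simp add: complex_diff_cnj complex_eq_iff)
  ultimately have split: "of_real (f z) = (z + cnj z) * (1 / 2) * of_real (f 1)
      + (z - cnj z) * (- \<i> / 2) * of_real (f \<i>)" for z
    by (metis of_real_add of_real_mult)
  have regroup: "(z + w) * r * a + (z - w) * s * b = (r * a + s * b) * z + (r * a - s * b) * w"
    for z w r s a b :: complex
    by (simp add: algebra_simps)
  have "of_real (f z) = (1 / 2 * of_real (f 1) + (- \<i> / 2) * of_real (f \<i>)) * z
       + (1 / 2 * of_real (f 1) - (- \<i> / 2) * of_real (f \<i>)) * cnj z" for z
    by (rule trans[OF split regroup])
  from this[of "trig T 1 _"] show ?case
    by (simp only: cnj_trig) (intro trig_poly_add trig_poly_trig)
qed (auto intro: trig_poly_const trig_poly_add trig_poly_mult)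

definition trig_approximable :: "real \<Rightarrow> real \<Rightarrow> (real \<Rightarrow> complex) \<Rightarrow> bool" where
  "trig_approximable a T f \<longleftrightarrow> f \<in> L2 \<and>
     (\<forall>\<epsilon>>0. \<exists>p. trig_poly T p \<and> L2_norm_sq (\<lambda>x. f x - indicator {a..<a + T} x * p x) < \<epsilon>)"

lemma trig_approximable_limit:
  assumes "f \<in> L2"
    and "\<And>\<epsilon>. \<epsilon> > 0 \<Longrightarrow> \<exists>g. trig_approximable a T g \<and> L2_norm_sq (\<lambda>x. f x - g x) < \<epsilon>"
  shows "trig_approximable a T f"
  unfolding trig_approximable_def
proof (intro conjI allI impI)
  fix \<epsilon> :: real assume "\<epsilon> > 0"
  then obtain g where g: "trig_approximable a T g" "L2_norm_sq (\<lambda>x. f x - g x) < \<epsilon> / 4"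
    using assms(2)[of "\<epsilon> / 4"] by auto
  then obtain p where p: "trig_poly T p"
      "L2_norm_sq (\<lambda>x. g x - indicator {a..<a + T} x * p x) < \<epsilon> / 4"
    using \<open>\<epsilon> > 0\<close> unfolding trig_approximable_def by (meson divide_pos_pos zero_less_numeral)
  have "L2_norm_sq (\<lambda>x. (f x - g x) + (g x - indicator {a..<a + T} x * p x))
      \<le> 2 * L2_norm_sq (\<lambda>x. f x - g x) + 2 * L2_norm_sq (\<lambda>x. g x - indicator {a..<a + T} x * p x)"
    using assms(1) g(1) p(1) unfolding trig_approximable_def
    by (intro L2_norm_sq_add_le L2_diff trig_poly_L2) auto
  then have "L2_norm_sq (\<lambda>x. f x - indicator {a..<a + T} x * p x) < \<epsilon>"
    using g(2) p(2) by simp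
  then show "\<exists>p. trig_poly T p \<and> L2_norm_sq (\<lambda>x. f x - indicator {a..<a + T} x * p x) < \<epsilon>"
    using p(1) by blast
qed (rule assms)

lemma trig_approximable_limit_seq:
  assumes "f \<in> L2" "\<And>i. trig_approximable a T (u i)"
    and "(\<lambda>i. L2_norm_sq (\<lambda>x. f x - u i x)) \<longlonglongrightarrow> 0"
  shows "trig_approximable a T f"
proof (rule trig_approximable_limit[OF assms(1)])
  fix \<epsilon> :: real assume "\<epsilon> > 0"
  then have "\<forall>\<^sub>F i in sequentially. L2_norm_sq (\<lambda>x. f x - u i x) < \<epsilon>"
    using assms(3) by (rule order_tendstoD(2)[rotated])
  then show "\<exists>g. trig_approximable a T g \<and> L2_norm_sq (\<lambda>x. f x - g x) < \<epsilon>"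
    using assms(2) by (auto dest!: eventually_happens)
qed

lemma trig_approximable_add:
  assumes "trig_approximable a T f" "trig_approximable a T g"
  shows "trig_approximable a T (\<lambda>x. f x + g x)"
  unfolding trig_approximable_def
proof (intro conjI allI impI)
  show "(\<lambda>x. f x + g x) \<in> L2"
    using assms unfolding trig_approximable_def by (auto intro: L2_add)
  fix \<epsilon> :: real assume "\<epsilon> > 0"
  then obtain p q where p: "trig_poly T p" "L2_norm_sq (\<lambda>x. f x - indicator {a..<a + T} x * p x) < \<epsilon> / 4"
    and q: "trig_poly T q" "L2_norm_sq (\<lambda>x. g x - indicator {a..<a + T} x * q x) < \<epsilon> / 4"
    using assms unfolding trig_approximable_def by (meson divide_pos_pos zero_less_numeral)
  have "L2_norm_sq (\<lambda>x. (f x - indicator {a..<a + T} x * p x) + (g x - indicator {a..<a + T} x * q x))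
     \<le> 2 * L2_norm_sq (\<lambda>x. f x - indicator {a..<a + T} x * p x)
        + 2 * L2_norm_sq (\<lambda>x. g x - indicator {a..<a + T} x * q x)"
    using assms p q unfolding trig_approximable_def
    by (intro L2_norm_sq_add_le L2_diff trig_poly_L2) auto
  then have "L2_norm_sq (\<lambda>x. (f x + g x) - indicator {a..<a + T} x * (p x + q x)) < \<epsilon>"
    using p(2) q(2) by (simp add: algebra_simps)
  then show "\<exists>p. trig_poly T p \<and> L2_norm_sq (\<lambda>x. f x + g x - indicator {a..<a + T} x * p x) < \<epsilon>"
    using trig_poly_add[OF p(1) q(1)] by blast
qed

lemma trig_approximable_trig_poly:
  "trig_poly T p \<Longrightarrow> trig_approximable a T (\<lambda>x. indicator {a..<a + T} x * p x)"
  unfolding trig_approximable_def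
proof (intro conjI allI impI exI[of _ p])
  show "L2_norm_sq (\<lambda>x. indicator {a..<a + T} x * p x - indicator {a..<a + T} x * p x) < \<epsilon>"
    if "\<epsilon> > 0" for \<epsilon>
    using that by (simp add: L2_norm_sq_def)
qed (rule trig_poly_L2, assumption+)

lemma trig_approximable_scale:
  assumes "trig_approximable a T f"
  shows "trig_approximable a T (\<lambda>x. c * f x)"
proof (rule trig_approximable_limit)
  have f: "f \<in> L2" using assms by (simp add: trig_approximable_def)
  then show "(\<lambda>x. c * f x) \<in> L2" by (rule L2_scale)
  fix \<epsilon> :: real assume "\<epsilon> > 0"
  moreover have pos: "(cmod c)\<^sup>2 + 1 > 0" by (simp add: add_nonneg_pos)
  ultimately have "\<epsilon> / ((cmod c)\<^sup>2 + 1) > 0" by simp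
  then obtain p where p: "trig_poly T p"
      "L2_norm_sq (\<lambda>x. f x - indicator {a..<a + T} x * p x) < \<epsilon> / ((cmod c)\<^sup>2 + 1)"
    using assms unfolding trig_approximable_def by meson
  have "L2_norm_sq (\<lambda>x. c * (f x - indicator {a..<a + T} x * p x))
      \<le> ((cmod c)\<^sup>2 + 1) * L2_norm_sq (\<lambda>x. f x - indicator {a..<a + T} x * p x)"
    unfolding L2_norm_sq_scale by (intro mult_right_mono) auto
  also have "\<dots> < \<epsilon>" using p(2) pos by (simp add: field_simps)
  finally have "L2_norm_sq (\<lambda>x. c * f x - indicator {a..<a + T} x * (c * p x)) < \<epsilon>"
    by (simp add: algebra_simps)
  then show "\<exists>g. trig_approximable a T g \<and> L2_norm_sq (\<lambda>x. c * f x - g x) < \<epsilon>"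
    using trig_approximable_trig_poly[OF trig_poly_scale[OF p(1)]] by blast
qed

lemma trig_approximable_sum:
  "(\<And>i. i \<in> A \<Longrightarrow> trig_approximable a T (f i)) \<Longrightarrow> trig_approximable a T (\<lambda>x. \<Sum>i\<in>A. f i x)"
proof (induction A rule: infinite_finite_induct)
  case (insert i A)
  have "trig_approximable a T (\<lambda>x. f i x + (\<Sum>i\<in>A. f i x))"
    by (intro trig_approximable_add insert) auto
  then show ?case using insert by simp
qed (use trig_approximable_trig_poly[OF trig_poly_const[of T 0], of a] in simp_all)

text \<open>
  The circle is the interval with its end points glued, so a continuous function of
  \<open>e\<^sup>2\<^sup>\<pi>\<^sup>i\<^sup>x\<^sup>/\<^sup>T\<close> is a uniform limit of trigonometric polynomials by the Stone-Weierstrass theorem.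
\<close>

lemma trig_approximable_circle:
  fixes F :: "complex \<Rightarrow> real"
  assumes "T > 0" "continuous_on UNIV F"
  shows "trig_approximable a T (\<lambda>x. indicator {a..<a + T} x * of_real (F (trig T 1 x)))"
proof (rule trig_approximable_limit)
  have [measurable]: "F \<in> borel_measurable borel"
    using assms(2) by (rule borel_measurable_continuous_onI)
  have cont: "continuous_on (sphere 0 1) F" using assms(2) continuous_on_subset by blast
  obtain C where C: "\<And>z. z \<in> sphere 0 1 \<Longrightarrow> \<bar>F z\<bar> \<le> C"
  proof -
    have "bounded (F ` sphere 0 1)"
      by (intro compact_imp_bounded compact_continuous_image cont) auto
    then obtain B where "\<forall>y\<in>F ` sphere 0 1. norm y \<le> B" unfolding bounded_iff by blast
    then show ?thesis using that[of B] by simp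
  qed
  show L2: "(\<lambda>x. indicator {a..<a + T} x * complex_of_real (F (trig T 1 x))) \<in> L2"
  proof (rule L2_bounded_on_interval)
    show "cmod (complex_of_real (F (trig T 1 x))) \<le> C" for x
      using C[of "trig T 1 x"] by simp
  qed measurable
  fix \<epsilon> :: real assume "\<epsilon> > 0"
  define \<delta> where "\<delta> = sqrt (\<epsilon> / (2 * T))"
  have \<delta>: "\<delta> > 0" "\<delta>\<^sup>2 * T = \<epsilon> / 2" using \<open>\<epsilon> > 0\<close> assms(1) by (auto simp: \<delta>_def)
  obtain g where g: "real_polynomial_function g" "\<And>z. z \<in> sphere 0 1 \<Longrightarrow> \<bar>F z - g z\<bar> < \<delta>"
    using Stone_Weierstrass_real_polynomial_function[OF compact_sphere cont \<delta>(1)] by blast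
  define p where "p x = complex_of_real (g (trig T 1 x))" for x
  have p: "trig_poly T p" unfolding p_def by (rule trig_poly_real_polynomial[OF g(1)])
  have "L2_norm_sq (\<lambda>x. indicator {a..<a + T} x * (complex_of_real (F (trig T 1 x)) - p x)) \<le> \<delta>\<^sup>2 * T"
  proof (rule L2_norm_sq_le_on_interval)
    show "(\<lambda>x. complex_of_real (F (trig T 1 x)) - p x) \<in> borel_measurable borel"
      using trig_poly_measurable[OF p] by measurable
    show "cmod (complex_of_real (F (trig T 1 x)) - p x) \<le> \<delta>" for x
      using g(2)[of "trig T 1 x"] by (simp add: p_def flip: of_real_diff)
  qed (use assms in auto)
  then have "L2_norm_sq (\<lambda>x. indicator {a..<a + T} x * complex_of_real (F (trig T 1 x))
      - indicator {a..<a + T} x * p x) < \<epsilon>"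
    using \<delta> \<open>\<epsilon> > 0\<close> by (simp add: right_diff_distrib)
  then show "\<exists>g. trig_approximable a T g \<and>
      L2_norm_sq (\<lambda>x. indicator {a..<a + T} x * complex_of_real (F (trig T 1 x)) - g x) < \<epsilon>"
    using trig_approximable_trig_poly[OF p] by blast
qed

lemma trig_eq_imp:
  assumes "T > 0" "trig T 1 x = trig T 1 y"
  obtains n :: int where "x - y = of_int n * T"
proof -
  have "cis (2 * pi * x / T - 2 * pi * y / T) = 1"
    using assms(2) by (simp add: trig_def flip: cis_divide)
  then have "cos (2 * pi * x / T - 2 * pi * y / T) = 1" by (simp add: complex_eq_iff)
  then obtain n :: int where "2 * pi * x / T - 2 * pi * y / T = of_int n * 2 * pi"
    unfolding cos_one_2pi_int by blast
  then have "2 * pi * (x - y) = 2 * pi * (of_int n * T)"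
    using assms(1) by (simp add: field_simps)
  then have "x - y = of_int n * T" by simp
  then show ?thesis using that by blast
qed

text \<open>
  Let \<open>C\<close> be the compact image on the circle of the part of the closed interval outside \<open>U\<close>. The only points
  of the interval that are glued, its end points, both lie outside \<open>U\<close>, so the image of a point is in \<open>C\<close>
  exactly if the point is not in \<open>U\<close>. The continuous functions \<open>min 1 (k d(z, C))\<close> therefore increase to the
  indicator of \<open>U\<close>.
\<close>

lemma trig_approximable_open:
  assumes T: "T > 0" and U: "open U" "U \<subseteq> {a<..<a + T}"
  shows "trig_approximable a T (indicator U)"
proof -
  define C where "C = trig T 1 ` ({a..a + T} - U)"
  have [measurable]: "U \<in> sets borel" using U by simp
  have "continuous_on UNIV (trig T 1)"
    unfolding trig_def using T by (intro continuous_intros) auto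
  then have "compact C"
    unfolding C_def using U(1)
    by (intro compact_continuous_image compact_diff) (auto intro: continuous_on_subset)
  then have closed: "closed C" by (rule compact_imp_closed)
  have "a \<in> {a..a + T} - U" using U T by auto
  then have ne: "C \<noteq> {}" unfolding C_def by blast
  have mem: "trig T 1 x \<in> C \<longleftrightarrow> x \<notin> U" if x: "x \<in> {a..<a + T}" for x
  proof
    assume "trig T 1 x \<in> C"
    then obtain y where y: "y \<in> {a..a + T}" "y \<notin> U" "trig T 1 x = trig T 1 y"
      unfolding C_def by blast
    obtain n :: int where n: "x - y = of_int n * T" using trig_eq_imp[OF T y(3)] by blast
    have "x - y < 1 * T" "(- 1) * T \<le> x - y" using x y by auto
    then have "real_of_int n * T < 1 * T" "(- 1) * T \<le> real_of_int n * T" unfolding n .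
    then have "real_of_int n < 1" "- 1 \<le> real_of_int n"
      using T by (simp_all only: mult_less_cancel_right_pos mult_le_cancel_right_pos)
    then consider "n = 0" | "n = - 1" by linarith
    then show "x \<notin> U"
    proof cases
      case 2
      then have "x = a" using n x y by auto
      then show ?thesis using U(2) by auto
    qed (use n y in auto)
  qed (use x in \<open>auto simp: C_def\<close>)
  define F where "F k z = min 1 (real k * infdist z C)" for k z
  have contF: "continuous_on UNIV (F k)" for k
    unfolding F_def by (intro continuous_intros)
  have [measurable]: "F k \<in> borel_measurable borel" for k
    using contF by (rule borel_measurable_continuous_onI)
  define u where "u k x = indicator {a..<a + T} x * complex_of_real (F k (trig T 1 x))" for k x
  have one: "(\<lambda>x. indicator {a..<a + T} x * (1 :: complex)) \<in> L2"
    by (rule L2_bounded_on_interval[where C = 1]) auto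
  have UL2: "indicator U \<in> L2"
    by (rule L2_bounded_by[OF one, where C = 1]) (use U(2) in \<open>auto simp: indicator_def\<close>)
  have "(\<lambda>k. L2_norm_sq (\<lambda>x. indicator U x - u k x)) \<longlonglongrightarrow> 0"
  proof (rule L2_dominated_convergence[OF one])
    show "u k \<in> borel_measurable borel" for k unfolding u_def by measurable
    show "cmod (u k x) \<le> cmod (indicator {a..<a + T} x * 1)" for k x
      using infdist_nonneg[of "trig T 1 x" C]
      by (auto simp: u_def F_def indicator_def)
    show "AE x in lborel. (\<lambda>k. u k x) \<longlonglongrightarrow> indicator U x"
    proof (rule AE_I2)
      fix x
      consider "x \<notin> {a..<a + T}" | "x \<in> {a..<a + T}" "x \<notin> U" | "x \<in> {a..<a + T}" "x \<in> U" by blast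
      then show "(\<lambda>k. u k x) \<longlonglongrightarrow> indicator U x"
      proof cases
        case 1
        then show ?thesis using U(2) by (auto simp: u_def indicator_def)
      next
        case 2
        then have "infdist (trig T 1 x) C = 0" using mem by auto
        with 2 show ?thesis by (simp add: u_def F_def)
      next
        case 3
        then have pos: "infdist (trig T 1 x) C > 0"
          using mem[of x] in_closed_iff_infdist_zero[OF closed ne] infdist_nonneg[of "trig T 1 x" C]
          by (metis less_eq_real_def)
        obtain K :: nat where K: "1 < real K * infdist (trig T 1 x) C"
          using reals_Archimedean3[OF pos] by blast
        have "\<forall>\<^sub>F k in sequentially. u k x = 1"
          using eventually_ge_at_top[of K]
        proof eventually_elim
          case (elim k)
          then have "real K * infdist (trig T 1 x) C \<le> real k * infdist (trig T 1 x) C"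
            using pos by (intro mult_right_mono) auto
          with K 3 show ?case by (simp add: u_def F_def)
        qed
        then show ?thesis using 3 by (simp add: tendsto_eventually)
      qed
    qed
  qed (rule L2_measurable[OF UL2])
  moreover have "trig_approximable a T (u k)" for k
    unfolding u_def by (rule trig_approximable_circle[OF T contF])
  ultimately show ?thesis by (rule trig_approximable_limit_seq[OF UL2, rotated])
qed

text \<open>
  Approximable sets form a Dynkin system, and open sets are a generator that is closed under intersection.
\<close>

lemma trig_approximable_borel:
  assumes T: "T > 0" and A: "A \<in> sets borel"
  shows "trig_approximable a T (indicator (A \<inter> {a<..<a + T}))"
proof -
  let ?J = "{a<..<a + T}"
  have one: "(\<lambda>x. indicator {a..<a + T} x * (1 :: complex)) \<in> L2"
    by (rule L2_bounded_on_interval[where C = 1]) auto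
  have "A \<in> sigma_sets UNIV {S. open S}" using A by (simp add: borel_def)
  then show ?thesis
  proof (induction A rule: sigma_sets_induct_disjoint[rotated 2, consumes 1,
        case_names basic empty compl union])
    case (basic A)
    then show ?case using T by (intro trig_approximable_open) auto
  next
    case empty
    then show ?case
      using trig_approximable_trig_poly[OF trig_poly_const[of T 0], of a]
      by (simp add: indicator_def[abs_def])
  next
    case (compl A)
    have "trig_approximable a T (\<lambda>x. indicator ?J x + (- 1) * indicator (A \<inter> ?J) x)"
      by (intro trig_approximable_add trig_approximable_scale trig_approximable_open compl T) auto
    also have "(\<lambda>x. indicator ?J x + (- 1) * indicator (A \<inter> ?J) x)
        = (indicator ((UNIV - A) \<inter> ?J) :: real \<Rightarrow> complex)"
      by (auto simp: indicator_def)
    finally show ?case .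
  next
    case (union A)
    have [measurable]: "A i \<in> sets borel" for i
      using union(2) by (auto simp: borel_def)
    define u where "u n x = (\<Sum>i<n. indicator (A i \<inter> ?J) x :: complex)" for n x
    have u_eq: "u n x = indicator ((\<Union>i<n. A i) \<inter> ?J) x" for n x
    proof -
      have "indicator (\<Union>i<n. A i \<inter> ?J) x = (\<Sum>i<n. indicator (A i \<inter> ?J) x :: complex)"
        by (rule indicator_UN_disjoint)
          (use union(1) in \<open>auto simp: disjoint_family_on_def\<close>)
      then show ?thesis by (simp add: u_def)
    qed
    have L2: "indicator ((\<Union>i. A i) \<inter> ?J) \<in> L2"
      by (rule L2_bounded_by[OF one, where C = 1]) (auto simp: indicator_def)
    have "(\<lambda>n. L2_norm_sq (\<lambda>x. indicator ((\<Union>i. A i) \<inter> ?J) x - u n x)) \<longlonglongrightarrow> 0"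
    proof (rule L2_dominated_convergence[OF one])
      show "u n \<in> borel_measurable borel" for n unfolding u_def by measurable
      show "cmod (u n x) \<le> cmod (indicator {a..<a + T} x * 1)" for n x
        unfolding u_eq by (auto simp: indicator_def)
      show "AE x in lborel. (\<lambda>n. u n x) \<longlonglongrightarrow> indicator ((\<Union>i. A i) \<inter> ?J) x"
      proof (rule AE_I2)
        fix x
        have "(\<lambda>n. indicator (\<Union>i<n. A i \<inter> ?J) x :: complex) \<longlonglongrightarrow> indicator (\<Union>i. A i \<inter> ?J) x"
          by (rule LIMSEQ_indicator_UN)
        then show "(\<lambda>n. u n x) \<longlonglongrightarrow> indicator ((\<Union>i. A i) \<inter> ?J) x"
          by (simp add: u_eq)
      qed
    qed (rule L2_measurable[OF L2])
    moreover have "trig_approximable a T (u n)" for n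
      unfolding u_def by (intro trig_approximable_sum union)
    ultimately show ?case by (rule trig_approximable_limit_seq[OF L2, rotated])
  qed (auto intro!: Int_stableI)
qed

text \<open>
  Approximate by simple functions; the end point \<open>a\<close>, where they are cut off, is a null set.
\<close>

lemma trig_approximable_L2:
  assumes T: "T > 0" and b: "b \<in> L2" "\<And>x. x \<notin> {a..<a + T} \<Longrightarrow> b x = 0"
  shows "trig_approximable a T b"
proof -
  let ?J = "{a<..<a + T}"
  have [measurable]: "b \<in> borel_measurable borel" using b by (simp add: L2_def)
  obtain s where s: "\<And>i. simple_function borel (s i)" "\<And>x. (\<lambda>i. s i x) \<longlonglongrightarrow> b x"
      "\<And>i x. cmod (s i x) \<le> 2 * cmod (b x)"
    using borel_measurable_implies_sequence_metric[of b borel 0] by auto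
  have [measurable]: "s i \<in> borel_measurable borel" for i
    using s(1) by (rule borel_measurable_simple_function)
  define u where "u i x = indicator ?J x * s i x" for i x
  have approx: "trig_approximable a T (u i)" for i
  proof -
    have "u i x = (\<Sum>y\<in>s i ` UNIV. y * indicator (s i -` {y} \<inter> ?J) x)" for x
    proof -
      have "(\<Sum>y\<in>s i ` UNIV. y * indicator (s i -` {y} \<inter> ?J) x)
          = (\<Sum>y\<in>s i ` UNIV. if y = s i x then u i x else 0)"
        by (intro sum.cong) (auto simp: u_def indicator_def)
      also have "\<dots> = u i x"
        using simple_functionD(1)[OF s(1)[of i]] by (subst sum.delta) auto
      finally show ?thesis by simp
    qed
    then have "u i = (\<lambda>x. \<Sum>y\<in>s i ` UNIV. y * indicator (s i -` {y} \<inter> ?J) x)" by blast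
    moreover have "s i -` {y} \<in> sets borel" for y
      using simple_functionD(2)[OF s(1)[of i], of "{y}"] by simp
    ultimately show ?thesis
      by (simp only:) (intro trig_approximable_sum trig_approximable_scale trig_approximable_borel T)
  qed
  have "(\<lambda>i. L2_norm_sq (\<lambda>x. b x - u i x)) \<longlonglongrightarrow> 0"
  proof (rule L2_dominated_convergence)
    show "(\<lambda>x. 2 * b x) \<in> L2" using b(1) by (rule L2_scale)
    show "u i \<in> borel_measurable borel" for i unfolding u_def by measurable
    show "cmod (u i x) \<le> cmod (2 * b x)" for i x
      using s(3)[of i x] by (auto simp: u_def indicator_def norm_mult)
    have "AE x in lborel. x \<noteq> a" by (rule AE_lborel_singleton)
    then show "AE x in lborel. (\<lambda>i. u i x) \<longlonglongrightarrow> b x"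
    proof eventually_elim
      case (elim x)
      then show ?case using s(2)[of x] b(2)[of x] by (cases "x \<in> ?J") (auto simp: u_def)
    qed
  qed fact
  then show ?thesis by (rule trig_approximable_limit_seq[OF b(1) approx])
qed

section \<open>Parseval's theorem on an interval\<close>

text \<open>
  The antiderivative is again a multiple of the character, hence takes equal values at both ends of a period.
\<close>

lemma trig_integral:
  assumes "T > 0" "n \<noteq> 0"
  shows "(LINT x|lborel. indicator {a..<a + T} x * trig T n x) = 0"
proof -
  define F where "F x = trig T n x * (of_real T / (2 * of_real pi * of_int n * \<i>))" for x
  have deriv: "(F has_vector_derivative trig T n x) (at x within {a..a + T})" for x
  proof -
    define k where "k = 2 * pi * real_of_int n / T"
    have "k \<noteq> 0" using assms by (simp add: k_def)
    have "((\<lambda>x. cis (k * x) * (1 / (\<i> * of_real k))) has_vector_derivative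
        (of_real k * (\<i> * cis (k * x))) * (1 / (\<i> * of_real k))) (at x within {a..a + T})"
    proof (rule has_vector_derivative_mult_left)
      have "((\<lambda>z. exp (\<i> * of_real k * z)) has_field_derivative \<i> * of_real k * exp (\<i> * of_real k * of_real x))
          (at (of_real x))"
        by (auto intro!: derivative_eq_intros)
      then have "((\<lambda>x. exp (\<i> * of_real k * of_real x)) has_vector_derivative
            \<i> * of_real k * exp (\<i> * of_real k * of_real x)) (at x within {a..a + T})"
        by (rule has_vector_derivative_real_field)
      then show "((\<lambda>x. cis (k * x)) has_vector_derivative of_real k * (\<i> * cis (k * x)))
          (at x within {a..a + T})"
        by (simp add: cis_conv_exp mult_ac)
    qed
    moreover have "(of_real k * (\<i> * cis (k * x))) * (1 / (\<i> * of_real k)) = trig T n x"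
      using \<open>k \<noteq> 0\<close> by (simp add: trig_def k_def)
    moreover have "F = (\<lambda>x. cis (k * x) * (1 / (\<i> * of_real k)))"
      by (simp add: F_def k_def trig_def fun_eq_iff mult_ac)
    ultimately show ?thesis by simp
  qed
  have "(LINT x|lborel. indicator {a..a + T} x *\<^sub>R trig T n x) = F (a + T) - F a"
  proof (rule integral_FTC_Icc)
    show "continuous_on {a..a + T} (trig T n)"
      unfolding trig_def using assms by (intro continuous_intros) auto
  qed (use assms deriv in auto)
  also have "\<dots> = 0"
  proof -
    have "trig T n (a + T) = trig T n a * cis (2 * pi * of_int n)"
      unfolding trig_def cis_mult using assms by (simp add: field_simps)
    also have "cis (2 * pi * of_int n) = 1" by (simp add: cis_multiple_2pi)
    finally show ?thesis by (simp add: F_def)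
  qed
  also have "(LINT x|lborel. indicator {a..a + T} x *\<^sub>R trig T n x)
      = (LINT x|lborel. indicator {a..<a + T} x * trig T n x)"
  proof (rule integral_cong_AE)
    have "AE x in lborel. x \<noteq> a + T" by (rule AE_lborel_singleton)
    then show "AE x in lborel. indicator {a..a + T} x *\<^sub>R trig T n x = indicator {a..<a + T} x * trig T n x"
      by eventually_elim (auto simp: indicator_def)
  qed measurable
  finally show ?thesis .
qed

definition trig_coeff :: "real \<Rightarrow> (real \<Rightarrow> complex) \<Rightarrow> int \<Rightarrow> complex" where
  "trig_coeff T b n = (LINT x|lborel. b x * cnj (trig T n x))"

lemma L2_trig: "(\<lambda>x. indicator {a..<a + T} x * trig T n x) \<in> L2"
  by (rule L2_bounded_on_interval[where C = 1]) auto

lemma L2_inner_trig: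
  assumes "T > 0"
  shows "L2_inner (\<lambda>x. indicator {a..<a + T} x * trig T n x) (\<lambda>x. indicator {a..<a + T} x * trig T m x)
      = (if n = m then of_real T else 0)"
proof -
  have "L2_inner (\<lambda>x. indicator {a..<a + T} x * trig T n x) (\<lambda>x. indicator {a..<a + T} x * trig T m x)
      = (LINT x|lborel. indicator {a..<a + T} x * trig T (n - m) x)"
    unfolding L2_inner_def
  proof (rule Bochner_Integration.integral_cong)
    fix x
    show "indicator {a..<a + T} x * trig T n x * cnj (indicator {a..<a + T} x * trig T m x)
        = indicator {a..<a + T} x * trig T (n - m) x"
      using trig_mult[of T n x "- m"] by (simp add: indicator_def cnj_trig)
  qed simp
  also have "\<dots> = (if n = m then of_real T else 0)"
  proof (cases "n = m")
    case True
    have "(LINT x|lborel. complex_of_real (indicator {a..<a + T} x)) = of_real T"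
      unfolding integral_complex_of_real using assms by simp
    moreover have "(\<lambda>x. indicator {a..<a + T} x * trig T (n - m) x)
        = (\<lambda>x. complex_of_real (indicator {a..<a + T} x))"
      using True by (simp add: fun_eq_iff indicator_def)
    ultimately show ?thesis using True by simp
  qed (use trig_integral[OF assms, of "n - m" a] in simp)
  finally show ?thesis .
qed

lemma L2_inner_trig_coeff:
  assumes "\<And>x. x \<notin> {a..<a + T} \<Longrightarrow> b x = 0"
  shows "L2_inner b (\<lambda>x. indicator {a..<a + T} x * trig T n x) = trig_coeff T b n"
  unfolding L2_inner_def trig_coeff_def
  by (rule Bochner_Integration.integral_cong) (use assms in \<open>auto simp: indicator_def\<close>)

text \<open>Completing the square: the best approximation is the one with the Fourier coefficients.\<close>

lemma L2_norm_sq_minus_trig: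
  assumes T: "T > 0" and b: "b \<in> L2" "\<And>x. x \<notin> {a..<a + T} \<Longrightarrow> b x = 0" and "finite F"
  shows "L2_norm_sq (\<lambda>x. b x - indicator {a..<a + T} x * (\<Sum>n\<in>F. d n * trig T n x))
    = L2_norm_sq b - (\<Sum>n\<in>F. (cmod (trig_coeff T b n))\<^sup>2) / T
        + T * (\<Sum>n\<in>F. (cmod (d n - trig_coeff T b n / of_real T))\<^sup>2)"
  using \<open>finite F\<close>
proof (induction F)
  case (insert k F)
  define e where "e n x = indicator {a..<a + T} x * trig T n x" for n x
  define c where "c = trig_coeff T b"
  have e: "e n \<in> L2" for n unfolding e_def by (rule L2_trig)
  have inner_e: "L2_inner (e n) (e m) = (if n = m then of_real T else 0)" for n m
    unfolding e_def by (rule L2_inner_trig[OF T])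
  define u where "u x = b x - (\<Sum>n\<in>F. d n * e n x)" for x
  have u: "u \<in> L2" unfolding u_def by (intro L2_diff L2_sum L2_scale b(1) e)
  have inner_sum: "L2_inner (\<lambda>x. \<Sum>n\<in>G. d n * e n x) (e k) = (\<Sum>n\<in>G. d n * L2_inner (e n) (e k))" if "finite G" for G
    using that
  proof (induction G)
    case (insert i G)
    have "L2_inner (\<lambda>x. d i * e i x + (\<Sum>n\<in>G. d n * e n x)) (e k)
        = d i * L2_inner (e i) (e k) + L2_inner (\<lambda>x. \<Sum>n\<in>G. d n * e n x) (e k)"
      unfolding L2_inner_scale_left[symmetric]
      by (intro L2_inner_add_left L2_scale L2_sum e)
    then show ?case using insert by simp
  qed (simp add: L2_inner_def)
  have "L2_inner (\<lambda>x. \<Sum>n\<in>F. d n * e n x) (e k) = 0"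
    unfolding inner_sum[OF insert(1)] using insert(2) by (intro sum.neutral) (auto simp: inner_e)
  moreover have "L2_inner u (e k) = L2_inner b (e k) - L2_inner (\<lambda>x. \<Sum>n\<in>F. d n * e n x) (e k)"
    unfolding u_def by (intro L2_inner_diff_left b(1) e L2_sum L2_scale)
  moreover have "L2_inner b (e k) = c k"
    unfolding e_def c_def using b(2) by (rule L2_inner_trig_coeff)
  ultimately have inner_u: "L2_inner u (e k) = c k" by simp
  have norm_e: "L2_norm_sq (e k) = T"
    using inner_e[of k k] by (simp add: L2_inner_self)
  have "L2_norm_sq (\<lambda>x. u x - d k * e k x)
      = L2_norm_sq u - 2 * Re (cnj (d k) * c k) + (cmod (d k))\<^sup>2 * T"
    unfolding L2_norm_sq_diff[OF u L2_scale[OF e]] L2_inner_scale_right inner_u L2_norm_sq_scale norm_e ..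
  also have "\<dots> = L2_norm_sq u - (cmod (c k))\<^sup>2 / T + T * (cmod (d k - c k / of_real T))\<^sup>2"
  proof -
    have "T * (cmod (d k - c k / of_real T))\<^sup>2
        = T * (cmod (d k))\<^sup>2 - 2 * Re (cnj (d k) * c k) + (cmod (c k))\<^sup>2 / T"
    proof -
      have "(cmod (d k - c k / of_real T))\<^sup>2
          = (cmod (d k))\<^sup>2 - 2 * (Re (cnj (d k) * c k) / T) + (cmod (c k))\<^sup>2 / T\<^sup>2"
        using T cmod_add_sq[of "d k" "- (c k / of_real T)"] by (simp add: norm_divide power_divide)
      then have "T * (cmod (d k - c k / of_real T))\<^sup>2 = T * ((cmod (d k))\<^sup>2
          - 2 * (Re (cnj (d k) * c k) / T) + (cmod (c k))\<^sup>2 / T\<^sup>2)"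
        by (rule arg_cong)
      also have "T * (p - 2 * (q / T) + r / T\<^sup>2) = T * p - 2 * q + r / T" for p q r
        using T by (simp add: field_simps power2_eq_square)
      finally show ?thesis .
    qed
    then show ?thesis by (simp only:) simp
  qed
  finally have "L2_norm_sq (\<lambda>x. u x - d k * e k x)
      = L2_norm_sq u - (cmod (c k))\<^sup>2 / T + T * (cmod (d k - c k / of_real T))\<^sup>2" .
  moreover have "u x - d k * e k x
      = b x - indicator {a..<a + T} x * (\<Sum>n\<in>insert k F. d n * trig T n x)" for x
  proof -
    have "(\<Sum>n\<in>F. d n * e n x) = indicator {a..<a + T} x * (\<Sum>n\<in>F. d n * trig T n x)"
      unfolding e_def sum_distrib_left by (simp only: mult.left_commute)
    then show ?thesis
      using insert(1,2) by (simp add: u_def e_def distrib_left)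
  qed
  moreover have "L2_norm_sq u = L2_norm_sq (\<lambda>x. b x - indicator {a..<a + T} x * (\<Sum>n\<in>F. d n * trig T n x))"
    unfolding u_def e_def sum_distrib_left by (simp only: mult.left_commute)
  ultimately show ?case
    unfolding insert.IH sum.insert[OF insert(1,2)] c_def
    by (simp add: add_divide_distrib distrib_left)
qed simp

text \<open>
  Parseval's theorem.  By density some trigonometric polynomial is close to \<open>b\<close>, and each partial sum
  of the Fourier series over a larger index set is at least as close.
\<close>

lemma trig_series_L2_error:
  assumes T: "T > 0" and b: "b \<in> L2" "\<And>x. x \<notin> {a..<a + T} \<Longrightarrow> b x = 0"
  shows "((\<lambda>F. L2_norm_sq b - (\<Sum>n\<in>F. (cmod (trig_coeff T b n))\<^sup>2) / T) \<longlongrightarrow> 0)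
           (finite_subsets_at_top UNIV)"
proof (rule tendstoI)
  fix \<epsilon> :: real assume "\<epsilon> > 0"
  have partial: "L2_norm_sq (\<lambda>x. b x - indicator {a..<a + T} x * (\<Sum>n\<in>F. trig_coeff T b n / of_real T * trig T n x))
      = L2_norm_sq b - (\<Sum>n\<in>F. (cmod (trig_coeff T b n))\<^sup>2) / T" if "finite F" for F
    using L2_norm_sq_minus_trig[OF T b that, where d = "\<lambda>n. trig_coeff T b n / of_real T"] by simp
  obtain p where p: "trig_poly T p" "L2_norm_sq (\<lambda>x. b x - indicator {a..<a + T} x * p x) < \<epsilon>"
    using trig_approximable_L2[OF T b] \<open>\<epsilon> > 0\<close> unfolding trig_approximable_def by blast
  then obtain G d where G: "finite G" "p = (\<lambda>x. \<Sum>n\<in>G. d n * trig T n x)"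
    unfolding trig_poly_def by blast
  show "\<forall>\<^sub>F F in finite_subsets_at_top UNIV.
      dist (L2_norm_sq b - (\<Sum>n\<in>F. (cmod (trig_coeff T b n))\<^sup>2) / T) 0 < \<epsilon>"
  proof -
    have "dist (L2_norm_sq b - (\<Sum>n\<in>F. (cmod (trig_coeff T b n))\<^sup>2) / T) 0 < \<epsilon>"
      if F: "finite F" "G \<subseteq> F" for F
    proof -
      have "L2_norm_sq b - (\<Sum>n\<in>F. (cmod (trig_coeff T b n))\<^sup>2) / T
          \<le> L2_norm_sq b - (\<Sum>n\<in>G. (cmod (trig_coeff T b n))\<^sup>2) / T"
        using F T by (intro diff_left_mono divide_right_mono sum_mono2) auto
      also have "\<dots> \<le> L2_norm_sq (\<lambda>x. b x - indicator {a..<a + T} x * p x)"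
        using L2_norm_sq_minus_trig[OF T b G(1), where d = d] T by (simp add: G(2) sum_nonneg)
      also have "\<dots> < \<epsilon>" by (rule p)
      finally have "L2_norm_sq b - (\<Sum>n\<in>F. (cmod (trig_coeff T b n))\<^sup>2) / T < \<epsilon>" .
      moreover have "0 \<le> L2_norm_sq b - (\<Sum>n\<in>F. (cmod (trig_coeff T b n))\<^sup>2) / T"
        unfolding partial[OF F(1), symmetric] by simp
      ultimately show ?thesis by simp
    qed
    then show ?thesis
      unfolding eventually_finite_subsets_at_top using G(1) by (intro exI[of _ G]) simp
  qed
qed

lemma parseval:
  assumes T: "T > 0" and b: "b \<in> L2" "\<And>x. x \<notin> {a..<a + T} \<Longrightarrow> b x = 0"
  shows "((\<lambda>n. (cmod (trig_coeff T b n))\<^sup>2) has_sum T * L2_norm_sq b) UNIV"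
  unfolding has_sum_def
proof -
  have "((\<lambda>F. T * L2_norm_sq b - T * (L2_norm_sq b - (\<Sum>n\<in>F. (cmod (trig_coeff T b n))\<^sup>2) / T))
      \<longlongrightarrow> T * L2_norm_sq b - T * 0) (finite_subsets_at_top UNIV)"
    by (intro tendsto_intros trig_series_L2_error[OF T b])
  then show "((\<lambda>F. \<Sum>n\<in>F. (cmod (trig_coeff T b n))\<^sup>2) \<longlongrightarrow> T * L2_norm_sq b) (finite_subsets_at_top UNIV)"
    using T by (simp add: right_diff_distrib)
qed

lemma trig_series_tendsto:
  assumes T: "T > 0" and b: "b \<in> L2" "\<And>x. x \<notin> {a..<a + T} \<Longrightarrow> b x = 0"
  shows "((\<lambda>F. L2_norm_sq (\<lambda>x. indicator {a..<a + T} x * (\<Sum>n\<in>F. trig_coeff T b n * trig T n x)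
             - of_real T * b x)) \<longlongrightarrow> 0) (finite_subsets_at_top UNIV)"
proof -
  define \<sigma> where "\<sigma> F x = indicator {a..<a + T} x * (\<Sum>n\<in>F. trig_coeff T b n * trig T n x)" for F x
  define \<rho> where "\<rho> F = L2_norm_sq b - (\<Sum>n\<in>F. (cmod (trig_coeff T b n))\<^sup>2) / T" for F
  have "(\<rho> \<longlongrightarrow> 0) (finite_subsets_at_top UNIV)"
    unfolding \<rho>_def[abs_def] using T b(1) b(2) by (rule trig_series_L2_error)
  then have "((\<lambda>F. T\<^sup>2 * \<rho> F) \<longlongrightarrow> T\<^sup>2 * 0) (finite_subsets_at_top UNIV)"
    by (rule tendsto_mult_left)
  then have lim: "((\<lambda>F. T\<^sup>2 * \<rho> F) \<longlongrightarrow> 0) (finite_subsets_at_top UNIV)"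
    by simp
  have eq: "L2_norm_sq (\<lambda>x. \<sigma> F x - of_real T * b x) = T\<^sup>2 * \<rho> F" if F: "finite F" for F
  proof -
    have err: "L2_norm_sq (\<lambda>x. b x - indicator {a..<a + T} x
        * (\<Sum>n\<in>F. trig_coeff T b n / of_real T * trig T n x)) = \<rho> F"
      using L2_norm_sq_minus_trig[OF T b F, where d = "\<lambda>n. trig_coeff T b n / of_real T"]
      by (simp add: \<rho>_def)
    have sum: "(\<Sum>n\<in>F. trig_coeff T b n * trig T n x)
        = of_real T * (\<Sum>n\<in>F. trig_coeff T b n / of_real T * trig T n x)" for x
      using T by (simp add: sum_distrib_left)
    have "(\<lambda>x. \<sigma> F x - of_real T * b x) = (\<lambda>x. (- of_real T) * (b x - indicator {a..<a + T} x
              * (\<Sum>n\<in>F. trig_coeff T b n / of_real T * trig T n x)))"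
      unfolding \<sigma>_def sum by (simp add: fun_eq_iff algebra_simps)
    then show ?thesis by (simp only: L2_norm_sq_scale err) simp
  qed
  have "\<forall>\<^sub>F F in finite_subsets_at_top UNIV.
      T\<^sup>2 * \<rho> F = L2_norm_sq (\<lambda>x. \<sigma> F x - of_real T * b x)"
    by (rule eventually_finite_subsets_at_top_weakI, rule eq[symmetric])
  from Lim_transform_eventually[OF lim this] show ?thesis unfolding \<sigma>_def .
qed

section \<open>Plancherel's theorem\<close>

text \<open>
  Unfolding the line into translates of a period. The translates are numbered by natural numbers so that
  the sum is a series.
\<close>

lemma nn_integral_tile:
  fixes u :: "real \<Rightarrow> ennreal"
  assumes [measurable]: "u \<in> borel_measurable borel" and \<delta>: "\<delta> > 0"
  shows "(\<integral>\<^sup>+x. u x \<partial>lborel)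
    = (\<integral>\<^sup>+x. indicator {0..<\<delta>} x * (\<Sum>n. u (x + of_int (int_decode n) * \<delta>)) \<partial>lborel)"
proof -
  define t where "t n = of_int (int_decode n) * \<delta>" for n
  have split: "u x = (\<Sum>n. indicator {0..<\<delta>} (x - t n) * u x)" for x
  proof -
    define k where "k = int_encode \<lfloor>x / \<delta>\<rfloor>"
    have "x - t n \<in> {0..<\<delta>} \<longleftrightarrow> n = k" for n
    proof -
      have "x - t n \<in> {0..<\<delta>} \<longleftrightarrow> of_int (int_decode n) \<le> x / \<delta> \<and> x / \<delta> < of_int (int_decode n) + 1"
        using \<delta> by (auto simp: t_def field_simps)
      also have "\<dots> \<longleftrightarrow> \<lfloor>x / \<delta>\<rfloor> = int_decode n"
        by (auto simp: floor_eq_iff)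
      also have "\<dots> \<longleftrightarrow> n = k"
        unfolding k_def by (metis int_decode_inverse int_encode_inverse)
      finally show ?thesis .
    qed
    then have "(\<Sum>n. indicator {0..<\<delta>} (x - t n) * u x) = (\<Sum>n\<in>{k}. indicator {0..<\<delta>} (x - t n) * u x)"
      by (intro suminf_finite) (auto simp: indicator_def)
    also have "\<dots> = u x" using \<open>\<And>n. x - t n \<in> {0..<\<delta>} \<longleftrightarrow> n = k\<close>[of k] by simp
    finally show ?thesis by simp
  qed
  have "(\<integral>\<^sup>+x. u x \<partial>lborel) = (\<integral>\<^sup>+x. (\<Sum>n. indicator {0..<\<delta>} (x - t n) * u x) \<partial>lborel)"
    by (subst split) simp
  also have "\<dots> = (\<Sum>n. \<integral>\<^sup>+x. indicator {0..<\<delta>} (x - t n) * u x \<partial>lborel)"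
    by (rule nn_integral_suminf) measurable
  also have "\<dots> = (\<Sum>n. \<integral>\<^sup>+x. indicator {0..<\<delta>} x * u (x + t n) \<partial>lborel)"
  proof (rule suminf_cong)
    fix n
    have "(\<integral>\<^sup>+x. indicator {0..<\<delta>} (x - t n) * u x \<partial>lborel)
        = ennreal \<bar>1\<bar> * (\<integral>\<^sup>+x. indicator {0..<\<delta>} (t n + 1 * x - t n) * u (t n + 1 * x) \<partial>lborel)"
      by (rule nn_integral_real_affine) measurable
    then show "(\<integral>\<^sup>+x. indicator {0..<\<delta>} (x - t n) * u x \<partial>lborel)
        = (\<integral>\<^sup>+x. indicator {0..<\<delta>} x * u (x + t n) \<partial>lborel)"
      by (simp add: add.commute)
  qed
  also have "\<dots> = (\<integral>\<^sup>+x. (\<Sum>n. indicator {0..<\<delta>} x * u (x + t n)) \<partial>lborel)"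
    by (rule nn_integral_suminf[symmetric]) measurable
  also have "\<dots> = (\<integral>\<^sup>+x. indicator {0..<\<delta>} x * (\<Sum>n. u (x + t n)) \<partial>lborel)"
    by (simp add: ennreal_suminf_cmult)
  finally show ?thesis by (simp only: t_def)
qed

definition FT :: "(real \<Rightarrow> complex) \<Rightarrow> real \<Rightarrow> complex" where
  "FT f \<xi> = of_real (1 / sqrt (2 * pi)) * (LINT t|lborel. f t * cis (- (t * \<xi>)))"

definition inv_FT :: "(real \<Rightarrow> complex) \<Rightarrow> real \<Rightarrow> complex" where
  "inv_FT g t = FT g (- t)"

lemma cis_measurable [measurable]: "f \<in> borel_measurable M \<Longrightarrow> (\<lambda>x. cis (f x)) \<in> borel_measurable M"
  unfolding cis_conv_exp by measurable

lemma FT_measurable: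
  assumes [measurable]: "f \<in> borel_measurable borel"
  shows "FT f \<in> borel_measurable borel"
  unfolding FT_def by measurable

lemma integrable_mult_cis:
  assumes "integrable lborel f" and [measurable]: "g \<in> borel_measurable borel"
  shows "integrable lborel (\<lambda>t. f t * cis (g t))"
proof (rule Bochner_Integration.integrable_bound[OF assms(1)])
  show "(\<lambda>t. f t * cis (g t)) \<in> borel_measurable lborel"
    using borel_measurable_integrable[OF assms(1)] by measurable
qed (simp add: norm_mult)

lemma FT_diff:
  assumes "integrable lborel f" "integrable lborel g"
  shows "FT (\<lambda>t. f t - g t) = (\<lambda>\<xi>. FT f \<xi> - FT g \<xi>)"
  unfolding FT_def fun_eq_iff using integrable_mult_cis[OF assms(1)] integrable_mult_cis[OF assms(2)]
  by (simp add: left_diff_distrib right_diff_distrib)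

lemma integrable_L2_bounded_support:
  assumes "f \<in> L2" and supp: "\<And>x. x \<notin> {a..<b} \<Longrightarrow> f x = 0"
  shows "integrable lborel f"
proof (rule Bochner_Integration.integrable_bound)
  show "integrable lborel (\<lambda>x. indicator {a..<b} x + (cmod (f x))\<^sup>2)"
    by (intro Bochner_Integration.integrable_add integrable_indicator_Ico L2_integrable assms)
  show "f \<in> borel_measurable lborel" using assms by (simp add: L2_def)
  show "AE x in lborel. cmod (f x) \<le> norm (indicator {a..<b} x + (cmod (f x))\<^sup>2)"
  proof (rule AE_I2)
    fix x
    have "2 * cmod (f x) \<le> 1 + (cmod (f x))\<^sup>2"
      using sum_squares_bound[of 1 "cmod (f x)"] by simp
    moreover have "0 \<le> cmod (f x)" by simp
    ultimately have "cmod (f x) \<le> 1 + (cmod (f x))\<^sup>2" by linarith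
    then show "cmod (f x) \<le> norm (indicator {a..<b} x + (cmod (f x))\<^sup>2)"
      using supp[of x] by (cases "x \<in> {a..<b}") auto
  qed
qed

text \<open>
  Plancherel's theorem for functions supported in an interval of length \<open>T\<close>, from Parseval's theorem:
  the Fourier coefficients of \<open>f(t) e\<^sup>-\<^sup>i\<^sup>t\<^sup>\<theta>\<close> are, up to a constant factor, the values of the Fourier
  transform on \<open>\<theta> + (2\<pi>/T)\<int>\<close>, and integration over \<open>\<theta>\<close> in a period covers the line once.
\<close>

lemma plancherel_bounded_support:
  assumes T: "T > 0" and f: "f \<in> L2" and supp: "\<And>x. x \<notin> {a..<a + T} \<Longrightarrow> f x = 0"
  shows "FT f \<in> L2" "L2_norm_sq (FT f) = L2_norm_sq f"
proof -
  have f_meas [measurable]: "f \<in> borel_measurable borel" using f by (simp add: L2_def)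
  have [measurable]: "FT f \<in> borel_measurable borel" by (rule FT_measurable) fact
  define \<delta> where "\<delta> = 2 * pi / T"
  have \<delta>: "\<delta> > 0" using T by (simp add: \<delta>_def)
  have sum: "(\<Sum>n. ennreal ((cmod (FT f (\<theta> + of_int (int_decode n) * \<delta>)))\<^sup>2)) = ennreal (L2_norm_sq f / \<delta>)" for \<theta>
  proof -
    define b where "b t = cis (- (t * \<theta>)) * f t" for t
    have b: "b \<in> L2" unfolding b_def by (rule L2_mult_bounded[OF f, where C = 1]) auto
    have b_supp: "b x = 0" if "x \<notin> {a..<a + T}" for x using supp[OF that] by (simp add: b_def)
    have norm_b: "L2_norm_sq b = L2_norm_sq f" by (simp add: L2_norm_sq_def b_def norm_mult)
    have "trig_coeff T b n = of_real (sqrt (2 * pi)) * FT f (\<theta> + of_int n * \<delta>)" for n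
    proof -
      have "b t * cnj (trig T n t) = f t * cis (- (t * (\<theta> + of_int n * \<delta>)))" for t
      proof -
        have "- (t * \<theta>) + - (2 * pi * of_int n * t / T) = - (t * (\<theta> + of_int n * \<delta>))"
          by (simp add: \<delta>_def ring_distribs)
        then have "cis (- (t * \<theta>)) * cnj (trig T n t) = cis (- (t * (\<theta> + of_int n * \<delta>)))"
          by (simp only: trig_def cis_cnj cis_mult)
        then show ?thesis by (simp add: b_def mult_ac)
      qed
      then show ?thesis
        unfolding trig_coeff_def FT_def by (simp flip: of_real_mult)
    qed
    then have "(cmod (trig_coeff T b n))\<^sup>2 = 2 * pi * (cmod (FT f (\<theta> + of_int n * \<delta>)))\<^sup>2" for n
      by (simp add: norm_mult power_mult_distrib)
    then have "((\<lambda>n. 2 * pi * (cmod (FT f (\<theta> + of_int n * \<delta>)))\<^sup>2) has_sum T * L2_norm_sq f) UNIV"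
      using parseval[where a = a and b = b, OF T b b_supp] by (simp add: norm_b)
    then have "((\<lambda>n. 1 / (2 * pi) * (2 * pi * (cmod (FT f (\<theta> + of_int n * \<delta>)))\<^sup>2))
        has_sum 1 / (2 * pi) * (T * L2_norm_sq f)) UNIV"
      by (rule has_sum_cmult_right)
    then have "((\<lambda>n. (cmod (FT f (\<theta> + of_int n * \<delta>)))\<^sup>2) has_sum L2_norm_sq f / \<delta>) UNIV"
      by (simp add: \<delta>_def mult.commute)
    then have "((\<lambda>n. (cmod (FT f (\<theta> + of_int (int_decode n) * \<delta>)))\<^sup>2) has_sum L2_norm_sq f / \<delta>) UNIV"
      by (subst has_sum_reindex_bij_betw[OF bij_int_decode])
    then show ?thesis
      by (intro suminf_ennreal_eq has_sum_imp_sums) auto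
  qed
  have "(\<integral>\<^sup>+\<xi>. ennreal ((cmod (FT f \<xi>))\<^sup>2) \<partial>lborel)
      = (\<integral>\<^sup>+\<theta>. indicator {0..<\<delta>} \<theta> * (\<Sum>n. ennreal ((cmod (FT f (\<theta> + of_int (int_decode n) * \<delta>)))\<^sup>2)) \<partial>lborel)"
    by (rule nn_integral_tile[OF _ \<delta>]) measurable
  also have "\<dots> = (\<integral>\<^sup>+\<theta>. ennreal (L2_norm_sq f / \<delta>) * indicator {0..<\<delta>} \<theta> \<partial>lborel)"
    by (simp only: sum) (simp only: mult.commute)
  also have "\<dots> = ennreal (L2_norm_sq f / \<delta>) * ennreal \<delta>"
    using \<delta> by (subst nn_integral_cmult_indicator) auto
  also have "\<dots> = ennreal (L2_norm_sq f)"
    using \<delta> by (simp flip: ennreal_mult)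
  finally have *: "(\<integral>\<^sup>+\<xi>. ennreal ((cmod (FT f \<xi>))\<^sup>2) \<partial>lborel) = ennreal (L2_norm_sq f)" .
  show "FT f \<in> L2" by (rule L2_I_eq(1)[OF _ *]) auto
  show "L2_norm_sq (FT f) = L2_norm_sq f" by (rule L2_I_eq(2)[OF _ *]) auto
qed

lemma inv_FT_L2:
  assumes T: "T > 0" and f: "f \<in> L2" and supp: "\<And>x. x \<notin> {a..<a + T} \<Longrightarrow> f x = 0"
  shows "inv_FT f \<in> L2" "L2_norm_sq (inv_FT f) = L2_norm_sq f"
proof -
  note P = plancherel_bounded_support[where a = a and f = f, OF T f supp]
  have [measurable]: "FT f \<in> borel_measurable borel" using P(1) by (simp add: L2_def)
  have "(\<integral>\<^sup>+\<xi>. ennreal ((cmod (FT f \<xi>))\<^sup>2) \<partial>lborel)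
      = ennreal \<bar>- 1\<bar> * (\<integral>\<^sup>+\<xi>. ennreal ((cmod (FT f (0 + (- 1) * \<xi>)))\<^sup>2) \<partial>lborel)"
    by (rule nn_integral_real_affine) auto
  then have *: "(\<integral>\<^sup>+\<xi>. ennreal ((cmod (inv_FT f \<xi>))\<^sup>2) \<partial>lborel) = ennreal (L2_norm_sq f)"
    using nn_integral_eq_L2_norm_sq[OF P(1)] P(2) by (simp add: inv_FT_def)
  have [measurable]: "inv_FT f \<in> borel_measurable borel" unfolding inv_FT_def by measurable
  show "inv_FT f \<in> L2" by (rule L2_I_eq(1)[OF _ *]) auto
  show "L2_norm_sq (inv_FT f) = L2_norm_sq f" by (rule L2_I_eq(2)[OF _ *]) auto
qed

text \<open>
  Fubini's theorem for \<open>f(t) cnj(g(\<xi>)) e\<^sup>-\<^sup>i\<^sup>t\<^sup>\<xi>\<close>, which is integrable on the plane.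
\<close>

lemma FT_adjoint:
  assumes f: "integrable lborel f" and g: "integrable lborel g"
  shows "(LINT \<xi>|lborel. FT f \<xi> * cnj (g \<xi>)) = (LINT t|lborel. f t * cnj (inv_FT g t))"
proof -
  have [measurable]: "f \<in> borel_measurable borel" "g \<in> borel_measurable borel"
    using f g by auto
  define c where "c = complex_of_real (1 / sqrt (2 * pi))"
  define k where "k t \<xi> = f t * cis (- (t * \<xi>)) * cnj (g \<xi>)" for t \<xi>
  have "integrable (lborel \<Otimes>\<^sub>M lborel) (\<lambda>(t, \<xi>). f t * cnj (g \<xi>))"
  proof (rule lborel_pair.Fubini_integrable)
    show "integrable lborel (\<lambda>t. LINT \<xi>|lborel. norm (case (t, \<xi>) of (t, \<xi>) \<Rightarrow> f t * cnj (g \<xi>)))"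
      using f by (simp add: norm_mult)
  qed (use g in auto)
  then have int: "integrable (lborel \<Otimes>\<^sub>M lborel) (\<lambda>(t, \<xi>). k t \<xi>)"
    by (rule Bochner_Integration.integrable_bound)
      (auto simp: k_def norm_mult split_beta' intro!: AE_I2)
  have "(LINT t|lborel. k t \<xi>) = (LINT t|lborel. f t * cis (- (t * \<xi>))) * cnj (g \<xi>)" for \<xi>
    unfolding k_def by (rule integral_mult_left_zero)
  then have "(LINT \<xi>|lborel. FT f \<xi> * cnj (g \<xi>)) = (LINT \<xi>|lborel. c * (LINT t|lborel. k t \<xi>))"
    by (simp add: FT_def c_def mult.assoc)
  also have "\<dots> = c * (LINT \<xi>|lborel. LINT t|lborel. k t \<xi>)" by simp
  also have "(LINT \<xi>|lborel. LINT t|lborel. k t \<xi>) = (LINT t|lborel. LINT \<xi>|lborel. k t \<xi>)"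
    by (rule lborel_pair.Fubini_integral[OF int])
  also have "c * \<dots> = (LINT t|lborel. f t * cnj (inv_FT g t))"
  proof -
    have "cnj (inv_FT g t) = c * (LINT \<xi>|lborel. cis (- (t * \<xi>)) * cnj (g \<xi>))" for t
    proof -
      have "cnj (inv_FT g t) = c * cnj (LINT \<xi>|lborel. g \<xi> * cis (- (\<xi> * - t)))"
        by (simp add: inv_FT_def FT_def c_def)
      also have "cnj (LINT \<xi>|lborel. g \<xi> * cis (- (\<xi> * - t)))
          = (LINT \<xi>|lborel. cnj (g \<xi> * cis (- (\<xi> * - t))))"
        by (rule Bochner_Integration.integral_cnj[symmetric])
      also have "(\<lambda>\<xi>. cnj (g \<xi> * cis (- (\<xi> * - t)))) = (\<lambda>\<xi>. cis (- (t * \<xi>)) * cnj (g \<xi>))"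
        by (simp add: fun_eq_iff cis_cnj mult.commute)
      finally show ?thesis .
    qed
    then show ?thesis by (simp add: k_def mult_ac)
  qed
  finally show ?thesis .
qed

definition window :: "real \<Rightarrow> (real \<Rightarrow> complex) \<Rightarrow> real \<Rightarrow> complex" where
  "window R f x = indicator {-R..R} x * f x"

lemma L2_window: "f \<in> L2 \<Longrightarrow> window R f \<in> L2"
  unfolding window_def by (intro L2_indicator) auto

text \<open>
  The half-open interval contains \<open>{-R..R}\<close> and has positive length for every sign of \<open>R\<close>, so that the
  results on intervals of length \<open>T > 0\<close> apply.
\<close>

lemma window_support: "x \<notin> {-R..<-R + (2 * \<bar>R\<bar> + 1)} \<Longrightarrow> window R f x = 0"
  by (auto simp: window_def indicator_def)

lemma fourier_trunc_eq: "fourier_trunc f R = FT (window R f)"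
proof -
  have "indicator {-R..R} t *\<^sub>R (f t * exp (- (\<i> * complex_of_real (t * \<xi>))))
      = window R f t * cis (- (t * \<xi>))" for t \<xi>
    by (simp add: window_def cis_conv_exp indicator_def)
  then show ?thesis
    unfolding fun_eq_iff fourier_trunc_def FT_def set_lebesgue_integral_def by simp
qed

lemma integrable_window:
  assumes "f \<in> L2"
  shows "integrable lborel (window R f)"
  by (rule integrable_L2_bounded_support[OF L2_window[OF assms] window_support])

lemma window_diff: "window R (\<lambda>x. f x - g x) = (\<lambda>x. window R f x - window R g x)"
  by (simp add: fun_eq_iff window_def right_diff_distrib)

lemma fourier_trunc_L2: "f \<in> L2 \<Longrightarrow> fourier_trunc f R \<in> L2"
  unfolding fourier_trunc_eq
  by (rule plancherel_bounded_support[where a = "-R" and T = "2 * \<bar>R\<bar> + 1"])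
    (use L2_window window_support in \<open>auto\<close>)

lemma L2_norm_sq_fourier_trunc:
  "f \<in> L2 \<Longrightarrow> L2_norm_sq (fourier_trunc f R) = L2_norm_sq (window R f)"
  unfolding fourier_trunc_eq
  by (rule plancherel_bounded_support[where a = "-R" and T = "2 * \<bar>R\<bar> + 1"])
    (use L2_window window_support in \<open>auto\<close>)

lemma fourier_trunc_diff:
  assumes "f \<in> L2" "g \<in> L2"
  shows "fourier_trunc (\<lambda>x. f x - g x) R = (\<lambda>\<xi>. fourier_trunc f R \<xi> - fourier_trunc g R \<xi>)"
  unfolding fourier_trunc_eq window_diff by (intro FT_diff integrable_window assms)

lemma L2_norm_sq_window:
  assumes "f \<in> L2"
  shows "L2_norm_sq (window R f) + L2_norm_sq (\<lambda>x. f x - window R f x) = L2_norm_sq f"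
proof -
  have "L2_norm_sq (window R f) + L2_norm_sq (\<lambda>x. f x - window R f x)
      = (LINT x|lborel. (cmod (window R f x))\<^sup>2 + (cmod (f x - window R f x))\<^sup>2)"
    unfolding L2_norm_sq_def
    by (rule Bochner_Integration.integral_add[symmetric]; intro L2_integrable L2_diff L2_window assms)
  also have "(\<lambda>x. (cmod (window R f x))\<^sup>2 + (cmod (f x - window R f x))\<^sup>2) = (\<lambda>x. (cmod (f x))\<^sup>2)"
    by (auto simp: window_def indicator_def)
  finally show ?thesis by (simp add: L2_norm_sq_def)
qed

lemma L2_norm_sq_tail_tendsto:
  assumes "f \<in> L2"
  shows "((\<lambda>R. L2_norm_sq (\<lambda>x. f x - window R f x)) \<longlongrightarrow> 0) at_top"
proof (rule tendsto_at_topI_sequentially)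
  fix X :: "nat \<Rightarrow> real" assume X: "filterlim X at_top sequentially"
  show "(\<lambda>n. L2_norm_sq (\<lambda>x. f x - window (X n) f x)) \<longlonglongrightarrow> 0"
  proof (rule L2_dominated_convergence[OF assms])
    show "window (X n) f \<in> borel_measurable borel" for n
      using L2_window[OF assms] by (simp add: L2_def)
    show "f \<in> borel_measurable borel" using assms by (simp add: L2_def)
    show "cmod (window (X n) f x) \<le> cmod (f x)" for n x
      by (auto simp: window_def indicator_def)
    show "AE x in lborel. (\<lambda>n. window (X n) f x) \<longlonglongrightarrow> f x"
    proof (rule AE_I2, rule tendsto_eventually)
      fix x
      have "\<forall>\<^sub>F n in sequentially. \<bar>x\<bar> \<le> X n"
        using X by (simp add: filterlim_at_top)
      then show "\<forall>\<^sub>F n in sequentially. window (X n) f x = f x"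
        by eventually_elim (auto simp: window_def indicator_def)
    qed
  qed
qed

lemma L2_norm_sq_window_tendsto:
  assumes "f \<in> L2"
  shows "((\<lambda>R. L2_norm_sq (window R f)) \<longlongrightarrow> L2_norm_sq f) at_top"
proof -
  have "((\<lambda>R. L2_norm_sq f - L2_norm_sq (\<lambda>x. f x - window R f x)) \<longlongrightarrow> L2_norm_sq f - 0) at_top"
    by (intro tendsto_diff tendsto_const L2_norm_sq_tail_tendsto assms)
  moreover have "L2_norm_sq f - L2_norm_sq (\<lambda>x. f x - window R f x) = L2_norm_sq (window R f)" for R
    using L2_norm_sq_window[OF assms, of R] by linarith
  ultimately show ?thesis by simp
qed

text \<open>Existence of the Fourier transform: the truncated transforms are Cauchy by Plancherel.\<close>

lemma fourier_trunc_Cauchy: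
  assumes f: "f \<in> L2" and R: "0 \<le> R" "R \<le> R'"
  shows "L2_norm_sq (\<lambda>\<xi>. fourier_trunc f R' \<xi> - fourier_trunc f R \<xi>) \<le> L2_norm_sq (\<lambda>x. f x - window R f x)"
proof -
  define d where "d x = f x - window R f x" for x
  have d: "d \<in> L2" unfolding d_def by (intro L2_diff L2_window f)
  have "(\<lambda>x. window R' f x - window R f x) = window R' d"
    using R by (auto simp: fun_eq_iff d_def window_def indicator_def)
  then have "(\<lambda>\<xi>. fourier_trunc f R' \<xi> - fourier_trunc f R \<xi>) = fourier_trunc d R'"
    unfolding fourier_trunc_eq using FT_diff[OF integrable_window[OF f] integrable_window[OF f], of R' R] by simp
  then have "L2_norm_sq (\<lambda>\<xi>. fourier_trunc f R' \<xi> - fourier_trunc f R \<xi>) = L2_norm_sq (window R' d)"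
    by (simp add: L2_norm_sq_fourier_trunc[OF d])
  also have "\<dots> \<le> L2_norm_sq d"
    using L2_norm_sq_window[OF d, of R'] L2_norm_sq_nonneg[of "\<lambda>x. d x - window R' d x"] by linarith
  finally show ?thesis by (simp add: d_def[abs_def])
qed

lemma fourier_exists:
  assumes f: "f \<in> L2"
  shows "\<exists>g. g \<in> L2 \<and> L2_tendsto (fourier_trunc f) g at_top"
proof -
  have "\<exists>R\<ge>0. L2_norm_sq (\<lambda>x. f x - window R f x) \<le> (1 / 4) ^ n" for n
  proof -
    have "\<forall>\<^sub>F R in at_top. L2_norm_sq (\<lambda>x. f x - window R f x) < (1 / 4) ^ n"
      using order_tendstoD(2)[OF L2_norm_sq_tail_tendsto[OF f]] by simp
    then have "\<forall>\<^sub>F R in at_top. 0 \<le> R \<and> L2_norm_sq (\<lambda>x. f x - window R f x) \<le> (1 / 4) ^ n"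
      using eventually_ge_at_top[of "0 :: real"] by eventually_elim simp
    then show ?thesis by (auto dest!: eventually_happens)
  qed
  then obtain r where r: "\<And>n. 0 \<le> r n" "\<And>n. L2_norm_sq (\<lambda>x. f x - window (r n) f x) \<le> (1 / 4) ^ n"
    by metis
  (* Monotone radii make the tail at the smaller radius bound every later difference. *)
  define R where "R n = Max (r ` {..n})" for n
  have R_ge: "r n \<le> R n" for n unfolding R_def by (intro Max_ge) auto
  have R_mono: "R n \<le> R m" if "n \<le> m" for n m
    unfolding R_def using that by (intro Max_mono) auto
  have R0: "0 \<le> R n" for n using r(1)[of n] R_ge[of n] by linarith
  have mono: "L2_norm_sq (\<lambda>x. f x - window b f x) \<le> L2_norm_sq (\<lambda>x. f x - window a f x)" if "a \<le> b" for a b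
    unfolding L2_norm_sq_def using that
    by (intro integral_mono L2_integrable L2_diff L2_window f) (auto simp: window_def indicator_def)
  have tail: "L2_norm_sq (\<lambda>x. f x - window (R n) f x) \<le> (1 / 4) ^ n" for n
    using mono[OF R_ge] r(2) order_trans by blast
  have cauchy: "L2_norm_sq (\<lambda>\<xi>. fourier_trunc f (R m) \<xi> - fourier_trunc f (R n) \<xi>) \<le> (1 / 4) ^ n" if "n \<le> m" for m n
    using fourier_trunc_Cauchy[OF f R0 R_mono[OF that]] tail[of n] by (rule order_trans)
  have "\<exists>g\<in>L2. \<forall>n. L2_norm_sq (\<lambda>\<xi>. fourier_trunc f (R n) \<xi> - g \<xi>) \<le> (1 / 4) ^ n"
    by (rule L2_complete) (rule fourier_trunc_L2[OF f], rule cauchy)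
  then obtain g where g: "g \<in> L2"
      and lim: "\<And>n. L2_norm_sq (\<lambda>\<xi>. fourier_trunc f (R n) \<xi> - g \<xi>) \<le> (1 / 4) ^ n"
    by blast
  have "((\<lambda>S. L2_norm_sq (\<lambda>\<xi>. fourier_trunc f S \<xi> - g \<xi>)) \<longlongrightarrow> 0) at_top"
  proof (rule tendstoI)
    fix \<epsilon> :: real assume "\<epsilon> > 0"
    obtain n :: nat where "(1 / 4) ^ n < \<epsilon> / 4"
      using real_arch_pow_inv[of "\<epsilon> / 4" "1 / 4"] \<open>\<epsilon> > 0\<close> by auto
    then have n: "4 * (1 / 4) ^ n < \<epsilon>" by simp
    show "\<forall>\<^sub>F S in at_top. dist (L2_norm_sq (\<lambda>\<xi>. fourier_trunc f S \<xi> - g \<xi>)) 0 < \<epsilon>"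
      using eventually_ge_at_top[of "R n"]
    proof eventually_elim
      case (elim S)
      have "L2_norm_sq (\<lambda>\<xi>. (fourier_trunc f S \<xi> - fourier_trunc f (R n) \<xi>) + (fourier_trunc f (R n) \<xi> - g \<xi>))
          \<le> 2 * L2_norm_sq (\<lambda>\<xi>. fourier_trunc f S \<xi> - fourier_trunc f (R n) \<xi>)
            + 2 * L2_norm_sq (\<lambda>\<xi>. fourier_trunc f (R n) \<xi> - g \<xi>)"
        by (intro L2_norm_sq_add_le L2_diff fourier_trunc_L2 f g)
      also have "\<dots> \<le> 2 * (1 / 4) ^ n + 2 * (1 / 4) ^ n"
        using fourier_trunc_Cauchy[OF f R0 elim] tail[of n] lim[of n] by simp
      finally show ?case using n by simp
    qed
  qed
  then show ?thesis using g fourier_trunc_L2[OF f] by (auto simp: L2_tendsto_iff)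
qed

lemma fourier_L2: "f \<in> L2 \<Longrightarrow> fourier f \<in> L2"
  and fourier_tendsto: "f \<in> L2 \<Longrightarrow> L2_tendsto (fourier_trunc f) (fourier f) at_top"
  unfolding fourier_def using someI_ex[OF fourier_exists] by blast+

lemma fourier_unique:
  assumes "f \<in> L2" "g \<in> L2" "L2_tendsto (fourier_trunc f) g at_top"
  shows "AE \<xi> in lborel. fourier f \<xi> = g \<xi>"
  using assms fourier_L2 fourier_tendsto fourier_trunc_L2
  by (intro L2_tendsto_unique[where F = at_top and u = "fourier_trunc f"]) auto

definition paley_wiener :: "real \<Rightarrow> (real \<Rightarrow> complex) set" where
  "paley_wiener \<omega> = {v \<in> L2. \<forall>x. x \<notin> {-\<omega>..\<omega>} \<longrightarrow> v x = 0}"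

lemma paley_wienerD:
  assumes "v \<in> paley_wiener \<omega>"
  shows "v \<in> L2" "x \<notin> {-\<omega>..<-\<omega> + (2 * \<bar>\<omega>\<bar> + 1)} \<Longrightarrow> v x = 0"
proof -
  show "v \<in> L2" using assms by (simp add: paley_wiener_def)
  assume "x \<notin> {-\<omega>..<-\<omega> + (2 * \<bar>\<omega>\<bar> + 1)}"
  then have "x \<notin> {-\<omega>..\<omega>}" by auto
  then show "v x = 0" using assms by (simp add: paley_wiener_def)
qed

lemma inv_FT_paley_wiener:
  assumes "v \<in> paley_wiener \<omega>"
  shows "inv_FT v \<in> L2" "L2_norm_sq (inv_FT v) = L2_norm_sq v"
  using inv_FT_L2[where a = "- \<omega>" and T = "2 * \<bar>\<omega>\<bar> + 1" and f = v, OF _ paley_wienerD[OF assms]] by auto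

lemma paley_wiener_integrable:
  assumes "v \<in> paley_wiener \<omega>"
  shows "integrable lborel v"
  by (rule integrable_L2_bounded_support[OF paley_wienerD[OF assms]])

text \<open>
  Fourier inversion.  Since \<open>\<langle>F(u \<one>\<^bsub>[-R,R]\<^esub>), v\<rangle> = \<langle>u \<one>\<^bsub>[-R,R]\<^esub>, u\<rangle>\<close> for \<open>u = F\<^sup>*v\<close>, the squared
  distance of the truncated transform of \<open>u\<close> from \<open>v\<close> is \<open>\<parallel>v\<parallel>\<^sup>2 - \<parallel>u \<one>\<^bsub>[-R,R]\<^esub>\<parallel>\<^sup>2\<close>.
\<close>

lemma fourier_inv_FT:
  assumes v: "v \<in> paley_wiener \<omega>"
  shows "AE \<xi> in lborel. fourier (inv_FT v) \<xi> = v \<xi>"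
proof -
  define u where "u = inv_FT v"
  have u: "u \<in> L2" and norm_u: "L2_norm_sq u = L2_norm_sq v"
    unfolding u_def by (rule inv_FT_paley_wiener[OF v])+
  have vL2: "v \<in> L2" using v by (simp add: paley_wiener_def)
  have "L2_norm_sq (\<lambda>\<xi>. fourier_trunc u R \<xi> - v \<xi>) = L2_norm_sq v - L2_norm_sq (window R u)" for R
  proof -
    have "L2_inner (fourier_trunc u R) v = L2_inner (window R u) u"
      unfolding L2_inner_def fourier_trunc_eq u_def
      by (rule FT_adjoint) (use integrable_window[OF u, of R] paley_wiener_integrable[OF v] in \<open>simp_all add: u_def\<close>)
    also have "\<dots> = L2_inner (window R u) (window R u)"
      unfolding L2_inner_def by (rule Bochner_Integration.integral_cong) (auto simp: window_def indicator_def)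
    finally show ?thesis
      by (simp add: L2_norm_sq_diff[OF fourier_trunc_L2[OF u] vL2] L2_norm_sq_fourier_trunc[OF u] L2_inner_self)
  qed
  moreover have "((\<lambda>R. L2_norm_sq v - L2_norm_sq (window R u)) \<longlongrightarrow> L2_norm_sq v - L2_norm_sq u) at_top"
    by (intro tendsto_diff tendsto_const L2_norm_sq_window_tendsto u)
  ultimately have "((\<lambda>R. L2_norm_sq (\<lambda>\<xi>. fourier_trunc u R \<xi> - v \<xi>)) \<longlongrightarrow> 0) at_top"
    by (simp add: norm_u)
  then have "L2_tendsto (fourier_trunc u) v at_top"
    using fourier_trunc_L2[OF u] vL2 by (subst L2_tendsto_iff) auto
  then show ?thesis unfolding u_def[symmetric] by (rule fourier_unique[OF u vL2])
qed

lemma inv_FT_bandlimited: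
  assumes v: "v \<in> paley_wiener \<omega>"
  shows "inv_FT v \<in> bandlimited \<omega>"
proof -
  have "AE \<xi> in lborel. \<xi> \<notin> {-\<omega>..\<omega>} \<longrightarrow> fourier (inv_FT v) \<xi> = 0"
    using fourier_inv_FT[OF v] by eventually_elim (use v in \<open>auto simp: paley_wiener_def\<close>)
  then show ?thesis using inv_FT_paley_wiener(1)[OF v] by (simp add: bandlimited_def)
qed

text \<open>
  By Plancherel's identity the truncated transforms of \<open>f - g\<close> have the norms of the truncations of
  \<open>f - g\<close>, which increase to the norm of \<open>f - g\<close>, while by assumption they tend to zero.
\<close>

lemma fourier_injective:
  assumes f: "f \<in> L2" and g: "g \<in> L2" and eq: "AE \<xi> in lborel. fourier f \<xi> = fourier g \<xi>"
  shows "AE x in lborel. f x = g x"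
proof -
  define d where "d x = f x - g x" for x
  have d: "d \<in> L2" unfolding d_def by (rule L2_diff[OF f g])
  have lim: "((\<lambda>R. L2_norm_sq (\<lambda>\<xi>. fourier_trunc h R \<xi> - fourier f \<xi>)) \<longlongrightarrow> 0) at_top"
    if h: "h \<in> L2" "AE \<xi> in lborel. fourier h \<xi> = fourier f \<xi>" for h
  proof -
    have "L2_norm_sq (\<lambda>\<xi>. fourier_trunc h R \<xi> - fourier f \<xi>) = L2_norm_sq (\<lambda>\<xi>. fourier_trunc h R \<xi> - fourier h \<xi>)" for R
      using h(2) L2_diff[OF fourier_trunc_L2[OF h(1)] fourier_L2[OF f]]
        L2_diff[OF fourier_trunc_L2[OF h(1)] fourier_L2[OF h(1)]]
      by (intro L2_norm_sq_cong_AE) (auto simp: L2_def)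
    then show ?thesis
      using fourier_tendsto[OF h(1)] fourier_trunc_L2[OF h(1)] fourier_L2[OF h(1)]
      by (simp add: L2_tendsto_iff)
  qed
  have "((\<lambda>R. 2 * L2_norm_sq (\<lambda>\<xi>. fourier_trunc f R \<xi> - fourier f \<xi>)
      + 2 * L2_norm_sq (\<lambda>\<xi>. fourier_trunc g R \<xi> - fourier f \<xi>)) \<longlongrightarrow> 2 * 0 + 2 * 0) at_top"
    using eq by (intro tendsto_add tendsto_mult_left lim f g) auto
  moreover have "L2_norm_sq (window R d)
      \<le> 2 * L2_norm_sq (\<lambda>\<xi>. fourier_trunc f R \<xi> - fourier f \<xi>)
        + 2 * L2_norm_sq (\<lambda>\<xi>. fourier_trunc g R \<xi> - fourier f \<xi>)" for R
  proof -
    have "L2_norm_sq (window R d) = L2_norm_sq (\<lambda>\<xi>. (fourier_trunc f R \<xi> - fourier f \<xi>)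
        - (fourier_trunc g R \<xi> - fourier f \<xi>))"
      unfolding L2_norm_sq_fourier_trunc[OF d, symmetric]
      by (simp add: d_def[abs_def] fourier_trunc_diff[OF f g])
    also have "\<dots> \<le> 2 * L2_norm_sq (\<lambda>\<xi>. fourier_trunc f R \<xi> - fourier f \<xi>)
        + 2 * L2_norm_sq (\<lambda>\<xi>. fourier_trunc g R \<xi> - fourier f \<xi>)"
      by (intro L2_norm_sq_diff_le L2_diff fourier_trunc_L2 fourier_L2 f g)
    finally show ?thesis .
  qed
  ultimately have "L2_norm_sq d \<le> 2 * 0 + 2 * 0"
    by (intro tendsto_le[OF _ _ L2_norm_sq_window_tendsto[OF d]]) (auto intro: always_eventually)
  then have "L2_norm_sq d = 0" using L2_norm_sq_nonneg[of d] by linarith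
  from L2_norm_sq_eq_0[OF d this] show ?thesis by (simp add: d_def)
qed

text \<open>
  A representative of the Fourier transform that vanishes everywhere, and not only almost everywhere,
  outside the band.
\<close>

definition spectrum :: "real \<Rightarrow> (real \<Rightarrow> complex) \<Rightarrow> real \<Rightarrow> complex" where
  "spectrum \<omega> f \<xi> = indicator {-\<omega>..\<omega>} \<xi> * fourier f \<xi>"

lemma
  assumes f: "f \<in> bandlimited \<omega>"
  shows spectrum_paley_wiener: "spectrum \<omega> f \<in> paley_wiener \<omega>"
    and fourier_eq_spectrum: "AE \<xi> in lborel. fourier f \<xi> = spectrum \<omega> f \<xi>"
    and bandlimited_eq_inv_FT: "AE x in lborel. f x = inv_FT (spectrum \<omega> f) x"
proof -
  have f': "f \<in> L2" "AE \<xi> in lborel. \<xi> \<notin> {-\<omega>..\<omega>} \<longrightarrow> fourier f \<xi> = 0"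
    using f by (simp_all add: bandlimited_def)
  have "spectrum \<omega> f \<in> L2"
    unfolding spectrum_def by (rule L2_indicator[OF fourier_L2[OF f'(1)]]) simp
  then show v: "spectrum \<omega> f \<in> paley_wiener \<omega>"
    by (simp add: paley_wiener_def spectrum_def)
  show eq: "AE \<xi> in lborel. fourier f \<xi> = spectrum \<omega> f \<xi>"
    using f'(2) by eventually_elim (auto simp: spectrum_def indicator_def)
  show "AE x in lborel. f x = inv_FT (spectrum \<omega> f) x"
  proof (rule fourier_injective[OF f'(1) inv_FT_paley_wiener(1)[OF v]])
    show "AE \<xi> in lborel. fourier f \<xi> = fourier (inv_FT (spectrum \<omega> f)) \<xi>"
      using eq fourier_inv_FT[OF v] by eventually_elim simp
  qed
qed

section \<open>Band-limited functions and their fibers\<close>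

lemma lborel_integral_shift:
  fixes f :: "real \<Rightarrow> 'a :: {banach, second_countable_topology}"
  shows "(LINT x|lborel. f (x + s)) = (LINT x|lborel. f x)"
  using lborel_integral_real_affine[of 1 f s] by (simp add: add.commute)

text \<open>
  Enclose the exceptional set in a Borel null set and translate that.
\<close>

lemma AE_lborel_shift:
  assumes "AE x in lborel. P x"
  shows "AE x in (lborel :: real measure). P (x + s)"
proof -
  obtain N where N: "N \<in> null_sets lborel" "{x. \<not> P x} \<subseteq> N"
    using assms by (auto elim!: AE_E simp: null_sets_def)
  have "AE x in lborel. x \<notin> N" by (rule AE_not_in[OF N(1)])
  moreover have "N \<in> sets borel" using N(1) by auto
  ultimately have "AE x in lborel. s + 1 * x \<notin> N"
    by (intro AE_borel_affine) (auto simp: pred_def)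
  then show ?thesis
    by eventually_elim (use N(2) in \<open>auto simp: add.commute\<close>)
qed

lemma paley_wiener_add: "v \<in> paley_wiener \<omega> \<Longrightarrow> w \<in> paley_wiener \<omega> \<Longrightarrow> (\<lambda>x. v x + w x) \<in> paley_wiener \<omega>"
  by (simp add: paley_wiener_def L2_add)

lemma paley_wiener_diff: "v \<in> paley_wiener \<omega> \<Longrightarrow> w \<in> paley_wiener \<omega> \<Longrightarrow> (\<lambda>x. v x - w x) \<in> paley_wiener \<omega>"
  by (simp add: paley_wiener_def L2_diff)

lemma paley_wiener_scale: "v \<in> paley_wiener \<omega> \<Longrightarrow> (\<lambda>x. c * v x) \<in> paley_wiener \<omega>"
  by (simp add: paley_wiener_def L2_scale)

lemma paley_wiener_sum:
  "(\<And>i. i \<in> A \<Longrightarrow> v i \<in> paley_wiener \<omega>) \<Longrightarrow> (\<lambda>x. \<Sum>i\<in>A. v i x) \<in> paley_wiener \<omega>"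
  unfolding paley_wiener_def by (auto intro: L2_sum sum.neutral)

lemma paley_wiener_mult_bounded:
  assumes "v \<in> paley_wiener \<omega>" "g \<in> borel_measurable borel" "\<And>x. cmod (g x) \<le> C"
  shows "(\<lambda>x. g x * v x) \<in> paley_wiener \<omega>"
  using assms L2_mult_bounded[of v g C] by (simp add: paley_wiener_def)

lemma inv_FT_add:
  assumes "integrable lborel v" "integrable lborel w"
  shows "inv_FT (\<lambda>x. v x + w x) t = inv_FT v t + inv_FT w t"
  unfolding inv_FT_def FT_def using integrable_mult_cis[OF assms(1)] integrable_mult_cis[OF assms(2)]
  by (simp add: distrib_right distrib_left)

lemma inv_FT_scale: "inv_FT (\<lambda>x. c * v x) t = c * inv_FT v t"
  unfolding inv_FT_def FT_def by (simp add: mult.assoc)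

lemma inv_FT_sum:
  assumes "\<And>i. i \<in> A \<Longrightarrow> integrable lborel (v i)"
  shows "inv_FT (\<lambda>x. \<Sum>i\<in>A. v i x) t = (\<Sum>i\<in>A. inv_FT (v i) t)"
  using assms
proof (induction A rule: infinite_finite_induct)
  case (insert i A)
  have "inv_FT (\<lambda>x. v i x + (\<Sum>i\<in>A. v i x)) t = inv_FT (v i) t + inv_FT (\<lambda>x. \<Sum>i\<in>A. v i x) t"
    by (rule inv_FT_add) (auto intro: insert)
  then show ?case using insert by simp
qed (simp_all add: inv_FT_def FT_def)

lemma inv_FT_diff:
  assumes "integrable lborel v" "integrable lborel w"
  shows "inv_FT (\<lambda>x. v x - w x) t = inv_FT v t - inv_FT w t"
  unfolding inv_FT_def using FT_diff[OF assms] by simp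

text \<open>
  For functions given as inverse transforms, translation is a modulation of the spectrum at every point,
  with no exceptional null set.
\<close>

lemma translate_inv_FT: "translate a (inv_FT v) = inv_FT (\<lambda>\<xi>. cis (a * \<xi>) * v \<xi>)"
proof -
  have "v \<xi> * cis (- (\<xi> * - (x + a))) = cis (a * \<xi>) * v \<xi> * cis (- (\<xi> * - x))" for x \<xi>
  proof -
    have "- (\<xi> * - (x + a)) = a * \<xi> + - (\<xi> * - x)" by (simp add: algebra_simps)
    then have "cis (- (\<xi> * - (x + a))) = cis (a * \<xi>) * cis (- (\<xi> * - x))"
      by (simp only: cis_mult)
    then show ?thesis by (simp only: mult_ac)
  qed
  then show ?thesis unfolding fun_eq_iff translate_def inv_FT_def FT_def by (simp only:) simp
qed

text \<open>Polarization of Plancherel's identity.\<close>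

lemma L2_inner_inv_FT:
  assumes v: "v \<in> paley_wiener \<omega>" and w: "w \<in> paley_wiener \<omega>"
  shows "L2_inner (inv_FT v) (inv_FT w) = L2_inner v w"
proof -
  have Re_eq: "Re (L2_inner (inv_FT u) (inv_FT w)) = Re (L2_inner u w)" if u: "u \<in> paley_wiener \<omega>" for u
  proof -
    have L2: "u \<in> L2" "w \<in> L2" using u w by (simp_all add: paley_wiener_def)
    have "L2_norm_sq (\<lambda>t. inv_FT u t + inv_FT w t) = L2_norm_sq (inv_FT (\<lambda>x. u x + w x))"
      by (simp add: inv_FT_add[OF u[THEN paley_wiener_integrable] w[THEN paley_wiener_integrable], abs_def])
    also have "\<dots> = L2_norm_sq (\<lambda>x. u x + w x)"
      by (rule inv_FT_paley_wiener(2)[OF paley_wiener_add[OF u w]])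
    finally show ?thesis
      unfolding L2_norm_sq_add[OF L2] L2_norm_sq_add[OF inv_FT_paley_wiener(1)[OF u] inv_FT_paley_wiener(1)[OF w]]
        inv_FT_paley_wiener(2)[OF u] inv_FT_paley_wiener(2)[OF w] by simp
  qed
  have "L2_inner (inv_FT (\<lambda>x. (- \<i>) * v x)) (inv_FT w) = (- \<i>) * L2_inner (inv_FT v) (inv_FT w)"
    unfolding inv_FT_scale[abs_def] by (rule L2_inner_scale_left)
  moreover have "L2_inner (\<lambda>x. (- \<i>) * v x) w = (- \<i>) * L2_inner v w"
    by (rule L2_inner_scale_left)
  ultimately have "Im (L2_inner (inv_FT v) (inv_FT w)) = Im (L2_inner v w)"
    using Re_eq[OF paley_wiener_scale[OF v, of "- \<i>"]] by simp
  then show ?thesis using Re_eq[OF v] by (simp add: complex_eq_iff)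
qed

text \<open>
  Test with the set \<open>E\<close> where the inequality fails.
\<close>

lemma AE_le_of_set_integral_le:
  fixes u w :: "real \<Rightarrow> real"
  assumes "integrable lborel u" "integrable lborel w"
    and le: "\<And>E. E \<in> sets borel \<Longrightarrow> (LINT x|lborel. indicator E x * u x) \<le> (LINT x|lborel. indicator E x * w x)"
  shows "AE x in lborel. u x \<le> w x"
proof -
  have [measurable]: "u \<in> borel_measurable borel" "w \<in> borel_measurable borel" using assms by auto
  define E where "E = {x. w x < u x}"
  have E: "E \<in> sets borel" unfolding E_def by measurable
  have int: "integrable lborel (\<lambda>x. indicator E x * f x)" if "integrable lborel f" for f :: "real \<Rightarrow> real"
    using integrable_mult_indicator[OF _ that, of E] E by simp
  have nonneg: "AE x in lborel. 0 \<le> indicator E x * u x - indicator E x * w x"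
    by (rule AE_I2) (auto simp: E_def indicator_def)
  have "(LINT x|lborel. indicator E x * u x - indicator E x * w x) \<le> 0"
    using le[OF E] int[OF assms(1)] int[OF assms(2)] by simp
  moreover have "(LINT x|lborel. indicator E x * u x - indicator E x * w x) \<ge> 0"
    using nonneg by (rule integral_nonneg_AE)
  ultimately have "AE x in lborel. indicator E x * u x - indicator E x * w x = 0"
    using integral_nonneg_eq_0_iff_AE[OF _ nonneg] int[OF assms(1)] int[OF assms(2)] by simp
  then show ?thesis
    by eventually_elim (auto simp: E_def indicator_def split: if_splits)
qed

lemma L2_bounded_by_AE:
  assumes "f \<in> L2" and [measurable]: "g \<in> borel_measurable borel"
    and "AE x in lborel. (cmod (g x))\<^sup>2 \<le> C * (cmod (f x))\<^sup>2" "C \<ge> 0"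
  shows "g \<in> L2" "L2_norm_sq g \<le> C * L2_norm_sq f"
proof -
  have int: "integrable lborel (\<lambda>x. C * (cmod (f x))\<^sup>2)"
    by (intro integrable_mult_right L2_integrable assms)
  then have "integrable lborel (\<lambda>x. (cmod (g x))\<^sup>2)"
    by (rule Bochner_Integration.integrable_bound)
      (use assms(3,4) in \<open>auto elim!: eventually_mono\<close>)
  then show g: "g \<in> L2" by (simp add: L2_def)
  have "L2_norm_sq g \<le> (LINT x|lborel. C * (cmod (f x))\<^sup>2)"
    unfolding L2_norm_sq_def by (intro integral_mono_AE L2_integrable g int assms)
  then show "L2_norm_sq g \<le> C * L2_norm_sq f" by (simp add: L2_norm_sq_def)
qed

text \<open>
  The line is cut into translates of the period \<open>{0..<h}\<close>. The \<open>M = 2l\<close> cells \<open>\<sigma> i + {0..<h}\<close> are those with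
  \<open>m = i - l\<close> from \<open>-l\<close> to \<open>l - 1\<close>; together they cover the band. A function on the band corresponds to its
  family of restrictions to the cells, moved to the period, and conversely \<open>assemble\<close> glues such a family.
\<close>

locale cells =
  fixes \<omega> h :: real and l :: nat
  assumes h: "h > 0" and \<omega>_less: "\<omega> < real l * h"
begin

definition M :: nat where "M = 2 * l"

definition \<sigma> :: "nat \<Rightarrow> real" where "\<sigma> i = (real i - real l) * h"

definition cell :: "nat \<Rightarrow> (real \<Rightarrow> complex) \<Rightarrow> real \<Rightarrow> complex" where
  "cell i v x = indicator {0..<h} x * v (x + \<sigma> i)"

definition assemble :: "(nat \<Rightarrow> real \<Rightarrow> complex) \<Rightarrow> real \<Rightarrow> complex" where
  "assemble V \<xi> = (\<Sum>i<M. indicator {0..<h} (\<xi> - \<sigma> i) * V i (\<xi> - \<sigma> i))"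

lemma cell_eq_iff:
  assumes "x \<in> {0..<h}"
  shows "x + \<sigma> i - \<sigma> j \<in> {0..<h} \<longleftrightarrow> i = j"
proof
  assume *: "x + \<sigma> i - \<sigma> j \<in> {0..<h}"
  have eq: "x + \<sigma> i - \<sigma> j = x + (real i - real j) * h" by (simp add: \<sigma>_def algebra_simps)
  have "(real i - real j) * h < 1 * h" "(- 1) * h < (real i - real j) * h"
    using assms *[unfolded eq]
    by (simp_all only: atLeastLessThan_iff mult_1 mult_minus1) linarith+
  then have "real i - real j < 1" "- 1 < real i - real j"
    using h by (simp_all only: mult_less_cancel_right_pos)
  then show "i = j" by linarith
qed (use assms in simp)

lemma assemble_cell:
  assumes "x \<in> {0..<h}" "i < M"
  shows "assemble V (x + \<sigma> i) = V i x"
proof -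
  have "assemble V (x + \<sigma> i) = (\<Sum>j<M. if j = i then V i x else 0)"
    unfolding assemble_def using cell_eq_iff[OF assms(1), of i]
    by (intro sum.cong) (auto simp: indicator_def simp del: atLeastLessThan_iff)
  then show ?thesis using assms(2) by simp
qed

lemma cell_cover:
  assumes "\<xi> \<in> {-\<omega>..\<omega>}"
  obtains i x where "i < M" "x \<in> {0..<h}" "\<xi> = x + \<sigma> i"
proof -
  define k where "k = \<lfloor>\<xi> / h\<rfloor> + int l"
  have "- (real l * h) \<le> \<xi>" "\<xi> < real l * h" using assms \<omega>_less by auto
  then have "- real l \<le> \<xi> / h" "\<xi> / h < real l" using h by (simp_all add: field_simps)
  then have "0 \<le> k" "k < 2 * int l" unfolding k_def by linarith+
  then have "nat k < M" by (simp add: M_def)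
  moreover have "\<xi> - of_int \<lfloor>\<xi> / h\<rfloor> * h \<in> {0..<h}"
  proof -
    have "of_int \<lfloor>\<xi> / h\<rfloor> * h \<le> \<xi>" "\<xi> < (of_int \<lfloor>\<xi> / h\<rfloor> + 1) * h"
      using h by (rule floor_divide_lower floor_divide_upper)+
    then show ?thesis by (simp add: distrib_right)
  qed
  moreover have "\<xi> = (\<xi> - of_int \<lfloor>\<xi> / h\<rfloor> * h) + \<sigma> (nat k)"
    using \<open>0 \<le> k\<close> by (simp add: \<sigma>_def k_def)
  ultimately show ?thesis by (rule that)
qed

lemma sum_cells_indicator:
  assumes "\<And>\<xi>. \<xi> \<notin> {-\<omega>..\<omega>} \<Longrightarrow> u \<xi> = (0 :: 'a :: real_vector)"
  shows "(\<Sum>i<M. indicator {0..<h} (\<xi> - \<sigma> i) *\<^sub>R u \<xi>) = u \<xi>"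
proof (cases "\<xi> \<in> {-\<omega>..\<omega>}")
  case True
  then obtain j x where j: "j < M" "x \<in> {0..<h}" "\<xi> = x + \<sigma> j" by (rule cell_cover)
  have "(\<Sum>i<M. indicator {0..<h} (\<xi> - \<sigma> i) *\<^sub>R u \<xi>) = (\<Sum>i<M. if i = j then u \<xi> else 0)"
    unfolding j(3) using cell_eq_iff[OF j(2), of j]
    by (intro sum.cong) (auto simp: indicator_def simp del: atLeastLessThan_iff)
  then show ?thesis using j(1) by simp
qed (simp add: assms)

text \<open>
  Integrate cell by cell, after moving each cell to the period.
\<close>

lemma integral_fold:
  fixes u :: "real \<Rightarrow> 'a :: {banach, second_countable_topology}"
  assumes u: "integrable lborel u" and supp: "\<And>\<xi>. \<xi> \<notin> {-\<omega>..\<omega>} \<Longrightarrow> u \<xi> = 0"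
  shows "(LINT \<xi>|lborel. u \<xi>) = (LINT x|lborel. indicator {0..<h} x *\<^sub>R (\<Sum>i<M. u (x + \<sigma> i)))"
    and "integrable lborel (\<lambda>x. indicator {0..<h} x *\<^sub>R u (x + \<sigma> i))"
proof -
  have int: "integrable lborel (\<lambda>x. indicator {0..<h} x *\<^sub>R u (x + \<sigma> i))" for i
    using integrable_mult_indicator[OF _ lborel_integrable_real_affine[OF u, of 1 "\<sigma> i"], of "{0..<h}"]
    by (simp add: add.commute)
  then show "integrable lborel (\<lambda>x. indicator {0..<h} x *\<^sub>R u (x + \<sigma> i))" .
  have int': "integrable lborel (\<lambda>\<xi>. indicator {0..<h} (\<xi> - \<sigma> i) *\<^sub>R u \<xi>)" for i
    using lborel_integrable_real_affine[OF int[of i], of 1 "- \<sigma> i"] by simp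
  have "(\<Sum>i<M. indicator {0..<h} (\<xi> - \<sigma> i) *\<^sub>R u \<xi>) = u \<xi>" for \<xi>
    by (rule sum_cells_indicator) (rule supp)
  then have "(LINT \<xi>|lborel. u \<xi>) = (LINT \<xi>|lborel. (\<Sum>i<M. indicator {0..<h} (\<xi> - \<sigma> i) *\<^sub>R u \<xi>))"
    by simp
  also have "\<dots> = (\<Sum>i<M. (LINT \<xi>|lborel. indicator {0..<h} (\<xi> - \<sigma> i) *\<^sub>R u \<xi>))"
    by (rule Bochner_Integration.integral_sum) (rule int')
  also have "\<dots> = (\<Sum>i<M. (LINT x|lborel. indicator {0..<h} x *\<^sub>R u (x + \<sigma> i)))"
  proof (rule sum.cong[OF refl])
    fix i
    show "(LINT \<xi>|lborel. indicator {0..<h} (\<xi> - \<sigma> i) *\<^sub>R u \<xi>)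
        = (LINT x|lborel. indicator {0..<h} x *\<^sub>R u (x + \<sigma> i))"
      using lborel_integral_shift[of "\<lambda>\<xi>. indicator {0..<h} (\<xi> - \<sigma> i) *\<^sub>R u \<xi>" "\<sigma> i"] by simp
  qed
  also have "\<dots> = (LINT x|lborel. (\<Sum>i<M. indicator {0..<h} x *\<^sub>R u (x + \<sigma> i)))"
    by (rule Bochner_Integration.integral_sum[symmetric]) (rule int)
  finally show "(LINT \<xi>|lborel. u \<xi>) = (LINT x|lborel. indicator {0..<h} x *\<^sub>R (\<Sum>i<M. u (x + \<sigma> i)))"
    by (simp only: scaleR_sum_right)
qed

lemma cell_L2:
  assumes v: "v \<in> paley_wiener \<omega>"
  shows "cell i v \<in> L2"
proof -
  have [measurable]: "v \<in> borel_measurable borel" using v by (simp add: paley_wiener_def L2_def)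
  have "integrable lborel (\<lambda>x. indicator {0..<h} x *\<^sub>R (cmod (v (x + \<sigma> i)))\<^sup>2)"
    by (rule integral_fold(2)) (use v in \<open>auto simp: paley_wiener_def L2_integrable\<close>)
  moreover have "(\<lambda>x. indicator {0..<h} x *\<^sub>R (cmod (v (x + \<sigma> i)))\<^sup>2) = (\<lambda>x. (cmod (cell i v x))\<^sup>2)"
    by (auto simp: cell_def indicator_def)
  ultimately show ?thesis
    unfolding L2_def cell_def by simp
qed

lemma L2_norm_sq_cells:
  assumes v: "v \<in> paley_wiener \<omega>"
  shows "L2_norm_sq v = (\<Sum>i<M. L2_norm_sq (cell i v))"
proof -
  have "L2_norm_sq v = (LINT x|lborel. indicator {0..<h} x *\<^sub>R (\<Sum>i<M. (cmod (v (x + \<sigma> i)))\<^sup>2))"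
    unfolding L2_norm_sq_def
    by (rule integral_fold(1)) (use v in \<open>auto simp: paley_wiener_def L2_integrable\<close>)
  also have "(\<lambda>x. indicator {0..<h} x *\<^sub>R (\<Sum>i<M. (cmod (v (x + \<sigma> i)))\<^sup>2))
      = (\<lambda>x. \<Sum>i<M. (cmod (cell i v x))\<^sup>2)"
    by (auto simp: cell_def indicator_def)
  also have "(LINT x|lborel. (\<Sum>i<M. (cmod (cell i v x))\<^sup>2)) = (\<Sum>i<M. L2_norm_sq (cell i v))"
    unfolding L2_norm_sq_def
    by (rule Bochner_Integration.integral_sum) (rule L2_integrable[OF cell_L2[OF v]])
  finally show ?thesis .
qed

lemma assemble_paley_wiener:
  assumes V: "\<And>i. i < M \<Longrightarrow> V i \<in> borel_measurable borel"
    and L2: "\<And>i. i < M \<Longrightarrow> (\<lambda>x. indicator {0..<h} x * V i x) \<in> L2"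
    and supp: "\<And>i x. i < M \<Longrightarrow> x \<in> {0..<h} \<Longrightarrow> x + \<sigma> i \<notin> {-\<omega>..\<omega>} \<Longrightarrow> V i x = 0"
  shows "assemble V \<in> paley_wiener \<omega>"
proof -
  have "(\<lambda>\<xi>. indicator {0..<h} (\<xi> - \<sigma> i) * V i (\<xi> - \<sigma> i)) \<in> L2" if i: "i < M" for i
  proof -
    define g where "g x = indicator {0..<h} x * V i x" for x
    have g: "g \<in> L2" unfolding g_def by (rule L2[OF i])
    have [measurable]: "g \<in> borel_measurable borel" using g by (simp add: L2_def)
    have "integrable lborel (\<lambda>\<xi>. (cmod (g (- \<sigma> i + 1 * \<xi>)))\<^sup>2)"
      by (rule lborel_integrable_real_affine[OF L2_integrable[OF g]]) simp
    then have "(\<lambda>\<xi>. g (\<xi> - \<sigma> i)) \<in> L2" unfolding L2_def by simp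
    then show ?thesis by (simp only: g_def)
  qed
  then have "assemble V \<in> L2" unfolding assemble_def by (intro L2_sum) auto
  moreover have "assemble V \<xi> = 0" if "\<xi> \<notin> {-\<omega>..\<omega>}" for \<xi>
    unfolding assemble_def using that supp[of _ "\<xi> - \<sigma> _"]
    by (intro sum.neutral) (auto simp: indicator_def)
  ultimately show ?thesis by (simp add: paley_wiener_def)
qed

end

section \<open>The frame inequality on fibers\<close>

lemma L2_cnj: "f \<in> L2 \<Longrightarrow> (\<lambda>x. cnj (f x)) \<in> L2"
  unfolding L2_def by auto

lemma L2_translate:
  assumes "f \<in> L2"
  shows "translate a f \<in> L2"
proof -
  have [measurable]: "f \<in> borel_measurable borel" using assms by (simp add: L2_def)
  have "integrable lborel (\<lambda>x. (cmod (f (a + 1 * x)))\<^sup>2)"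
    by (rule lborel_integrable_real_affine[OF L2_integrable[OF assms]]) simp
  then show ?thesis unfolding L2_def translate_def by (simp add: add.commute)
qed

text \<open>
  The number \<open>N\<close> of generators and the number of cells are kept independent of each other until the end.
\<close>

locale frame_setup = cells \<omega> h l for \<omega> h :: real and l :: nat +
  fixes t\<^sub>0 :: real and N :: nat and \<phi> :: "nat \<Rightarrow> real \<Rightarrow> complex"
  assumes t\<^sub>0: "t\<^sub>0 > 0" "h = 2 * pi / t\<^sub>0"
    and \<phi>: "\<And>j. j \<in> {1..N} \<Longrightarrow> \<phi> j \<in> bandlimited \<omega>"
    and frame: "is_frame \<omega> t\<^sub>0 N \<phi>"
begin

definition \<phi>_hat :: "nat \<Rightarrow> real \<Rightarrow> complex" where
  "\<phi>_hat j = spectrum \<omega> (\<phi> j)"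

lemma \<phi>_hat_paley_wiener: "j \<in> {1..N} \<Longrightarrow> \<phi>_hat j \<in> paley_wiener \<omega>"
  unfolding \<phi>_hat_def by (rule spectrum_paley_wiener[OF \<phi>])

lemma \<phi>_hat_measurable: "j \<in> {1..N} \<Longrightarrow> \<phi>_hat j \<in> borel_measurable borel"
  using \<phi>_hat_paley_wiener[of j] by (simp add: paley_wiener_def L2_def)

lemma \<phi>_hat_support: "\<xi> \<notin> {-\<omega>..\<omega>} \<Longrightarrow> \<phi>_hat j \<xi> = 0"
  by (simp add: \<phi>_hat_def spectrum_def)

text \<open>
  The bracket product of the spectrum \<open>v\<close> with a generator: the \<open>j\<close>-th entry of \<open>cnj A(x)\<close> applied to
  the fiber of \<open>v\<close> over \<open>x\<close>.
\<close>

definition bracket :: "(real \<Rightarrow> complex) \<Rightarrow> nat \<Rightarrow> real \<Rightarrow> complex" where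
  "bracket v j x = indicator {0..<h} x * (\<Sum>i<M. v (x + \<sigma> i) * cnj (\<phi>_hat j (x + \<sigma> i)))"

lemma trig_h: "trig h n \<xi> = cis (of_int n * t\<^sub>0 * \<xi>)"
  using t\<^sub>0 by (simp add: trig_def mult_ac)

lemma trig_shift: "trig h n (x + \<sigma> i) = trig h n x"
proof -
  have "2 * pi * of_int n * (x + \<sigma> i) / h
      = 2 * pi * of_int n * x / h + 2 * pi * of_int (n * (int i - int l))"
    using h by (simp add: \<sigma>_def field_simps)
  then have "trig h n (x + \<sigma> i) = trig h n x * cis (2 * pi * of_int (n * (int i - int l)))"
    by (simp only: trig_def cis_mult)
  also have "cis (2 * pi * of_int (n * (int i - int l))) = 1"
    by (rule cis_multiple_2pi) simp
  finally show ?thesis by simp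
qed

lemma frame_coeff:
  assumes f: "f \<in> L2" and v: "v \<in> paley_wiener \<omega>" and eq: "AE x in lborel. f x = inv_FT v x"
    and j: "j \<in> {1..N}"
  shows "L2_inner f (translate (of_int n * t\<^sub>0) (\<phi> j)) = trig_coeff h (bracket v j) n"
proof -
  define w where "w \<xi> = trig h n \<xi> * \<phi>_hat j \<xi>" for \<xi>
  have w: "w \<in> paley_wiener \<omega>"
    unfolding w_def by (rule paley_wiener_mult_bounded[OF \<phi>_hat_paley_wiener[OF j], where C = 1]) auto
  have \<phi>L2: "\<phi> j \<in> L2" using \<phi>[OF j] by (simp add: bandlimited_def)
  have "AE x in lborel. \<phi> j x = inv_FT (\<phi>_hat j) x"
    unfolding \<phi>_hat_def by (rule bandlimited_eq_inv_FT[OF \<phi>[OF j]])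
  then have "AE x in lborel. \<phi> j (x + of_int n * t\<^sub>0) = inv_FT (\<phi>_hat j) (x + of_int n * t\<^sub>0)"
    by (rule AE_lborel_shift)
  moreover have "translate (of_int n * t\<^sub>0) (inv_FT (\<phi>_hat j)) = inv_FT w"
    unfolding translate_inv_FT w_def trig_h ..
  ultimately have "AE x in lborel. translate (of_int n * t\<^sub>0) (\<phi> j) x = inv_FT w x"
    by (simp add: translate_def fun_eq_iff)
  then have "L2_inner f (translate (of_int n * t\<^sub>0) (\<phi> j)) = L2_inner (inv_FT v) (inv_FT w)"
    using eq f L2_translate[OF \<phi>L2] inv_FT_paley_wiener(1)[OF v] inv_FT_paley_wiener(1)[OF w]
    by (intro L2_inner_cong_AE) (auto simp: L2_def)
  also have "\<dots> = (LINT \<xi>|lborel. v \<xi> * cnj (w \<xi>))"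
    using L2_inner_inv_FT[OF v w] by (simp only: L2_inner_def)
  also have "\<dots> = (LINT x|lborel. indicator {0..<h} x *\<^sub>R (\<Sum>i<M. v (x + \<sigma> i) * cnj (w (x + \<sigma> i))))"
  proof (rule integral_fold(1))
    show "integrable lborel (\<lambda>\<xi>. v \<xi> * cnj (w \<xi>))"
      using v w by (intro L2_inner_integrable) (auto simp: paley_wiener_def)
  qed (use v in \<open>auto simp: paley_wiener_def\<close>)
  also have "\<dots> = trig_coeff h (bracket v j) n"
    unfolding trig_coeff_def
  proof (rule Bochner_Integration.integral_cong)
    fix x
    have "(\<Sum>i<M. v (x + \<sigma> i) * cnj (w (x + \<sigma> i)))
        = (\<Sum>i<M. v (x + \<sigma> i) * cnj (\<phi>_hat j (x + \<sigma> i))) * cnj (trig h n x)"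
      unfolding sum_distrib_right w_def trig_shift by (simp add: mult_ac)
    then show "indicator {0..<h} x *\<^sub>R (\<Sum>i<M. v (x + \<sigma> i) * cnj (w (x + \<sigma> i)))
        = bracket v j x * cnj (trig h n x)"
      by (simp add: bracket_def indicator_def)
  qed simp
  finally show ?thesis .
qed

lemma bracket_support: "x \<notin> {0..<0 + h} \<Longrightarrow> bracket v j x = 0"
  by (simp add: bracket_def)

lemma frame_bounds:
  "\<exists>A>0. \<exists>B>0. \<forall>v\<in>paley_wiener \<omega>. (\<forall>j\<in>{1..N}. bracket v j \<in> L2) \<longrightarrow>
      A * L2_norm_sq v \<le> h * (\<Sum>j=1..N. L2_norm_sq (bracket v j)) \<and>
      h * (\<Sum>j=1..N. L2_norm_sq (bracket v j)) \<le> B * L2_norm_sq v"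
proof -
  obtain A B where AB: "0 < A" "A \<le> B" and bounds: "\<And>f. f \<in> bandlimited \<omega> \<Longrightarrow>
       A * L2_norm_sq f
         \<le> (\<Sum>j=1..N. \<Sum>\<^sub>\<infinity>n::int. (cmod (L2_inner f (translate (of_int n * t\<^sub>0) (\<phi> j))))\<^sup>2) \<and>
       (\<Sum>j=1..N. \<Sum>\<^sub>\<infinity>n::int. (cmod (L2_inner f (translate (of_int n * t\<^sub>0) (\<phi> j))))\<^sup>2)
         \<le> B * L2_norm_sq f"
    using frame unfolding is_frame_def by blast
  have "\<forall>v\<in>paley_wiener \<omega>. (\<forall>j\<in>{1..N}. bracket v j \<in> L2) \<longrightarrow>
      A * L2_norm_sq v \<le> h * (\<Sum>j=1..N. L2_norm_sq (bracket v j)) \<and>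
      h * (\<Sum>j=1..N. L2_norm_sq (bracket v j)) \<le> B * L2_norm_sq v"
  proof (intro conjI ballI impI)
    fix v assume v: "v \<in> paley_wiener \<omega>" and "\<forall>j\<in>{1..N}. bracket v j \<in> L2"
    then have b: "\<And>j. j \<in> {1..N} \<Longrightarrow> bracket v j \<in> L2" by blast
    have "(\<Sum>\<^sub>\<infinity>n::int. (cmod (L2_inner (inv_FT v) (translate (of_int n * t\<^sub>0) (\<phi> j))))\<^sup>2)
        = h * L2_norm_sq (bracket v j)" if j: "j \<in> {1..N}" for j
      unfolding frame_coeff[OF inv_FT_paley_wiener(1)[OF v] v AE_I2[OF refl] j]
      by (rule infsumI, rule parseval[where a = 0, OF h b[OF j]]) (rule bracket_support)
    then have le: "A * L2_norm_sq v \<le> h * (\<Sum>j=1..N. L2_norm_sq (bracket v j))"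
        "h * (\<Sum>j=1..N. L2_norm_sq (bracket v j)) \<le> B * L2_norm_sq v"
      using bounds[OF inv_FT_bandlimited[OF v]]
      by (simp_all add: inv_FT_paley_wiener(2)[OF v] sum_distrib_left)
    show "A * L2_norm_sq v \<le> h * (\<Sum>j=1..N. L2_norm_sq (bracket v j))" by (rule le)
    show "h * (\<Sum>j=1..N. L2_norm_sq (bracket v j)) \<le> B * L2_norm_sq v" by (rule le)
  qed
  moreover have "0 < B" using AB by linarith
  ultimately show ?thesis using AB(1) by blast
qed

definition band :: "nat \<Rightarrow> real \<Rightarrow> real" where
  "band i x = indicator {-\<omega>..\<omega>} (x + \<sigma> i)"

lemma band_measurable [measurable]: "band i \<in> borel_measurable borel"
  unfolding band_def by measurable

text \<open>
  For a vector \<open>c\<close>, indexed by the cells, these are the two sides of the frame inequality on the fiber over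
  \<open>x\<close>: its squared norm, where cells outside the band do not count, and \<open>h |cnj A(x) c|\<^sup>2\<close>.
\<close>

definition weight :: "(nat \<Rightarrow> complex) \<Rightarrow> real \<Rightarrow> real" where
  "weight c x = (\<Sum>i<M. (cmod (c i))\<^sup>2 * band i x)"

definition energy :: "(nat \<Rightarrow> complex) \<Rightarrow> real \<Rightarrow> real" where
  "energy c x = h * (\<Sum>j=1..N. (cmod (\<Sum>i<M. c i * cnj (\<phi>_hat j (x + \<sigma> i))))\<^sup>2)"

text \<open>
  The frame inequality for the function whose spectrum is \<open>c i\<close> on the translate of a set \<open>E\<close> to the
  \<open>i\<close>-th cell is the integral over \<open>E\<close> of an inequality between functions of \<open>x\<close>; as \<open>E\<close> is
  arbitrary, that inequality holds almost everywhere.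
\<close>

lemma frame_bounds_fixed_vector:
  "\<exists>A>0. \<exists>B>0. \<forall>c. AE x in lborel. x \<in> {0..<h} \<longrightarrow>
      A * weight c x \<le> energy c x \<and> energy c x \<le> B * weight c x"
proof -
  obtain A B where AB: "0 < A" "0 < B" and bounds: "\<forall>v\<in>paley_wiener \<omega>.
      (\<forall>j\<in>{1..N}. bracket v j \<in> L2) \<longrightarrow>
      A * L2_norm_sq v \<le> h * (\<Sum>j=1..N. L2_norm_sq (bracket v j)) \<and>
      h * (\<Sum>j=1..N. L2_norm_sq (bracket v j)) \<le> B * L2_norm_sq v"
    using frame_bounds by blast
  have "AE x in lborel. x \<in> {0..<h} \<longrightarrow>
      A * weight c x \<le> energy c x \<and> energy c x \<le> B * weight c x"
    for c :: "nat \<Rightarrow> complex"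
  proof -
    define \<alpha> where "\<alpha> i x = (cmod (c i))\<^sup>2 * (indicator {0..<h} x * band i x)" for i x
    define g where "g j x = indicator {0..<h} x * (\<Sum>i<M. c i * cnj (\<phi>_hat j (x + \<sigma> i)))" for j x
    have g: "g j \<in> L2" if j: "j \<in> {1..N}" for j
    proof -
      have "g j = (\<lambda>x. \<Sum>i<M. c i * cnj (cell i (\<phi>_hat j) x))"
        by (auto simp: fun_eq_iff g_def cell_def indicator_def)
      then show ?thesis
        using j by (simp only:) (intro L2_sum L2_scale L2_cnj cell_L2 \<phi>_hat_paley_wiener)
    qed
    have int_\<alpha>: "integrable lborel (\<alpha> i)" for i
    proof -
      have "integrable lborel (\<lambda>x. indicator {0..<0 + h} x :: real)"
        by (rule integrable_indicator_Ico)
      then have "integrable lborel (\<lambda>x. indicator {0..<h} x * band i x)"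
        by (rule Bochner_Integration.integrable_bound) (auto simp: band_def indicator_def)
      then show ?thesis unfolding \<alpha>_def by (rule integrable_mult_right)
    qed
    have int_sum: "integrable lborel (\<lambda>x. C * (\<Sum>i<M. \<alpha> i x))" for C
      by (intro integrable_mult_right Bochner_Integration.integrable_sum int_\<alpha>)
    have int_g: "integrable lborel (\<lambda>x. h * (\<Sum>j=1..N. (cmod (g j x))\<^sup>2))"
      by (intro integrable_mult_right Bochner_Integration.integrable_sum L2_integrable g)
    have tested: "A * (\<Sum>i<M. (LINT x|lborel. indicator E x * \<alpha> i x))
          \<le> h * (\<Sum>j=1..N. (LINT x|lborel. indicator E x * (cmod (g j x))\<^sup>2)) \<and>
        h * (\<Sum>j=1..N. (LINT x|lborel. indicator E x * (cmod (g j x))\<^sup>2))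
          \<le> B * (\<Sum>i<M. (LINT x|lborel. indicator E x * \<alpha> i x))"
      if E [measurable]: "E \<in> sets borel" for E
    proof -
      define V where "V i x = c i * (indicator E x * of_real (band i x))" for i x
      define v where "v = assemble V"
      have v: "v \<in> paley_wiener \<omega>"
        unfolding v_def
      proof (rule assemble_paley_wiener)
        show "V i \<in> borel_measurable borel" for i unfolding V_def by measurable
        then show "(\<lambda>x. indicator {0..<h} x * V i x) \<in> L2" for i
          using L2_bounded_on_interval[of "V i" 0 h "cmod (c i)"]
          by (auto simp: V_def band_def indicator_def norm_mult)
        show "V i x = 0" if "x + \<sigma> i \<notin> {-\<omega>..\<omega>}" for i x
          using that by (simp add: V_def band_def)
      qed
      have cell_v: "cell i v x = indicator {0..<h} x * V i x" if "i < M" for i x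
        using assemble_cell[OF _ that, of x V] by (auto simp: cell_def v_def indicator_def)
      have bracket_v: "bracket v j x = indicator E x * g j x" for j x
      proof (cases "x \<in> {0..<h}")
        case True
        have "v (x + \<sigma> i) * cnj (\<phi>_hat j (x + \<sigma> i)) = indicator E x * (c i * cnj (\<phi>_hat j (x + \<sigma> i)))" if "i < M" for i
          using assemble_cell[OF True that, of V] \<phi>_hat_support[of "x + \<sigma> i" j]
          by (cases "x + \<sigma> i \<in> {-\<omega>..\<omega>}") (simp_all add: v_def V_def band_def)
        then have "(\<Sum>i<M. v (x + \<sigma> i) * cnj (\<phi>_hat j (x + \<sigma> i)))
            = (\<Sum>i<M. indicator E x * (c i * cnj (\<phi>_hat j (x + \<sigma> i))))"
          by (intro sum.cong) simp_all
        then show ?thesis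
          using True by (simp only: bracket_def g_def indicator_simps mult_1 sum_distrib_left)
      qed (simp add: bracket_def g_def)
      have "bracket v j \<in> L2" if "j \<in> {1..N}" for j
        unfolding bracket_v[abs_def] by (rule L2_indicator[OF g[OF that] E])
      with bounds v have b: "A * L2_norm_sq v \<le> h * (\<Sum>j=1..N. L2_norm_sq (bracket v j)) \<and>
          h * (\<Sum>j=1..N. L2_norm_sq (bracket v j)) \<le> B * L2_norm_sq v"
        by blast
      have "L2_norm_sq (bracket v j) = (LINT x|lborel. indicator E x * (cmod (g j x))\<^sup>2)" for j
        unfolding L2_norm_sq_def bracket_v
        by (rule Bochner_Integration.integral_cong) (auto simp: indicator_def)
      moreover have "L2_norm_sq v = (\<Sum>i<M. (LINT x|lborel. indicator E x * \<alpha> i x))"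
        unfolding L2_norm_sq_cells[OF v]
      proof (rule sum.cong[OF refl])
        fix i assume "i \<in> {..<M}"
        then show "L2_norm_sq (cell i v) = (LINT x|lborel. indicator E x * \<alpha> i x)"
          unfolding L2_norm_sq_def
          by (intro Bochner_Integration.integral_cong)
            (auto simp: cell_v V_def \<alpha>_def band_def indicator_def)
      qed
      ultimately show ?thesis using b by simp
    qed
    have int_ind: "integrable lborel (\<lambda>x. indicator E x * u x)" if "integrable lborel u" "E \<in> sets borel"
      for u :: "real \<Rightarrow> real" and E
      using integrable_mult_indicator[OF _ that(1), of E] that(2) by simp
    have sum_\<alpha>: "(LINT x|lborel. indicator E x * (C * (\<Sum>i<M. \<alpha> i x)))
        = C * (\<Sum>i<M. (LINT x|lborel. indicator E x * \<alpha> i x))" if "E \<in> sets borel" for C E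
    proof -
      have "(\<lambda>x. indicator E x * (C * (\<Sum>i<M. \<alpha> i x))) = (\<lambda>x. C * (\<Sum>i<M. indicator E x * \<alpha> i x))"
        by (simp only: sum_distrib_left mult.left_commute)
      then show ?thesis
        by (simp only: Bochner_Integration.integral_sum[OF int_ind[OF int_\<alpha> that]] integral_mult_right_zero)
    qed
    have sum_g: "(LINT x|lborel. indicator E x * (h * (\<Sum>j=1..N. (cmod (g j x))\<^sup>2)))
        = h * (\<Sum>j=1..N. (LINT x|lborel. indicator E x * (cmod (g j x))\<^sup>2))" if "E \<in> sets borel" for E
    proof -
      have "(\<lambda>x. indicator E x * (h * (\<Sum>j=1..N. (cmod (g j x))\<^sup>2)))
          = (\<lambda>x. h * (\<Sum>j=1..N. indicator E x * (cmod (g j x))\<^sup>2))"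
        by (simp only: sum_distrib_left mult.left_commute)
      then show ?thesis
        by (simp only: Bochner_Integration.integral_sum[OF int_ind[OF L2_integrable[OF g] that]] integral_mult_right_zero)
    qed
    have "AE x in lborel. A * (\<Sum>i<M. \<alpha> i x) \<le> h * (\<Sum>j=1..N. (cmod (g j x))\<^sup>2)"
      by (rule AE_le_of_set_integral_le[OF int_sum int_g]) (simp only: sum_\<alpha> sum_g tested)
    moreover have "AE x in lborel. h * (\<Sum>j=1..N. (cmod (g j x))\<^sup>2) \<le> B * (\<Sum>i<M. \<alpha> i x)"
      by (rule AE_le_of_set_integral_le[OF int_g int_sum]) (simp only: sum_\<alpha> sum_g tested)
    ultimately show ?thesis
      by eventually_elim (auto simp: \<alpha>_def g_def weight_def energy_def)
  qed
  with AB show ?thesis by blast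
qed

text \<open>Both sides are continuous in the vector, so a countable dense set of vectors suffices.\<close>

lemma frame_bounds_AE:
  "\<exists>A>0. \<exists>B>0. AE x in lborel. x \<in> {0..<h} \<longrightarrow> (\<forall>c.
      A * weight c x \<le> energy c x \<and> energy c x \<le> B * weight c x)"
proof -
  obtain A B where AB: "0 < A" "0 < B" and fixed: "\<And>c. AE x in lborel. x \<in> {0..<h} \<longrightarrow>
      A * weight c x \<le> energy c x \<and> energy c x \<le> B * weight c x"
    using frame_bounds_fixed_vector by blast
  (* The exceptional null set depends on the vector, so only countably many vectors can be tested. *)
  obtain D :: "complex set" where D: "countable D" "\<And>X. open X \<Longrightarrow> X \<noteq> {} \<Longrightarrow> \<exists>d\<in>D. d \<in> X"
    by (erule countable_dense_setE)
  define S where "S = PiE {..<M} (\<lambda>_. D)"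
  have S: "countable S" unfolding S_def by (intro countable_PiE D) auto
  have "AE x in lborel. \<forall>c\<in>S. x \<in> {0..<h} \<longrightarrow> A * weight c x \<le> energy c x \<and> energy c x \<le> B * weight c x"
    unfolding AE_ball_countable[OF S] using fixed by blast
  then have "AE x in lborel. x \<in> {0..<h} \<longrightarrow> (\<forall>c. A * weight c x \<le> energy c x \<and> energy c x \<le> B * weight c x)"
  proof eventually_elim
    case (elim x)
    show ?case
    proof (intro impI allI)
      fix c :: "nat \<Rightarrow> complex" assume x: "x \<in> {0..<h}"
      have "\<exists>d\<in>D. d \<in> ball (c i) (1 / real (Suc n))" for i n
        by (rule D(2)) auto
      then obtain e where e: "\<forall>i n. e i n \<in> D \<and> dist (c i) (e i n) < 1 / real (Suc n)"
        by (metis mem_ball)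
      define d where "d n i = e i n" for n i
      have d: "\<And>i n. d n i \<in> D" "\<And>i n. dist (c i) (d n i) < 1 / real (Suc n)"
        unfolding d_def using e by blast+
      have lim: "(\<lambda>n. d n i) \<longlonglongrightarrow> c i" for i
      proof (rule LIMSEQ_I)
        fix r :: real assume "r > 0"
        then obtain n0 where n0: "1 / real (Suc n0) < r" using nat_approx_posE by blast
        have "norm (d n i - c i) < r" if "n \<ge> n0" for n
        proof -
          have "norm (d n i - c i) < 1 / real (Suc n)"
            using d(2)[of i n] by (simp add: dist_norm norm_minus_commute)
          also have "\<dots> \<le> 1 / real (Suc n0)" using that by (simp add: frac_le)
          finally show ?thesis using n0 by simp
        qed
        then show "\<exists>n0. \<forall>n\<ge>n0. norm (d n i - c i) < r" by blast
      qed
      have rest: "weight (restrict (d n) {..<M}) x = weight (d n) x" "energy (restrict (d n) {..<M}) x = energy (d n) x" for n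
        unfolding weight_def energy_def by simp_all
      have "restrict (d n) {..<M} \<in> S" for n unfolding S_def using d(1) by auto
      then have "A * weight (restrict (d n) {..<M}) x \<le> energy (restrict (d n) {..<M}) x \<and>
          energy (restrict (d n) {..<M}) x \<le> B * weight (restrict (d n) {..<M}) x" for n
        using elim x by blast
      then have bounds: "A * weight (d n) x \<le> energy (d n) x" "energy (d n) x \<le> B * weight (d n) x" for n
        unfolding rest by blast+
      have lim_weight: "(\<lambda>n. C * weight (d n) x) \<longlonglongrightarrow> C * weight c x" for C
        unfolding weight_def by (intro tendsto_intros lim)
      have lim_energy: "(\<lambda>n. energy (d n) x) \<longlonglongrightarrow> energy c x"
        unfolding energy_def by (intro tendsto_intros lim)
      show "A * weight c x \<le> energy c x \<and> energy c x \<le> B * weight c x"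
        using LIMSEQ_le[OF lim_weight lim_energy] LIMSEQ_le[OF lim_energy lim_weight] bounds by blast
    qed
  qed
  with AB show ?thesis by blast
qed

end

section \<open>The frame operator on fibers\<close>

text \<open>
  With this, the sum over pairs \<open>(j, n)\<close> can be taken to the limit separately in each Fourier series over \<open>n\<close>.
\<close>

lemma filterlim_section:
  assumes "j \<in> J"
  shows "filterlim (\<lambda>F. F `` {j}) (finite_subsets_at_top UNIV) (finite_subsets_at_top (J \<times> UNIV))"
  unfolding filterlim_iff
proof (intro allI impI)
  fix P :: "'b set \<Rightarrow> bool" assume "\<forall>\<^sub>F G in finite_subsets_at_top UNIV. P G"
  then obtain G where G: "finite G" "\<And>G'. finite G' \<Longrightarrow> G \<subseteq> G' \<Longrightarrow> P G'"
    unfolding eventually_finite_subsets_at_top by auto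
  show "\<forall>\<^sub>F F in finite_subsets_at_top (J \<times> UNIV). P (F `` {j})"
    unfolding eventually_finite_subsets_at_top
  proof (intro exI[of _ "{j} \<times> G"] conjI allI impI)
    fix F assume F: "finite F \<and> {j} \<times> G \<subseteq> F \<and> F \<subseteq> J \<times> UNIV"
    show "P (F `` {j})" using F by (intro G(2) finite_Image) auto
  qed (use assms G(1) in auto)
qed

context frame_setup
begin

text \<open>
  The upper frame bound for the \<open>i\<close>-th unit vector.
\<close>

lemma \<phi>_hat_bounded:
  "\<exists>C\<ge>0. AE x in lborel. x \<in> {0..<h} \<longrightarrow> (\<forall>i<M. \<forall>j\<in>{1..N}. (cmod (\<phi>_hat j (x + \<sigma> i)))\<^sup>2 \<le> C)"
proof -
  obtain B where B: "B > 0" "AE x in lborel. x \<in> {0..<h} \<longrightarrow> (\<forall>c.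
      energy c x \<le> B * weight c x)"
  proof -
    obtain A B where "B > 0" "AE x in lborel. x \<in> {0..<h} \<longrightarrow> (\<forall>c.
      A * weight c x \<le> energy c x \<and> energy c x \<le> B * weight c x)"
      using frame_bounds_AE by blast
    then show thesis by (intro that[of B]) (auto elim!: eventually_mono)
  qed
  have "AE x in lborel. x \<in> {0..<h} \<longrightarrow> (\<forall>i<M. \<forall>j\<in>{1..N}. (cmod (\<phi>_hat j (x + \<sigma> i)))\<^sup>2 \<le> B / h)"
    using B(2)
  proof eventually_elim
    case (elim x)
    show ?case
    proof (intro impI allI ballI)
      fix i j assume x: "x \<in> {0..<h}" and i: "i < M" and j: "j \<in> {1..N}"
      define c :: "nat \<Rightarrow> complex" where "c k = (if k = i then 1 else 0)" for k
      have combination: "(\<Sum>k<M. c k * cnj (\<phi>_hat j (x + \<sigma> k))) = cnj (\<phi>_hat j (x + \<sigma> i))" for j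
      proof -
        have "(\<Sum>k<M. c k * cnj (\<phi>_hat j (x + \<sigma> k))) = (\<Sum>k<M. if k = i then cnj (\<phi>_hat j (x + \<sigma> i)) else 0)"
          by (intro sum.cong) (auto simp: c_def)
        then show ?thesis using i by simp
      qed
      have "(\<Sum>k<M. (cmod (c k))\<^sup>2 * band k x) = (\<Sum>k<M. if k = i then band i x else 0)"
        by (intro sum.cong) (auto simp: c_def)
      then have weight_c: "(\<Sum>k<M. (cmod (c k))\<^sup>2 * band k x) = band i x" using i by simp
      have "energy c x \<le> B * weight c x"
        using elim x by blast
      then have "h * (\<Sum>j=1..N. (cmod (\<phi>_hat j (x + \<sigma> i)))\<^sup>2) \<le> B * band i x"
        unfolding energy_def weight_def combination weight_c complex_mod_cnj .
      also have "\<dots> \<le> B" using B(1) by (simp add: band_def indicator_def)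
      finally have "(\<Sum>j=1..N. (cmod (\<phi>_hat j (x + \<sigma> i)))\<^sup>2) \<le> B / h"
        using h by (simp add: field_simps)
      moreover have "(cmod (\<phi>_hat j (x + \<sigma> i)))\<^sup>2 \<le> (\<Sum>j=1..N. (cmod (\<phi>_hat j (x + \<sigma> i)))\<^sup>2)"
        using j by (intro member_le_sum) auto
      ultimately show "(cmod (\<phi>_hat j (x + \<sigma> i)))\<^sup>2 \<le> B / h" by linarith
    qed
  qed
  moreover have "B / h \<ge> 0" using B(1) h by simp
  ultimately show ?thesis by blast
qed

definition bound :: real where
  "bound = (SOME C. C \<ge> 0 \<and> (AE x in lborel. x \<in> {0..<h} \<longrightarrow> (\<forall>i<M. \<forall>j\<in>{1..N}. (cmod (\<phi>_hat j (x + \<sigma> i)))\<^sup>2 \<le> C)))"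

lemma bound: "bound \<ge> 0"
    "AE x in lborel. x \<in> {0..<h} \<longrightarrow> (\<forall>i<M. \<forall>j\<in>{1..N}. (cmod (\<phi>_hat j (x + \<sigma> i)))\<^sup>2 \<le> bound)"
  unfolding bound_def using someI_ex[OF \<phi>_hat_bounded] by blast+

lemma L2_mult_generator:
  assumes f: "f \<in> L2" and supp: "\<And>x. x \<notin> {0..<h} \<Longrightarrow> f x = 0" and ij: "i < M" "j \<in> {1..N}"
  shows "(\<lambda>x. f x * \<phi>_hat j (x + \<sigma> i)) \<in> L2"
    "L2_norm_sq (\<lambda>x. f x * \<phi>_hat j (x + \<sigma> i)) \<le> bound * L2_norm_sq f"
proof -
  have [measurable]: "f \<in> borel_measurable borel" "\<phi>_hat j \<in> borel_measurable borel"
    using f \<phi>_hat_measurable[OF ij(2)] by (simp_all add: L2_def)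
  have meas: "(\<lambda>x. f x * \<phi>_hat j (x + \<sigma> i)) \<in> borel_measurable borel" by measurable
  have "AE x in lborel. (cmod (f x * \<phi>_hat j (x + \<sigma> i)))\<^sup>2 \<le> bound * (cmod (f x))\<^sup>2"
    using bound(2)
  proof eventually_elim
    case (elim x)
    show ?case
    proof (cases "x \<in> {0..<h}")
      case True
      then have "(cmod (\<phi>_hat j (x + \<sigma> i)))\<^sup>2 \<le> bound" using elim ij by blast
      then have "(cmod (f x))\<^sup>2 * (cmod (\<phi>_hat j (x + \<sigma> i)))\<^sup>2 \<le> (cmod (f x))\<^sup>2 * bound"
        by (rule mult_left_mono) simp
      then show ?thesis by (simp add: norm_mult power_mult_distrib mult.commute)
    qed (simp add: supp)
  qed
  from L2_bounded_by_AE[OF f meas this bound(1)]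
  show "(\<lambda>x. f x * \<phi>_hat j (x + \<sigma> i)) \<in> L2"
    "L2_norm_sq (\<lambda>x. f x * \<phi>_hat j (x + \<sigma> i)) \<le> bound * L2_norm_sq f" by blast+
qed

lemma bracket_L2:
  assumes v: "v \<in> paley_wiener \<omega>" and j: "j \<in> {1..N}"
  shows "bracket v j \<in> L2"
proof -
  have "(\<lambda>x. cnj (cell i v x) * \<phi>_hat j (x + \<sigma> i)) \<in> L2" if "i < M" for i
    by (rule L2_mult_generator(1)[OF L2_cnj[OF cell_L2[OF v]] _ that j]) (simp add: cell_def)
  then have "(\<lambda>x. \<Sum>i<M. cnj (cnj (cell i v x) * \<phi>_hat j (x + \<sigma> i))) \<in> L2"
    by (intro L2_sum L2_cnj) auto
  moreover have "bracket v j = (\<lambda>x. \<Sum>i<M. cnj (cnj (cell i v x) * \<phi>_hat j (x + \<sigma> i)))"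
    by (simp add: fun_eq_iff bracket_def cell_def sum_distrib_left mult.assoc)
  ultimately show ?thesis by simp
qed

text \<open>
  The frame operator in terms of spectra: multiplication of the fibers by \<open>h A(x)\<^sup>T cnj A(x)\<close>.
\<close>

definition fiber_op :: "(real \<Rightarrow> complex) \<Rightarrow> real \<Rightarrow> complex" where
  "fiber_op v = assemble (\<lambda>i x. of_real h * (\<Sum>j=1..N. bracket v j x * \<phi>_hat j (x + \<sigma> i)))"

lemma fiber_op_paley_wiener:
  assumes v: "v \<in> paley_wiener \<omega>"
  shows "fiber_op v \<in> paley_wiener \<omega>"
  unfolding fiber_op_def
proof (rule assemble_paley_wiener)
  have [measurable]: "\<phi>_hat j \<in> borel_measurable borel" "bracket v j \<in> borel_measurable borel"
    if "j \<in> {1..N}" for j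
    using \<phi>_hat_measurable[OF that] bracket_L2[OF v that] by (simp_all add: L2_def)
  show "(\<lambda>x. of_real h * (\<Sum>j=1..N. bracket v j x * \<phi>_hat j (x + \<sigma> i))) \<in> borel_measurable borel" for i
    by measurable
  show "(\<lambda>x. indicator {0..<h} x * (of_real h * (\<Sum>j=1..N. bracket v j x * \<phi>_hat j (x + \<sigma> i)))) \<in> L2"
    if i: "i < M" for i
    by (intro L2_indicator L2_scale L2_sum L2_mult_generator bracket_L2 v i) (auto simp: bracket_def)
  show "of_real h * (\<Sum>j=1..N. bracket v j x * \<phi>_hat j (x + \<sigma> i)) = 0" if "x + \<sigma> i \<notin> {-\<omega>..\<omega>}" for i x
    using \<phi>_hat_support[OF that] by simp
qed

definition synthesis :: "(real \<Rightarrow> complex) \<Rightarrow> (nat \<times> int) set \<Rightarrow> real \<Rightarrow> complex" where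
  "synthesis v F \<xi> = (\<Sum>(j, n)\<in>F. trig_coeff h (bracket v j) n * (trig h n \<xi> * \<phi>_hat j \<xi>))"

lemma synthesis_pw:
  assumes "F \<subseteq> {1..N} \<times> UNIV"
  shows "synthesis v F \<in> paley_wiener \<omega>"
proof -
  have "(\<lambda>\<xi>. \<Sum>k\<in>F. trig_coeff h (bracket v (fst k)) (snd k) * (trig h (snd k) \<xi> * \<phi>_hat (fst k) \<xi>))
      \<in> paley_wiener \<omega>"
  proof (intro paley_wiener_sum paley_wiener_scale)
    fix k assume "k \<in> F"
    then have "fst k \<in> {1..N}" using assms by auto
    then show "(\<lambda>\<xi>. trig h (snd k) \<xi> * \<phi>_hat (fst k) \<xi>) \<in> paley_wiener \<omega>"
      by (intro paley_wiener_mult_bounded[where C = 1] \<phi>_hat_paley_wiener) auto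
  qed
  then show ?thesis by (simp add: synthesis_def[abs_def] case_prod_beta')
qed

text \<open>
  On each cell the synthesis series is a combination of the Fourier series of the brackets, with the
  almost everywhere bounded coefficients \<open>\<phi>_hat j (x + \<sigma> i)\<close>.
\<close>

lemma synthesis_tendsto:
  assumes v: "v \<in> paley_wiener \<omega>"
  shows "((\<lambda>F. L2_norm_sq (\<lambda>\<xi>. synthesis v F \<xi> - fiber_op v \<xi>)) \<longlongrightarrow> 0) (finite_subsets_at_top ({1..N} \<times> UNIV))"
proof -
  define D where "D j G x = indicator {0..<0 + h} x * (\<Sum>n\<in>G. trig_coeff h (bracket v j) n * trig h n x)
      - of_real h * bracket v j x" for j G x
  have D_L2: "D j G \<in> L2" if "j \<in> {1..N}" for j G
    unfolding D_def
  proof (intro L2_diff L2_scale bracket_L2 v that)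
    have "(\<lambda>x. \<Sum>n\<in>G. trig_coeff h (bracket v j) n * (indicator {0..<0 + h} x * trig h n x)) \<in> L2"
      by (intro L2_sum L2_scale L2_trig)
    then show "(\<lambda>x. indicator {0..<0 + h} x * (\<Sum>n\<in>G. trig_coeff h (bracket v j) n * trig h n x)) \<in> L2"
      by (simp only: sum_distrib_left mult.left_commute)
  qed
  have D_supp: "D j G x = 0" if "x \<notin> {0..<h}" for j G x
    using that by (simp add: D_def bracket_def)
  have D_lim: "((\<lambda>F. L2_norm_sq (D j (F `` {j}))) \<longlongrightarrow> 0) (finite_subsets_at_top ({1..N} \<times> UNIV))"
    if j: "j \<in> {1..N}" for j
  proof -
    have "((\<lambda>G. L2_norm_sq (D j G)) \<longlongrightarrow> 0) (finite_subsets_at_top UNIV)"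
      unfolding D_def by (rule trig_series_tendsto[OF h bracket_L2[OF v j]]) (rule bracket_support)
    then show ?thesis by (rule filterlim_compose[OF _ filterlim_section[OF j]])
  qed
  have cell_eq: "cell i (\<lambda>\<xi>. synthesis v F \<xi> - fiber_op v \<xi>) x = (\<Sum>j=1..N. D j (F `` {j}) x * \<phi>_hat j (x + \<sigma> i))"
    if F: "finite F" "F \<subseteq> {1..N} \<times> UNIV" and i: "i < M" for F i x
  proof (cases "x \<in> {0..<h}")
    case True
    have F_eq: "F = (SIGMA j:{1..N}. F `` {j})" using F(2) by auto
    have "synthesis v F (x + \<sigma> i)
        = (\<Sum>(j, n)\<in>(SIGMA j:{1..N}. F `` {j}). trig_coeff h (bracket v j) n * (trig h n x * \<phi>_hat j (x + \<sigma> i)))"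
      unfolding synthesis_def trig_shift using F_eq by simp
    also have "\<dots> = (\<Sum>j=1..N. \<Sum>n\<in>F `` {j}. trig_coeff h (bracket v j) n * (trig h n x * \<phi>_hat j (x + \<sigma> i)))"
      using F(1) by (intro sum.Sigma[symmetric]) auto
    also have "\<dots> = (\<Sum>j=1..N. (\<Sum>n\<in>F `` {j}. trig_coeff h (bracket v j) n * trig h n x) * \<phi>_hat j (x + \<sigma> i))"
      by (simp add: sum_distrib_right mult.assoc)
    finally have syn: "synthesis v F (x + \<sigma> i)
        = (\<Sum>j=1..N. (\<Sum>n\<in>F `` {j}. trig_coeff h (bracket v j) n * trig h n x) * \<phi>_hat j (x + \<sigma> i))" .
    have "fiber_op v (x + \<sigma> i) = (\<Sum>j=1..N. (of_real h * bracket v j x) * \<phi>_hat j (x + \<sigma> i))"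
      unfolding fiber_op_def assemble_cell[OF True i] by (simp add: sum_distrib_left mult.assoc)
    then show ?thesis
      using True by (simp add: cell_def syn D_def left_diff_distrib sum_subtractf)
  qed (simp add: cell_def D_supp)
  have "((\<lambda>F. \<Sum>i<M. 2 ^ card {1..N} * (\<Sum>j=1..N. bound * L2_norm_sq (D j (F `` {j}))))
      \<longlongrightarrow> (\<Sum>i<M. 2 ^ card {1..N} * (\<Sum>j=1..N. bound * 0))) (finite_subsets_at_top ({1..N} \<times> UNIV))"
    by (intro tendsto_sum tendsto_mult_left D_lim)
  then have lim: "((\<lambda>F. \<Sum>i<M. 2 ^ card {1..N} * (\<Sum>j=1..N. bound * L2_norm_sq (D j (F `` {j}))))
      \<longlongrightarrow> 0) (finite_subsets_at_top ({1..N} \<times> UNIV))" by simp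
  have bound: "L2_norm_sq (\<lambda>\<xi>. synthesis v F \<xi> - fiber_op v \<xi>)
      \<le> (\<Sum>i<M. 2 ^ card {1..N} * (\<Sum>j=1..N. bound * L2_norm_sq (D j (F `` {j}))))"
    if F: "finite F" "F \<subseteq> {1..N} \<times> UNIV" for F
  proof -
    have "L2_norm_sq (\<lambda>\<xi>. synthesis v F \<xi> - fiber_op v \<xi>)
        = (\<Sum>i<M. L2_norm_sq (cell i (\<lambda>\<xi>. synthesis v F \<xi> - fiber_op v \<xi>)))"
      by (rule L2_norm_sq_cells) (intro paley_wiener_diff synthesis_pw F fiber_op_paley_wiener v)
    also have "\<dots> \<le> (\<Sum>i<M. 2 ^ card {1..N} * (\<Sum>j=1..N. bound * L2_norm_sq (D j (F `` {j}))))"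
    proof (rule sum_mono)
      fix i assume "i \<in> {..<M}"
      then have i: "i < M" by simp
      have "L2_norm_sq (\<lambda>x. \<Sum>j=1..N. D j (F `` {j}) x * \<phi>_hat j (x + \<sigma> i))
          \<le> 2 ^ card {1..N} * (\<Sum>j=1..N. L2_norm_sq (\<lambda>x. D j (F `` {j}) x * \<phi>_hat j (x + \<sigma> i)))"
        by (rule L2_norm_sq_sum_le) (rule L2_mult_generator(1)[OF D_L2 D_supp i])
      also have "\<dots> \<le> 2 ^ card {1..N} * (\<Sum>j=1..N. bound * L2_norm_sq (D j (F `` {j})))"
        by (intro mult_left_mono sum_mono L2_mult_generator(2)[OF D_L2 D_supp i]) auto
      finally show "L2_norm_sq (cell i (\<lambda>\<xi>. synthesis v F \<xi> - fiber_op v \<xi>))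
          \<le> 2 ^ card {1..N} * (\<Sum>j=1..N. bound * L2_norm_sq (D j (F `` {j})))"
        unfolding cell_eq[OF F i, abs_def] .
    qed
    finally show ?thesis .
  qed
  show ?thesis
  proof (rule tendsto_sandwich[OF _ _ tendsto_const lim])
    show "\<forall>\<^sub>F F in finite_subsets_at_top ({1..N} \<times> UNIV). 0 \<le> L2_norm_sq (\<lambda>\<xi>. synthesis v F \<xi> - fiber_op v \<xi>)"
      by simp
    show "\<forall>\<^sub>F F in finite_subsets_at_top ({1..N} \<times> UNIV). L2_norm_sq (\<lambda>\<xi>. synthesis v F \<xi> - fiber_op v \<xi>)
        \<le> (\<Sum>i<M. 2 ^ card {1..N} * (\<Sum>j=1..N. bound * L2_norm_sq (D j (F `` {j}))))"
      by (rule eventually_finite_subsets_at_top_weakI) (rule bound)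
  qed
qed

text \<open>
  The partial sums that define the frame operator are the inverse transforms of \<open>synthesis v F\<close>, so by
  Plancherel's identity they converge like the latter. This also provides the existence of the limit that
  the definition of the frame operator chooses.
\<close>

lemma frame_operator_eq:
  assumes f: "f \<in> L2" and v: "v \<in> paley_wiener \<omega>" and eq: "AE x in lborel. f x = inv_FT v x"
  shows "AE x in lborel. frame_operator t\<^sub>0 N \<phi> f x = inv_FT (fiber_op v) x"
proof -
  define u where "u F x = (\<Sum>(j, n)\<in>F. L2_inner f (translate (of_int n * t\<^sub>0) (\<phi> j)) *
                             translate (of_int n * t\<^sub>0) (\<phi> j) x)" for F x
  define \<F> where "\<F> = finite_subsets_at_top ({1..N} \<times> (UNIV :: int set))"
  have u_eq: "u F \<in> L2" "L2_norm_sq (\<lambda>x. u F x - inv_FT (fiber_op v) x) = L2_norm_sq (\<lambda>\<xi>. synthesis v F \<xi> - fiber_op v \<xi>)"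
    if F: "finite F" "F \<subseteq> {1..N} \<times> UNIV" for F
  proof -
    have j: "fst k \<in> {1..N}" if "k \<in> F" for k using F(2) that by auto
    have trans_L2: "translate a (\<phi> j) \<in> L2" if "j \<in> {1..N}" for a j
      using \<phi>[OF that] by (intro L2_translate) (simp add: bandlimited_def)
    have u_alt: "u F = (\<lambda>x. \<Sum>k\<in>F. trig_coeff h (bracket v (fst k)) (snd k) *
        translate (of_int (snd k) * t\<^sub>0) (\<phi> (fst k)) x)"
      unfolding u_def case_prod_beta' using frame_coeff[OF f v eq j]
      by (intro ext sum.cong) auto
    show uL2: "u F \<in> L2"
      unfolding u_alt by (intro L2_sum L2_scale trans_L2 j)
    have "AE x in lborel. \<forall>k\<in>F. translate (of_int (snd k) * t\<^sub>0) (\<phi> (fst k)) x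
        = inv_FT (\<lambda>\<xi>. trig h (snd k) \<xi> * \<phi>_hat (fst k) \<xi>) x"
    proof (rule AE_finite_allI[OF F(1)])
      fix k assume k: "k \<in> F"
      have "AE x in lborel. \<phi> (fst k) x = inv_FT (\<phi>_hat (fst k)) x"
        unfolding \<phi>_hat_def by (rule bandlimited_eq_inv_FT[OF \<phi>[OF j[OF k]]])
      then have "AE x in lborel. \<phi> (fst k) (x + of_int (snd k) * t\<^sub>0) = inv_FT (\<phi>_hat (fst k)) (x + of_int (snd k) * t\<^sub>0)"
        by (rule AE_lborel_shift)
      moreover have "inv_FT (\<phi>_hat (fst k)) (x + of_int (snd k) * t\<^sub>0) = inv_FT (\<lambda>\<xi>. trig h (snd k) \<xi> * \<phi>_hat (fst k) \<xi>) x" for x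
        using translate_inv_FT[of "of_int (snd k) * t\<^sub>0" "\<phi>_hat (fst k)"] by (simp add: translate_def fun_eq_iff trig_h)
      ultimately show "AE x in lborel. translate (of_int (snd k) * t\<^sub>0) (\<phi> (fst k)) x
        = inv_FT (\<lambda>\<xi>. trig h (snd k) \<xi> * \<phi>_hat (fst k) \<xi>) x"
        by (simp add: translate_def)
    qed
    moreover have "inv_FT (synthesis v F) x = (\<Sum>k\<in>F. trig_coeff h (bracket v (fst k)) (snd k) *
        inv_FT (\<lambda>\<xi>. trig h (snd k) \<xi> * \<phi>_hat (fst k) \<xi>) x)" for x
    proof -
      have "integrable lborel (\<lambda>\<xi>. trig_coeff h (bracket v (fst k)) (snd k) * (trig h (snd k) \<xi> * \<phi>_hat (fst k) \<xi>))"
        if "k \<in> F" for k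
        by (rule paley_wiener_integrable, rule paley_wiener_scale, rule paley_wiener_mult_bounded[where C = 1])
          (use \<phi>_hat_paley_wiener[OF j[OF that]] in auto)
      then show ?thesis
        unfolding synthesis_def[abs_def] case_prod_beta' by (simp add: inv_FT_sum inv_FT_scale)
    qed
    ultimately have "AE x in lborel. u F x = inv_FT (synthesis v F) x"
      by (auto simp: u_alt elim!: eventually_mono)
    moreover have "inv_FT (\<lambda>\<xi>. synthesis v F \<xi> - fiber_op v \<xi>) x = inv_FT (synthesis v F) x - inv_FT (fiber_op v) x" for x
      by (intro inv_FT_diff paley_wiener_integrable[OF synthesis_pw] paley_wiener_integrable[OF fiber_op_paley_wiener] F v)
    ultimately have "AE x in lborel. u F x - inv_FT (fiber_op v) x = inv_FT (\<lambda>\<xi>. synthesis v F \<xi> - fiber_op v \<xi>) x"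
      by (auto elim!: eventually_mono)
    moreover have diff_pw: "(\<lambda>\<xi>. synthesis v F \<xi> - fiber_op v \<xi>) \<in> paley_wiener \<omega>"
      by (intro paley_wiener_diff synthesis_pw fiber_op_paley_wiener F v)
    ultimately have "L2_norm_sq (\<lambda>x. u F x - inv_FT (fiber_op v) x) = L2_norm_sq (inv_FT (\<lambda>\<xi>. synthesis v F \<xi> - fiber_op v \<xi>))"
      using L2_diff[OF uL2 inv_FT_paley_wiener(1)[OF fiber_op_paley_wiener[OF v]]] inv_FT_paley_wiener(1)[OF diff_pw]
      by (intro L2_norm_sq_cong_AE) (auto simp: L2_def)
    then show "L2_norm_sq (\<lambda>x. u F x - inv_FT (fiber_op v) x) = L2_norm_sq (\<lambda>\<xi>. synthesis v F \<xi> - fiber_op v \<xi>)"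
      using inv_FT_paley_wiener(2)[OF diff_pw] by simp
  qed
  have ev_L2: "\<forall>\<^sub>F F in \<F>. u F \<in> L2"
    unfolding \<F>_def by (rule eventually_finite_subsets_at_top_weakI) (rule u_eq)
  have "((\<lambda>F. L2_norm_sq (\<lambda>x. u F x - inv_FT (fiber_op v) x)) \<longlongrightarrow> 0) \<F>"
  proof (rule Lim_transform_eventually[OF synthesis_tendsto[OF v, folded \<F>_def]])
    show "\<forall>\<^sub>F F in \<F>. L2_norm_sq (\<lambda>\<xi>. synthesis v F \<xi> - fiber_op v \<xi>) = L2_norm_sq (\<lambda>x. u F x - inv_FT (fiber_op v) x)"
      unfolding \<F>_def by (rule eventually_finite_subsets_at_top_weakI) (rule u_eq(2)[symmetric])
  qed
  then have lim: "L2_tendsto u (inv_FT (fiber_op v)) \<F>"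
    using ev_L2 inv_FT_paley_wiener(1)[OF fiber_op_paley_wiener[OF v]] by (simp add: L2_tendsto_iff)
  have "\<exists>g. g \<in> L2 \<and> L2_tendsto u g \<F>"
    using lim inv_FT_paley_wiener(1)[OF fiber_op_paley_wiener[OF v]] by blast
  from someI_ex[OF this]
  have "frame_operator t\<^sub>0 N \<phi> f \<in> L2 \<and> L2_tendsto u (frame_operator t\<^sub>0 N \<phi> f) \<F>"
    unfolding frame_operator_def \<F>_def u_def .
  then show ?thesis
    using lim ev_L2 inv_FT_paley_wiener(1)[OF fiber_op_paley_wiener[OF v]]
    by (intro L2_tendsto_unique[of \<F> u]) (auto simp: \<F>_def)
qed

end

section \<open>The dual generators on fibers\<close>

lemma det_measurable:
  fixes A :: "real \<Rightarrow> complex mat"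
  assumes carrier: "\<And>x. A x \<in> carrier_mat n n"
    and meas: "\<And>i j. i < n \<Longrightarrow> j < n \<Longrightarrow> (\<lambda>x. A x $$ (i, j)) \<in> borel_measurable borel"
  shows "(\<lambda>x. Determinant.det (A x)) \<in> borel_measurable borel"
proof -
  have "Determinant.det (A x) = (\<Sum>\<pi>\<in>{\<pi>. \<pi> permutes {0..<n}}. signof \<pi> * (\<Prod>i = 0..<n. A x $$ (i, \<pi> i)))" for x
    by (rule det_def'[OF carrier])
  moreover have "(\<lambda>x. \<Sum>\<pi>\<in>{\<pi>. \<pi> permutes {0..<n}}. signof \<pi> * (\<Prod>i = 0..<n. A x $$ (i, \<pi> i)))
      \<in> borel_measurable borel"
  proof (intro borel_measurable_sum borel_measurable_times borel_measurable_prod borel_measurable_const)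
    fix \<pi> i assume "\<pi> \<in> {\<pi>. \<pi> permutes {0..<n}}" "i \<in> {0..<n}"
    then have "i < n" "\<pi> i < n" using permutes_in_image[of \<pi> "{0..<n}" i] by auto
    then show "(\<lambda>x. A x $$ (i, \<pi> i)) \<in> borel_measurable borel" by (rule meas)
  qed
  ultimately show ?thesis by simp
qed

lemma adj_mat_measurable:
  fixes A :: "real \<Rightarrow> complex mat"
  assumes carrier: "\<And>x. A x \<in> carrier_mat n n"
    and meas: "\<And>i j. i < n \<Longrightarrow> j < n \<Longrightarrow> (\<lambda>x. A x $$ (i, j)) \<in> borel_measurable borel"
    and ij: "i < n" "j < n"
  shows "(\<lambda>x. adj_mat (A x) $$ (i, j)) \<in> borel_measurable borel"
proof -
  have dims: "dim_row (A x) = n" "dim_col (A x) = n" for x using carrier[of x] by auto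
  have "(\<lambda>x. Determinant.det (mat_delete (A x) j i)) \<in> borel_measurable borel"
  proof (rule det_measurable[where n = "n - 1"])
    show "mat_delete (A x) j i \<in> carrier_mat (n - 1) (n - 1)" for x
      using carrier[of x] by (rule mat_delete_carrier)
    show "(\<lambda>x. mat_delete (A x) j i $$ (r, s)) \<in> borel_measurable borel" if "r < n - 1" "s < n - 1" for r s
      using that by (auto simp: mat_delete_def dims intro!: meas)
  qed
  moreover have "adj_mat (A x) $$ (i, j) = (- 1) ^ (j + i) * Determinant.det (mat_delete (A x) j i)" for x
    using ij by (simp add: adj_mat_def cofactor_def dims)
  ultimately show ?thesis by simp
qed

text \<open>
  From \<open>2 A Re (cnj a b) \<le> A\<^sup>2 |a|\<^sup>2 + |b|\<^sup>2\<close>; bounds the solution of a system that is positive definite with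
  constant \<open>A\<close> by its right-hand side.
\<close>

lemma cross_terms_le:
  fixes a b :: "nat \<Rightarrow> complex"
  assumes "A > 0" "A * (\<Sum>i<n. (cmod (a i))\<^sup>2) \<le> Re (\<Sum>i<n. cnj (a i) * b i)"
  shows "(\<Sum>i<n. (cmod (a i))\<^sup>2) \<le> 1 / A\<^sup>2 * (\<Sum>i<n. (cmod (b i))\<^sup>2)"
proof -
  have "2 * A * Re (cnj (a i) * b i) \<le> A\<^sup>2 * (cmod (a i))\<^sup>2 + (cmod (b i))\<^sup>2" for i
  proof -
    have "Re (cnj (a i) * b i) \<le> cmod (a i) * cmod (b i)"
      using complex_Re_le_cmod[of "cnj (a i) * b i"] by (simp add: norm_mult)
    then have "2 * A * Re (cnj (a i) * b i) \<le> 2 * (A * cmod (a i)) * cmod (b i)"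
      using assms(1) mult_left_mono[of "Re (cnj (a i) * b i)" "cmod (a i) * cmod (b i)" "2 * A"]
      by (simp add: mult.assoc)
    also have "\<dots> \<le> (A * cmod (a i))\<^sup>2 + (cmod (b i))\<^sup>2" by (rule sum_squares_bound)
    finally show ?thesis by (simp add: power_mult_distrib)
  qed
  then have "(\<Sum>i<n. 2 * A * Re (cnj (a i) * b i)) \<le> (\<Sum>i<n. A\<^sup>2 * (cmod (a i))\<^sup>2 + (cmod (b i))\<^sup>2)"
    by (rule sum_mono)
  then have "2 * A * Re (\<Sum>i<n. cnj (a i) * b i) \<le> A\<^sup>2 * (\<Sum>i<n. (cmod (a i))\<^sup>2) + (\<Sum>i<n. (cmod (b i))\<^sup>2)"
    by (simp only: Re_sum sum_distrib_left sum.distrib)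
  moreover have "2 * A * (A * (\<Sum>i<n. (cmod (a i))\<^sup>2)) \<le> 2 * A * Re (\<Sum>i<n. cnj (a i) * b i)"
    using assms by (intro mult_left_mono) auto
  ultimately have "A\<^sup>2 * (\<Sum>i<n. (cmod (a i))\<^sup>2) \<le> (\<Sum>i<n. (cmod (b i))\<^sup>2)"
    by (simp add: power2_eq_square)
  then show ?thesis using assms(1) by (simp add: field_simps)
qed

context frame_setup
begin

text \<open>
  The matrix \<open>h A(x)\<^sup>T cnj A(x)\<close>, completed by a diagonal entry \<open>1\<close> for each cell outside the band. With this
  completion it has the same size at every \<open>x\<close> and is invertible almost everywhere. The right-hand
  sides, fibers of the generators, vanish in the additional cells, and hence so do the solutions.
\<close>

definition gram :: "real \<Rightarrow> complex mat" where
  "gram x = Matrix.mat M M (\<lambda>(i, k). of_real h * (\<Sum>j=1..N. \<phi>_hat j (x + \<sigma> i) * cnj (\<phi>_hat j (x + \<sigma> k)))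
     + (if i = k then of_real (1 - band i x) else 0))"

definition fiber :: "nat \<Rightarrow> real \<Rightarrow> complex Matrix.vec" where
  "fiber k x = Matrix.vec M (\<lambda>i. \<phi>_hat k (x + \<sigma> i))"

text \<open>
  The solution given by the adjugate matrix, which depends measurably on \<open>x\<close>. Where the determinant vanishes
  the quotient is zero, and the factor \<open>band i x\<close> enforces the vanishing outside the band at every point.
\<close>

definition solution :: "nat \<Rightarrow> nat \<Rightarrow> real \<Rightarrow> complex" where
  "solution k i x = of_real (band i x) *
     ((\<Sum>m<M. adj_mat (gram x) $$ (i, m) * \<phi>_hat k (x + \<sigma> m)) / Determinant.det (gram x))"

lemma gram_carrier: "gram x \<in> carrier_mat M M"
  by (simp add: gram_def)

lemma gram_measurable:
  assumes "i < M" "k < M"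
  shows "(\<lambda>x. gram x $$ (i, k)) \<in> borel_measurable borel"
proof -
  have [measurable]: "\<phi>_hat j \<in> borel_measurable borel" if "j \<in> {1..N}" for j
    by (rule \<phi>_hat_measurable[OF that])
  show ?thesis using assms by (simp add: gram_def) measurable
qed

lemma solution_measurable:
  assumes k: "k \<in> {1..N}" and i: "i < M"
  shows "solution k i \<in> borel_measurable borel"
proof -
  have [measurable]: "\<phi>_hat k \<in> borel_measurable borel" by (rule \<phi>_hat_measurable[OF k])
  have [measurable]: "(\<lambda>x. adj_mat (gram x) $$ (i, m)) \<in> borel_measurable borel" if "m \<in> {..<M}" for m
    by (rule adj_mat_measurable[OF gram_carrier gram_measurable i]) (use that in auto)
  have [measurable]: "(\<lambda>x. Determinant.det (gram x)) \<in> borel_measurable borel"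
    by (rule det_measurable[OF gram_carrier gram_measurable])
  show ?thesis unfolding solution_def by measurable
qed

lemma gram_apply:
  assumes "i < M"
  shows "(\<Sum>m<M. gram x $$ (i, m) * c m)
    = of_real h * (\<Sum>j=1..N. \<phi>_hat j (x + \<sigma> i) * (\<Sum>m<M. c m * cnj (\<phi>_hat j (x + \<sigma> m)))) + of_real (1 - band i x) * c i"
proof -
  have "(\<Sum>m<M. gram x $$ (i, m) * c m)
      = (\<Sum>m<M. of_real h * (\<Sum>j=1..N. \<phi>_hat j (x + \<sigma> i) * cnj (\<phi>_hat j (x + \<sigma> m))) * c m)
        + (\<Sum>m<M. if m = i then of_real (1 - band i x) * c i else 0)"
    unfolding sum.distrib[symmetric] using assms
    by (intro sum.cong) (auto simp: gram_def distrib_right)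
  also have "(\<Sum>m<M. if m = i then of_real (1 - band i x) * c i else 0) = of_real (1 - band i x) * c i"
    using assms by simp
  also have "(\<Sum>m<M. of_real h * (\<Sum>j=1..N. \<phi>_hat j (x + \<sigma> i) * cnj (\<phi>_hat j (x + \<sigma> m))) * c m)
      = of_real h * (\<Sum>j=1..N. \<phi>_hat j (x + \<sigma> i) * (\<Sum>m<M. c m * cnj (\<phi>_hat j (x + \<sigma> m))))"
  proof -
    have "(\<Sum>m<M. of_real h * (\<Sum>j=1..N. \<phi>_hat j (x + \<sigma> i) * cnj (\<phi>_hat j (x + \<sigma> m))) * c m)
        = of_real h * (\<Sum>m<M. \<Sum>j=1..N. \<phi>_hat j (x + \<sigma> i) * (c m * cnj (\<phi>_hat j (x + \<sigma> m))))"
      by (simp add: sum_distrib_left sum_distrib_right mult_ac)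
    also have "(\<Sum>m<M. \<Sum>j=1..N. \<phi>_hat j (x + \<sigma> i) * (c m * cnj (\<phi>_hat j (x + \<sigma> m))))
        = (\<Sum>j=1..N. \<phi>_hat j (x + \<sigma> i) * (\<Sum>m<M. c m * cnj (\<phi>_hat j (x + \<sigma> m))))"
      by (subst sum.swap) (simp add: sum_distrib_left)
    finally show ?thesis .
  qed
  finally show ?thesis .
qed

text \<open>
  With the lower frame bound this shows that the completed matrix is positive definite at almost every \<open>x\<close>.
\<close>

lemma gram_quadratic_form:
  "Re (\<Sum>i<M. cnj (c i) * (\<Sum>m<M. gram x $$ (i, m) * c m))
    = energy c x + (\<Sum>i<M. (1 - band i x) * (cmod (c i))\<^sup>2)"
proof -
  define y where "y j = (\<Sum>m<M. c m * cnj (\<phi>_hat j (x + \<sigma> m)))" for j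
  have "(\<Sum>i<M. cnj (c i) * (\<Sum>m<M. gram x $$ (i, m) * c m))
      = (\<Sum>i<M. cnj (c i) * (of_real h * (\<Sum>j=1..N. \<phi>_hat j (x + \<sigma> i) * y j)))
        + (\<Sum>i<M. of_real ((1 - band i x) * (cmod (c i))\<^sup>2))"
  proof -
    have "cnj (c i) * (\<Sum>m<M. gram x $$ (i, m) * c m)
        = cnj (c i) * (of_real h * (\<Sum>j=1..N. \<phi>_hat j (x + \<sigma> i) * y j)) + of_real ((1 - band i x) * (cmod (c i))\<^sup>2)"
      if "i < M" for i
    proof -
      have "cnj (c i) * (of_real (1 - band i x) * c i) = of_real ((1 - band i x) * (cmod (c i))\<^sup>2)"
        unfolding of_real_mult complex_norm_square by (simp add: mult_ac)
      then show ?thesis unfolding gram_apply[OF that] y_def by (simp only: distrib_left)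
    qed
    then show ?thesis by (simp add: sum.distrib)
  qed
  also have "(\<Sum>i<M. cnj (c i) * (of_real h * (\<Sum>j=1..N. \<phi>_hat j (x + \<sigma> i) * y j)))
      = of_real (h * (\<Sum>j=1..N. (cmod (y j))\<^sup>2))"
  proof -
    have "(\<Sum>i<M. cnj (c i) * (of_real h * (\<Sum>j=1..N. \<phi>_hat j (x + \<sigma> i) * y j)))
        = of_real h * (\<Sum>i<M. \<Sum>j=1..N. cnj (c i) * (\<phi>_hat j (x + \<sigma> i) * y j))"
      by (simp add: sum_distrib_left mult_ac)
    also have "(\<Sum>i<M. \<Sum>j=1..N. cnj (c i) * (\<phi>_hat j (x + \<sigma> i) * y j)) = (\<Sum>j=1..N. y j * cnj (y j))"
      by (subst sum.swap) (simp add: y_def sum_distrib_left mult_ac)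
    also have "\<dots> = of_real (\<Sum>j=1..N. (cmod (y j))\<^sup>2)"
      by (simp only: of_real_sum complex_norm_square[symmetric])
    finally show ?thesis by simp
  qed
  finally show ?thesis by (simp add: y_def energy_def flip: of_real_sum of_real_add)
qed

lemma solution_AE:
  "\<exists>A>0. AE x in lborel. x \<in> {0..<h} \<longrightarrow> (\<forall>k.
     (\<forall>i<M. of_real h * (\<Sum>j=1..N. (\<Sum>m<M. solution k m x * cnj (\<phi>_hat j (x + \<sigma> m))) * \<phi>_hat j (x + \<sigma> i)) = \<phi>_hat k (x + \<sigma> i)) \<and>
     (\<Sum>i<M. (cmod (solution k i x))\<^sup>2) \<le> 1 / A\<^sup>2 * (\<Sum>i<M. (cmod (\<phi>_hat k (x + \<sigma> i)))\<^sup>2))"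
proof -
  obtain A B where A: "A > 0" and bounds: "AE x in lborel. x \<in> {0..<h} \<longrightarrow> (\<forall>c.
      A * weight c x \<le> energy c x \<and> energy c x \<le> B * weight c x)"
    using frame_bounds_AE by blast
  have "AE x in lborel. x \<in> {0..<h} \<longrightarrow> (\<forall>k.
     (\<forall>i<M. of_real h * (\<Sum>j=1..N. (\<Sum>m<M. solution k m x * cnj (\<phi>_hat j (x + \<sigma> m))) * \<phi>_hat j (x + \<sigma> i)) = \<phi>_hat k (x + \<sigma> i)) \<and>
     (\<Sum>i<M. (cmod (solution k i x))\<^sup>2) \<le> 1 / A\<^sup>2 * (\<Sum>i<M. (cmod (\<phi>_hat k (x + \<sigma> i)))\<^sup>2))"
    using bounds
  proof eventually_elim
    case (elim x)
    show ?case
    proof (intro impI allI)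
      fix k assume x: "x \<in> {0..<h}"
      have lower: "A * weight c x
          \<le> energy c x" for c
        using elim x by blast
      have band01: "band i x = 0 \<or> band i x = 1" for i by (simp add: band_def indicator_def)
      have hat_0: "\<phi>_hat j (x + \<sigma> i) = 0" if "band i x = 0" for i j
        using that by (intro \<phi>_hat_support) (auto simp: band_def indicator_def)
      have det: "Determinant.det (gram x) \<noteq> 0"
      proof
        assume "Determinant.det (gram x) = 0"
        then obtain v where v: "v \<in> carrier_vec M" "v \<noteq> 0\<^sub>v M" "gram x *\<^sub>v v = 0\<^sub>v M"
          using det_0_iff_vec_prod_zero[OF gram_carrier] by blast
        define c where "c i = v $ i" for i
        have "(\<Sum>m<M. gram x $$ (i, m) * c m) = 0" if "i < M" for i
        proof -
          have "(gram x *\<^sub>v v) $ i = (\<Sum>m<M. gram x $$ (i, m) * c m)"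
            using that v(1) gram_carrier[of x]
            by (auto simp: scalar_prod_def c_def atLeast0LessThan)
          then show ?thesis using v(3) that by simp
        qed
        then have zero: "energy c x
            + (\<Sum>i<M. (1 - band i x) * (cmod (c i))\<^sup>2) = 0"
          using gram_quadratic_form[of c x] by simp
        have nonneg: "0 \<le> (1 - band i x) * (cmod (c i))\<^sup>2" "0 \<le> (cmod (c i))\<^sup>2 * band i x" for i
          using band01[of i] by auto
        have sum_nonneg': "0 \<le> (\<Sum>i<M. (1 - band i x) * (cmod (c i))\<^sup>2)" "0 \<le> A * weight c x"
          using nonneg A by (simp_all only: weight_def sum_nonneg mult_nonneg_nonneg less_imp_le)
        then have "(\<Sum>i<M. (1 - band i x) * (cmod (c i))\<^sup>2) = 0" "A * weight c x = 0"
          using zero lower[of c] by linarith+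
        then have "(1 - band i x) * (cmod (c i))\<^sup>2 = 0" "(cmod (c i))\<^sup>2 * band i x = 0" if "i < M" for i
          using that nonneg A by (simp_all add: weight_def sum_nonneg_eq_0_iff)
        then have "c i = 0" if "i < M" for i
          using that band01[of i] by fastforce
        then have "v = 0\<^sub>v M" using v(1) by (intro eq_vecI) (auto simp: c_def)
        then show False using v(2) by simp
      qed
      define c where "c i = (\<Sum>m<M. adj_mat (gram x) $$ (i, m) * \<phi>_hat k (x + \<sigma> m)) / Determinant.det (gram x)" for i
      have solves: "(\<Sum>m<M. gram x $$ (i, m) * c m) = \<phi>_hat k (x + \<sigma> i)" if i: "i < M" for i
      proof -
        have adj: "adj_mat (gram x) \<in> carrier_mat M M" by (rule adj_mat(1)[OF gram_carrier])
        have "gram x *\<^sub>v (adj_mat (gram x) *\<^sub>v fiber k x) = (Determinant.det (gram x) \<cdot>\<^sub>m 1\<^sub>m M) *\<^sub>v fiber k x"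
          using assoc_mult_mat_vec[OF gram_carrier[of x] adj, of "fiber k x"] adj_mat(2)[OF gram_carrier[of x]]
          by (simp add: fiber_def)
        then have "(gram x *\<^sub>v (adj_mat (gram x) *\<^sub>v fiber k x)) $ i
            = ((Determinant.det (gram x) \<cdot>\<^sub>m 1\<^sub>m M) *\<^sub>v fiber k x) $ i" by simp
        moreover have "(gram x *\<^sub>v (adj_mat (gram x) *\<^sub>v fiber k x)) $ i
            = (\<Sum>m<M. gram x $$ (i, m) * (Determinant.det (gram x) * c m))"
          using i adj gram_carrier[of x] det
          by (auto simp: scalar_prod_def c_def fiber_def atLeast0LessThan intro!: sum.cong)
        moreover have "((Determinant.det (gram x) \<cdot>\<^sub>m 1\<^sub>m M) *\<^sub>v fiber k x) $ i = Determinant.det (gram x) * \<phi>_hat k (x + \<sigma> i)"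
        proof -
          have "((Determinant.det (gram x) \<cdot>\<^sub>m 1\<^sub>m M) *\<^sub>v fiber k x) $ i
              = (\<Sum>m<M. Determinant.det (gram x) * (if m = i then 1 else 0) * \<phi>_hat k (x + \<sigma> m))"
            using i by (simp add: scalar_prod_def fiber_def atLeast0LessThan)
          also have "\<dots> = (\<Sum>m<M. if m = i then Determinant.det (gram x) * \<phi>_hat k (x + \<sigma> i) else 0)"
            by (intro sum.cong) auto
          finally show ?thesis using i by simp
        qed
        ultimately have "Determinant.det (gram x) * (\<Sum>m<M. gram x $$ (i, m) * c m)
            = Determinant.det (gram x) * \<phi>_hat k (x + \<sigma> i)"
          by (simp add: sum_distrib_left mult_ac)
        then show ?thesis using det by simp
      qed
      have c0: "c i = 0" if "i < M" "band i x = 0" for i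
        using solves[OF that(1)] gram_apply[OF that(1), of x c] hat_0[OF that(2)] that(2) by simp
      have sol: "solution k i x = c i" if "i < M" for i
        using band01[of i] c0[OF that] by (auto simp: solution_def c_def)
      have eq: "of_real h * (\<Sum>j=1..N. (\<Sum>m<M. c m * cnj (\<phi>_hat j (x + \<sigma> m))) * \<phi>_hat j (x + \<sigma> i)) = \<phi>_hat k (x + \<sigma> i)"
        if "i < M" for i
      proof -
        have "of_real (1 - band i x) * c i = 0" using band01[of i] c0[OF that] by auto
        then show ?thesis using solves[OF that] gram_apply[OF that, of x c] by (simp add: mult.commute)
      qed
      have "A * (\<Sum>i<M. (cmod (c i))\<^sup>2) = A * weight c x"
        unfolding weight_def using band01 c0 by (intro arg_cong[where f = "\<lambda>y. A * y"] sum.cong) fastforce+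
      also have "\<dots> \<le> Re (\<Sum>i<M. cnj (c i) * (\<Sum>m<M. gram x $$ (i, m) * c m))"
      proof -
        have "0 \<le> (\<Sum>i<M. (1 - band i x) * (cmod (c i))\<^sup>2)"
        proof (rule sum_nonneg)
          show "0 \<le> (1 - band i x) * (cmod (c i))\<^sup>2" for i using band01[of i] by auto
        qed
        then show ?thesis using lower[of c] unfolding gram_quadratic_form by linarith
      qed
      also have "(\<Sum>i<M. cnj (c i) * (\<Sum>m<M. gram x $$ (i, m) * c m)) = (\<Sum>i<M. cnj (c i) * \<phi>_hat k (x + \<sigma> i))"
        by (intro sum.cong) (auto simp: solves)
      finally have "(\<Sum>i<M. (cmod (c i))\<^sup>2) \<le> 1 / A\<^sup>2 * (\<Sum>i<M. (cmod (\<phi>_hat k (x + \<sigma> i)))\<^sup>2)"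
        by (rule cross_terms_le[OF A])
      then show "(\<forall>i<M. of_real h * (\<Sum>j=1..N. (\<Sum>m<M. solution k m x * cnj (\<phi>_hat j (x + \<sigma> m))) * \<phi>_hat j (x + \<sigma> i)) = \<phi>_hat k (x + \<sigma> i)) \<and>
         (\<Sum>i<M. (cmod (solution k i x))\<^sup>2) \<le> 1 / A\<^sup>2 * (\<Sum>i<M. (cmod (\<phi>_hat k (x + \<sigma> i)))\<^sup>2)"
        using eq by (simp add: sol)
    qed
  qed
  with A show ?thesis by blast
qed

lemma AE_of_cells:
  assumes "AE x in lborel. x \<in> {0..<h} \<longrightarrow> (\<forall>i<M. P (x + \<sigma> i))"
    and "\<And>\<xi>. \<xi> \<notin> {-\<omega>..\<omega>} \<Longrightarrow> P \<xi>"
  shows "AE \<xi> in lborel. P \<xi>"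
proof -
  have "AE \<xi> in lborel. \<forall>i\<in>{..<M}. (\<xi> + - \<sigma> i) \<in> {0..<h} \<longrightarrow> (\<forall>k<M. P ((\<xi> + - \<sigma> i) + \<sigma> k))"
    by (intro AE_finite_allI AE_lborel_shift[OF assms(1)]) simp
  then show ?thesis
  proof eventually_elim
    case (elim \<xi>)
    show ?case
    proof (cases "\<xi> \<in> {-\<omega>..\<omega>}")
      case True
      then obtain i x where ix: "i < M" "x \<in> {0..<h}" "\<xi> = x + \<sigma> i" by (rule cell_cover)
      have "\<xi> + - \<sigma> i \<in> {0..<h}" "\<xi> + - \<sigma> i + \<sigma> i = \<xi>" using ix by auto
      then show ?thesis using elim ix(1) by (metis lessThan_iff)
    qed (rule assms(2))
  qed
qed

lemma AE_on_cells:
  assumes "AE \<xi> in lborel. P \<xi>"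
  shows "AE x in lborel. \<forall>i<M. P (x + \<sigma> i)"
proof -
  have "AE x in lborel. \<forall>i\<in>{..<M}. P (x + \<sigma> i)"
    by (rule AE_finite_allI) (auto intro: AE_lborel_shift[OF assms])
  then show ?thesis by eventually_elim auto
qed

text \<open>
  Glue the fiberwise solutions. They are square-integrable because their norm is at most a constant times
  that of the fiber of \<open>\<phi>_hat k\<close>.
\<close>

lemma dual_exists:
  assumes k: "k \<in> {1..N}"
  shows "\<exists>v\<in>paley_wiener \<omega>. AE \<xi> in lborel. fiber_op v \<xi> = \<phi>_hat k \<xi>"
proof -
  obtain A where A: "A > 0" and sol: "AE x in lborel. x \<in> {0..<h} \<longrightarrow> (\<forall>k.
     (\<forall>i<M. of_real h * (\<Sum>j=1..N. (\<Sum>m<M. solution k m x * cnj (\<phi>_hat j (x + \<sigma> m))) * \<phi>_hat j (x + \<sigma> i)) = \<phi>_hat k (x + \<sigma> i)) \<and>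
     (\<Sum>i<M. (cmod (solution k i x))\<^sup>2) \<le> 1 / A\<^sup>2 * (\<Sum>i<M. (cmod (\<phi>_hat k (x + \<sigma> i)))\<^sup>2))"
    using solution_AE by blast
  (* The norm of the fiber over \<open>x\<close>, as a function in \<open>L2\<close>. *)
  define w where "w x = complex_of_real (sqrt (\<Sum>i<M. (cmod (cell i (\<phi>_hat k) x))\<^sup>2))" for x
  have hat_k: "\<phi>_hat k \<in> paley_wiener \<omega>" by (rule \<phi>_hat_paley_wiener[OF k])
  have [measurable]: "\<phi>_hat k \<in> borel_measurable borel" by (rule \<phi>_hat_measurable[OF k])
  have cmod_w: "(cmod (w x))\<^sup>2 = (\<Sum>i<M. (cmod (cell i (\<phi>_hat k) x))\<^sup>2)" for x
    unfolding w_def by (simp add: sum_nonneg)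
  have w: "w \<in> L2"
  proof -
    have "w \<in> borel_measurable borel" unfolding w_def cell_def by measurable
    moreover have "integrable lborel (\<lambda>x. (cmod (w x))\<^sup>2)"
      unfolding cmod_w by (intro Bochner_Integration.integrable_sum L2_integrable cell_L2 hat_k)
    ultimately show ?thesis by (simp add: L2_def)
  qed
  define v where "v = assemble (solution k)"
  have v: "v \<in> paley_wiener \<omega>"
    unfolding v_def
  proof (rule assemble_paley_wiener)
    show meas: "solution k i \<in> borel_measurable borel" if "i < M" for i
      by (rule solution_measurable[OF k that])
    show "solution k i x = 0" if "x + \<sigma> i \<notin> {-\<omega>..\<omega>}" for i x
      using that by (simp add: solution_def band_def)
    show "(\<lambda>x. indicator {0..<h} x * solution k i x) \<in> L2" if i: "i < M" for i
    proof (rule L2_bounded_by_AE(1)[OF w])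
      show "(\<lambda>x. indicator {0..<h} x * solution k i x) \<in> borel_measurable borel"
        using meas[OF i] by measurable
      show "AE x in lborel. (cmod (indicator {0..<h} x * solution k i x))\<^sup>2 \<le> 1 / A\<^sup>2 * (cmod (w x))\<^sup>2"
        using sol
      proof eventually_elim
        case (elim x)
        show ?case
        proof (cases "x \<in> {0..<h}")
          case True
          have "(cmod (solution k i x))\<^sup>2 \<le> (\<Sum>i<M. (cmod (solution k i x))\<^sup>2)"
            using i by (intro member_le_sum) auto
          also have "\<dots> \<le> 1 / A\<^sup>2 * (\<Sum>i<M. (cmod (\<phi>_hat k (x + \<sigma> i)))\<^sup>2)" using elim True by blast
          finally show ?thesis using True by (simp add: cmod_w cell_def)
        qed simp
      qed
    qed (use A in simp)
  qed
  have "AE \<xi> in lborel. fiber_op v \<xi> = \<phi>_hat k \<xi>"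
  proof (rule AE_of_cells)
    show "AE x in lborel. x \<in> {0..<h} \<longrightarrow> (\<forall>i<M. fiber_op v (x + \<sigma> i) = \<phi>_hat k (x + \<sigma> i))"
      using sol
    proof eventually_elim
      case (elim x)
      show ?case
      proof (intro impI allI)
        fix i assume x: "x \<in> {0..<h}" and i: "i < M"
        have "bracket v j x = (\<Sum>m<M. solution k m x * cnj (\<phi>_hat j (x + \<sigma> m)))" for j
          using x by (auto simp: bracket_def v_def assemble_cell[OF x] intro!: sum.cong)
        then have "fiber_op v (x + \<sigma> i)
            = of_real h * (\<Sum>j=1..N. (\<Sum>m<M. solution k m x * cnj (\<phi>_hat j (x + \<sigma> m))) * \<phi>_hat j (x + \<sigma> i))"
          unfolding fiber_op_def assemble_cell[OF x i] by simp
        then show "fiber_op v (x + \<sigma> i) = \<phi>_hat k (x + \<sigma> i)" using elim x i by simp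
      qed
    qed
    show "fiber_op v \<xi> = \<phi>_hat k \<xi>" if "\<xi> \<notin> {-\<omega>..\<omega>}" for \<xi>
      using fiber_op_paley_wiener[OF v] that \<phi>_hat_support[OF that] by (simp add: paley_wiener_def)
  qed
  with v show ?thesis by blast
qed

lemma inv_FT_injective:
  assumes "v \<in> paley_wiener \<omega>" "w \<in> paley_wiener \<omega>" "AE x in lborel. inv_FT v x = inv_FT w x"
  shows "AE \<xi> in lborel. v \<xi> = w \<xi>"
proof -
  have pw: "(\<lambda>\<xi>. v \<xi> - w \<xi>) \<in> paley_wiener \<omega>" by (rule paley_wiener_diff[OF assms(1,2)])
  have "L2_norm_sq (\<lambda>\<xi>. v \<xi> - w \<xi>) = L2_norm_sq (inv_FT (\<lambda>\<xi>. v \<xi> - w \<xi>))"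
    by (rule inv_FT_paley_wiener(2)[OF pw, symmetric])
  also have "\<dots> = L2_norm_sq (\<lambda>x. 0)"
    using assms(3) inv_FT_paley_wiener(1)[OF pw]
    by (intro L2_norm_sq_cong_AE)
      (auto simp: L2_def inv_FT_diff[OF paley_wiener_integrable[OF assms(1)] paley_wiener_integrable[OF assms(2)]])
  also have "\<dots> = 0" by (simp add: L2_norm_sq_def)
  finally have "AE \<xi> in lborel. v \<xi> - w \<xi> = 0"
    using pw by (intro L2_norm_sq_eq_0) (auto simp: paley_wiener_def)
  then show ?thesis by simp
qed

text \<open>
  The dual generator is an arbitrary solution of \<open>S g = \<phi>\<^sub>k\<close>. Existence makes the choice meaningful, and
  every solution has the stated property since the frame operator is known on spectra.
\<close>

lemma dual_generator_spectrum:
  assumes k: "k \<in> {1..N}"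
  defines "g \<equiv> dual_generator \<omega> t\<^sub>0 N \<phi> k"
  shows "g \<in> bandlimited \<omega>" "AE \<xi> in lborel. fiber_op (spectrum \<omega> g) \<xi> = \<phi>_hat k \<xi>"
proof -
  have eq_p: "AE x in lborel. \<phi> k x = inv_FT (\<phi>_hat k) x"
    unfolding \<phi>_hat_def by (rule bandlimited_eq_inv_FT[OF \<phi>[OF k]])
  have "\<exists>g. g \<in> bandlimited \<omega> \<and> (AE x in lborel. frame_operator t\<^sub>0 N \<phi> g x = \<phi> k x)"
  proof -
    obtain v where v: "v \<in> paley_wiener \<omega>" "AE \<xi> in lborel. fiber_op v \<xi> = \<phi>_hat k \<xi>"
      using dual_exists[OF k] by blast
    have "inv_FT (fiber_op v) x = inv_FT (\<phi>_hat k) x" for x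
    proof -
      have [measurable]: "fiber_op v \<in> borel_measurable borel" "\<phi>_hat k \<in> borel_measurable borel"
        using fiber_op_paley_wiener[OF v(1)] \<phi>_hat_measurable[OF k] by (simp_all add: paley_wiener_def L2_def)
      have "(LINT t|lborel. fiber_op v t * cis (- (t * - x))) = (LINT t|lborel. \<phi>_hat k t * cis (- (t * - x)))"
        using v(2) by (intro integral_cong_AE) auto
      then show ?thesis by (simp only: inv_FT_def FT_def)
    qed
    then have "AE x in lborel. frame_operator t\<^sub>0 N \<phi> (inv_FT v) x = inv_FT (\<phi>_hat k) x"
      using frame_operator_eq[OF inv_FT_paley_wiener(1)[OF v(1)] v(1) AE_I2[OF refl]] by simp
    then have "AE x in lborel. frame_operator t\<^sub>0 N \<phi> (inv_FT v) x = \<phi> k x"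
      using eq_p by eventually_elim simp
    then show ?thesis using inv_FT_bandlimited[OF v(1)] by blast
  qed
  from someI_ex[OF this]
  have g: "g \<in> bandlimited \<omega>" "AE x in lborel. frame_operator t\<^sub>0 N \<phi> g x = \<phi> k x"
    unfolding g_def dual_generator_def by blast+
  then show "g \<in> bandlimited \<omega>" by blast
  have v: "spectrum \<omega> g \<in> paley_wiener \<omega>" by (rule spectrum_paley_wiener[OF g(1)])
  have "AE x in lborel. frame_operator t\<^sub>0 N \<phi> g x = inv_FT (fiber_op (spectrum \<omega> g)) x"
    using g(1) by (intro frame_operator_eq v bandlimited_eq_inv_FT) (simp_all add: bandlimited_def)
  then have "AE x in lborel. inv_FT (fiber_op (spectrum \<omega> g)) x = inv_FT (\<phi>_hat k) x"
    using g(2) eq_p by eventually_elim simp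
  then show "AE \<xi> in lborel. fiber_op (spectrum \<omega> g) \<xi> = \<phi>_hat k \<xi>"
    by (rule inv_FT_injective[OF fiber_op_paley_wiener[OF v] \<phi>_hat_paley_wiener[OF k]])
qed

end

section \<open>Cross products and orthogonal projections\<close>

lemma sum_diff_scaled:
  fixes f g w :: "nat \<Rightarrow> complex"
  shows "(\<Sum>k\<in>A. (f k - c * g k) * w k) = (\<Sum>k\<in>A. f k * w k) - c * (\<Sum>k\<in>A. g k * w k)"
  by (simp add: left_diff_distrib sum_subtractf sum_distrib_left mult.assoc)

text \<open>
  Putting a row \<open>w\<close> on top of the given \<open>n - 1\<close> vectors makes the cross product a determinant, by Laplace
  expansion along that row.
\<close>

definition bordered :: "nat \<Rightarrow> complex Matrix.vec list \<Rightarrow> (nat \<Rightarrow> complex) \<Rightarrow> complex mat" where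
  "bordered n vs w = Matrix.mat n n (\<lambda>(i, k). if i = 0 then w k else (vs ! (i - 1)) $ k)"

lemma bordered_carrier: "bordered n vs w \<in> carrier_mat n n"
  by (simp add: bordered_def)

lemma det_bordered:
  assumes n: "n \<ge> 1" and len: "length vs = n - 1"
  shows "Determinant.det (bordered n vs w) = (\<Sum>k<n. w k * cross_product n vs $ k)"
proof -
  have "Determinant.det (bordered n vs w)
      = (\<Sum>k<n. bordered n vs w $$ (0, k) * cofactor (bordered n vs w) 0 k)"
    using n by (intro laplace_expansion_row[OF bordered_carrier]) simp
  also have "\<dots> = (\<Sum>k<n. w k * cross_product n vs $ k)"
  proof (rule sum.cong[OF refl])
    fix k assume "k \<in> {..<n}"
    then have k: "k < n" by simp
    have "mat_delete (bordered n vs w) 0 k = delete_col (mat_of_rows n vs) k"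
      by (rule eq_matI) (use len n in \<open>auto simp: mat_delete_def delete_col_def bordered_def mat_of_rows_def\<close>)
    then show "bordered n vs w $$ (0, k) * cofactor (bordered n vs w) 0 k = w k * cross_product n vs $ k"
      using k n by (simp add: cofactor_def cross_product_def bordered_def)
  qed
  finally show ?thesis .
qed

lemma cross_product_orthogonal:
  assumes n: "n \<ge> 1" and len: "length vs = n - 1" and r: "r < n - 1"
  shows "(\<Sum>k<n. (vs ! r) $ k * cross_product n vs $ k) = 0"
proof -
  have "Determinant.det (bordered n vs (\<lambda>k. (vs ! r) $ k)) = 0"
  proof (rule det_identical_rows[OF bordered_carrier])
    show "Matrix.row (bordered n vs (\<lambda>k. (vs ! r) $ k)) 0 = Matrix.row (bordered n vs (\<lambda>k. (vs ! r) $ k)) (Suc r)"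
      by (rule eq_vecI) (use r in \<open>auto simp: bordered_def\<close>)
  qed (use r in auto)
  then show ?thesis using det_bordered[OF n len] by simp
qed

text \<open>
  A linear relation between the rows \<open>z\<^sup>*\<close> and \<open>vs\<close>, evaluated at \<open>z\<close>, leaves \<open>|z|\<^sup>2\<close> times the
  coefficient of \<open>z\<^sup>*\<close>. So this coefficient is zero, and the other ones vanish by independence.
\<close>

lemma det_bordered_conjugate_nonzero:
  assumes n: "n \<ge> 1" and len: "length vs = n - 1"
    and indep: "\<And>c. (\<And>k. k < n \<Longrightarrow> (\<Sum>r<n - 1. c r * (vs ! r) $ k) = 0) \<Longrightarrow> (\<forall>r<n - 1. c r = (0 :: complex))"
    and kernel: "\<And>r. r < n - 1 \<Longrightarrow> (\<Sum>k<n. z k * (vs ! r) $ k) = 0"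
    and nz: "\<exists>k<n. z k \<noteq> 0"
  shows "Determinant.det (bordered n vs (\<lambda>k. cnj (z k))) \<noteq> 0"
proof
  let ?B = "bordered n vs (\<lambda>k. cnj (z k))"
  assume "Determinant.det ?B = 0"
  then have "Determinant.det (transpose_mat ?B) = 0"
    using det_transpose[OF bordered_carrier] by simp
  moreover have carrier: "transpose_mat ?B \<in> carrier_mat n n" using bordered_carrier by simp
  ultimately obtain v where v: "v \<in> carrier_vec n" "v \<noteq> 0\<^sub>v n" "transpose_mat ?B *\<^sub>v v = 0\<^sub>v n"
    using det_0_iff_vec_prod_zero[OF carrier] by blast
  have split: "(\<Sum>i<n. f i) = f 0 + (\<Sum>r<n - 1. f (Suc r))" for f :: "nat \<Rightarrow> complex"
    using sum.lessThan_Suc_shift[of f "n - 1"] n by simp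
  have comb: "v $ 0 * cnj (z k) + (\<Sum>r<n - 1. v $ (Suc r) * (vs ! r) $ k) = 0" if k: "k < n" for k
  proof -
    have "(transpose_mat ?B *\<^sub>v v) $ k = (\<Sum>i<n. ?B $$ (i, k) * v $ i)"
      using k v(1) bordered_carrier[of n vs] by (auto simp: scalar_prod_def atLeast0LessThan bordered_def)
    then have "(\<Sum>i<n. ?B $$ (i, k) * v $ i) = 0" using v(3) k by simp
    then show ?thesis
      unfolding split using k n by (simp add: bordered_def mult.commute)
  qed
  have "(\<Sum>k<n. (v $ 0 * cnj (z k) + (\<Sum>r<n - 1. v $ (Suc r) * (vs ! r) $ k)) * z k) = 0"
    using comb by (intro sum.neutral) simp
  moreover have "(\<Sum>k<n. (\<Sum>r<n - 1. v $ (Suc r) * (vs ! r) $ k) * z k)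
      = (\<Sum>r<n - 1. v $ (Suc r) * (\<Sum>k<n. z k * (vs ! r) $ k))"
    unfolding sum_distrib_right sum_distrib_left by (subst sum.swap) (simp add: mult_ac)
  moreover have "\<dots> = 0" using kernel by (intro sum.neutral) simp
  moreover have "(\<Sum>k<n. v $ 0 * cnj (z k) * z k) = v $ 0 * of_real (\<Sum>k<n. (cmod (z k))\<^sup>2)"
    unfolding of_real_sum complex_norm_square sum_distrib_left by (simp add: mult_ac)
  ultimately have "v $ 0 * of_real (\<Sum>k<n. (cmod (z k))\<^sup>2) = 0"
    by (simp add: distrib_right sum.distrib)
  moreover have "(\<Sum>k<n. (cmod (z k))\<^sup>2) \<noteq> 0"
    using nz by (auto simp: sum_nonneg_eq_0_iff)
  ultimately have v0: "v $ 0 = 0" by (simp flip: of_real_sum)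
  have "\<forall>r<n - 1. v $ (Suc r) = 0"
    by (rule indep) (use comb v0 in simp)
  then have "v $ i = 0" if "i < n" for i
    using that v0 by (cases i) auto
  then have "v = 0\<^sub>v n" using v(1) by (intro eq_vecI) auto
  then show False using v(2) by simp
qed

text \<open>
  For \<open>n - 1\<close> independent vectors, the cross product spans the space of their common bilinear
  annihilators: for a nonzero annihilator \<open>z\<close> the determinant \<open>\<langle>W, z\<rangle>\<close> with rows \<open>z\<^sup>*\<close> and the given
  vectors cannot vanish, so an annihilator orthogonal to \<open>W\<close> is zero.
\<close>

lemma cross_product_spans_annihilator:
  assumes n: "n \<ge> 1" and len: "length vs = n - 1"
    and indep: "\<And>c. (\<And>k. k < n \<Longrightarrow> (\<Sum>r<n - 1. c r * (vs ! r) $ k) = 0) \<Longrightarrow> (\<forall>r<n - 1. c r = (0 :: complex))"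
  defines "W \<equiv> cross_product n vs"
  shows "(\<Sum>k<n. (cmod (W $ k))\<^sup>2) \<noteq> 0"
    and "(\<And>r. r < n - 1 \<Longrightarrow> (\<Sum>k<n. z k * (vs ! r) $ k) = 0) \<Longrightarrow> \<exists>c. \<forall>k<n. z k = c * W $ k"
proof -
  have nonorth: "(\<Sum>k<n. cnj (z k) * W $ k) \<noteq> 0"
    if "\<And>r. r < n - 1 \<Longrightarrow> (\<Sum>k<n. z k * (vs ! r) $ k) = 0" "\<exists>k<n. z k \<noteq> 0" for z
    using det_bordered_conjugate_nonzero[OF n len indep that] det_bordered[OF n len] by (simp add: W_def)
  (* A zero row on top gives a vanishing determinant, hence a nonzero annihilator. *)
  have "Determinant.det (bordered n vs (\<lambda>_. 0)) = 0"
    using det_bordered[OF n len, of "\<lambda>_. 0"] by simp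
  then obtain v where v: "v \<in> carrier_vec n" "v \<noteq> 0\<^sub>v n" "bordered n vs (\<lambda>_. 0) *\<^sub>v v = 0\<^sub>v n"
    using det_0_iff_vec_prod_zero[OF bordered_carrier] by blast
  have "(\<Sum>k<n. v $ k * (vs ! r) $ k) = 0" if "r < n - 1" for r
  proof -
    have "(bordered n vs (\<lambda>_. 0) *\<^sub>v v) $ (Suc r) = (\<Sum>k<n. v $ k * (vs ! r) $ k)"
      using that v(1) bordered_carrier[of n vs]
      by (auto simp: scalar_prod_def atLeast0LessThan bordered_def mult.commute intro!: sum.cong)
    then show ?thesis using v(3) that by simp
  qed
  moreover have "\<exists>k<n. v $ k \<noteq> 0"
  proof (rule ccontr)
    assume "\<not> (\<exists>k<n. v $ k \<noteq> 0)"
    then have "v = 0\<^sub>v n" using v(1) by (intro eq_vecI) auto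
    then show False using v(2) by simp
  qed
  ultimately have "(\<Sum>k<n. cnj (v $ k) * W $ k) \<noteq> 0" by (rule nonorth)
  then have "\<exists>k<n. W $ k \<noteq> 0" by (metis (no_types, lifting) lessThan_iff mult_zero_right sum.neutral)
  then show W: "(\<Sum>k<n. (cmod (W $ k))\<^sup>2) \<noteq> 0"
    by (auto simp: sum_nonneg_eq_0_iff)
  show "\<exists>c. \<forall>k<n. z k = c * W $ k" if z: "\<And>r. r < n - 1 \<Longrightarrow> (\<Sum>k<n. z k * (vs ! r) $ k) = 0"
  proof -
    define s where "s = complex_of_real (\<Sum>k<n. (cmod (W $ k))\<^sup>2)"
    have s: "s \<noteq> 0" "s = (\<Sum>k<n. W $ k * cnj (W $ k))"
      using W by (simp_all only: s_def of_real_eq_0_iff not_False_eq_True)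
        (simp only: of_real_sum complex_norm_square)
    define c where "c = (\<Sum>k<n. z k * cnj (W $ k)) / s"
    define u where "u k = z k - c * W $ k" for k
    have "(\<Sum>k<n. u k * (vs ! r) $ k) = 0" if r: "r < n - 1" for r
    proof -
      have "(\<Sum>k<n. u k * (vs ! r) $ k)
          = (\<Sum>k<n. z k * (vs ! r) $ k) - c * (\<Sum>k<n. (vs ! r) $ k * W $ k)"
        unfolding u_def sum_diff_scaled by (simp only: mult.commute)
      then show ?thesis using z[OF r] cross_product_orthogonal[OF n len r] by (simp add: W_def)
    qed
    moreover have "(\<Sum>k<n. cnj (u k) * W $ k) = 0"
    proof -
      have "(\<Sum>k<n. u k * cnj (W $ k)) = (\<Sum>k<n. z k * cnj (W $ k)) - c * s"
        unfolding u_def sum_diff_scaled s(2) ..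
      also have "\<dots> = 0" using s(1) by (simp add: c_def)
      finally have "cnj (\<Sum>k<n. u k * cnj (W $ k)) = 0" by simp
      then show ?thesis by simp
    qed
    ultimately have "\<not> (\<exists>k<n. u k \<noteq> 0)" using nonorth[of u] by blast
    then show ?thesis by (auto simp: u_def)
  qed
qed

lemma orth_proj_span_eq:
  assumes nz: "(\<Sum>k<dim_vec v. (cmod (v $ k))\<^sup>2) \<noteq> 0"
  shows "orth_proj_span v = Matrix.mat (dim_vec v) (dim_vec v)
    (\<lambda>(i, k). v $ i * cnj (v $ k) / of_real (\<Sum>k<dim_vec v. (cmod (v $ k))\<^sup>2))"
proof -
  define n where "n = dim_vec v"
  define s where "s = complex_of_real (\<Sum>k<n. (cmod (v $ k))\<^sup>2)"
  have s: "s \<noteq> 0" "s = (\<Sum>k<n. v $ k * cnj (v $ k))"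
    using nz by (simp_all only: s_def n_def of_real_eq_0_iff not_False_eq_True)
      (simp only: of_real_sum complex_norm_square)
  define E where "E = Matrix.mat n n (\<lambda>(i, k). v $ i * cnj (v $ k) / s)"
  have inner: "x \<bullet>c v = (\<Sum>k<n. x $ k * cnj (v $ k))" for x
    by (simp add: scalar_prod_def n_def atLeast0LessThan)
  have "is_orth_proj_span v E"
    unfolding is_orth_proj_span_def n_def[symmetric]
  proof (intro conjI ballI)
    show "E \<in> carrier_mat n n" by (simp add: E_def)
    fix u :: "complex Matrix.vec" assume u: "u \<in> carrier_vec n"
    define c where "c = (\<Sum>k<n. u $ k * cnj (v $ k)) / s"
    have Eu: "E *\<^sub>v u = c \<cdot>\<^sub>v v"
    proof (rule eq_vecI)
      fix i assume "i < dim_vec (c \<cdot>\<^sub>v v)"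
      then have i: "i < n" by (simp add: n_def)
      have "(E *\<^sub>v u) $ i = (\<Sum>k<n. v $ i * cnj (v $ k) / s * u $ k)"
        using i u by (auto simp: E_def scalar_prod_def atLeast0LessThan)
      also have "\<dots> = c * v $ i"
        unfolding c_def sum_divide_distrib sum_distrib_right by (intro sum.cong) auto
      finally show "(E *\<^sub>v u) $ i = (c \<cdot>\<^sub>v v) $ i" using i by (simp add: n_def)
    qed (simp add: E_def n_def)
    then show "\<exists>c. E *\<^sub>v u = c \<cdot>\<^sub>v v" by blast
    have "(u - E *\<^sub>v u) \<bullet>c v = (\<Sum>k<n. (u $ k - c * v $ k) * cnj (v $ k))"
      unfolding inner Eu using u by (intro sum.cong) (auto simp: n_def)
    also have "\<dots> = (\<Sum>k<n. u $ k * cnj (v $ k)) - c * s"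
      unfolding sum_diff_scaled s(2) ..
    finally have "(u - E *\<^sub>v u) \<bullet>c v = (\<Sum>k<n. u $ k * cnj (v $ k)) - c * s" .
    then show "(u - E *\<^sub>v u) \<bullet>c v = 0" using s(1) by (simp add: c_def)
  qed
  moreover have "P = E" if P: "is_orth_proj_span v P" for P
  proof (rule eq_matI)
    have carrier: "P \<in> carrier_mat n n" using P by (simp add: is_orth_proj_span_def n_def)
    then show "dim_row P = dim_row E" "dim_col P = dim_col E" by (auto simp: E_def)
    fix i k assume "i < dim_row E" "k < dim_col E"
    then have i: "i < n" and k: "k < n" by (auto simp: E_def)
    obtain c where c: "P *\<^sub>v unit_vec n k = c \<cdot>\<^sub>v v"
      and orth: "(unit_vec n k - P *\<^sub>v unit_vec n k) \<bullet>c v = 0"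
      using P unit_vec_carrier[of n k] unfolding is_orth_proj_span_def n_def[symmetric] by metis
    have "(unit_vec n k - P *\<^sub>v unit_vec n k) \<bullet>c v = (\<Sum>m<n. (if m = k then cnj (v $ k) else 0) - c * (v $ m * cnj (v $ m)))"
      unfolding inner c using k by (intro sum.cong) (auto simp: n_def unit_vec_def left_diff_distrib)
    also have "\<dots> = cnj (v $ k) - c * s"
      using k by (simp add: sum_subtractf s(2) sum_distrib_left)
    finally have "c = cnj (v $ k) / s" using orth s(1) by (simp add: field_simps)
    moreover have "P $$ (i, k) = (P *\<^sub>v unit_vec n k) $ i"
      using carrier i k by simp
    ultimately show "P $$ (i, k) = E $$ (i, k)"
      using i k unfolding c by (simp add: E_def n_def)
  qed
  ultimately have "orth_proj_span v = E"
    unfolding orth_proj_span_def by (intro the_equality)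
  then show ?thesis by (simp only: E_def s_def n_def)
qed

context frame_setup
begin

definition dual_hat :: "nat \<Rightarrow> real \<Rightarrow> complex" where
  "dual_hat k = spectrum \<omega> (dual_generator \<omega> t\<^sub>0 N \<phi> k)"

text \<open>
  The entry of the mixed Gramian for the generator \<open>j\<close> and the dual generator \<open>k\<close>, as a finite sum over the
  cells.
\<close>

definition gram_entry :: "nat \<Rightarrow> nat \<Rightarrow> real \<Rightarrow> complex" where
  "gram_entry k j x = of_real h * (\<Sum>m<M. dual_hat k (x + \<sigma> m) * cnj (\<phi>_hat j (x + \<sigma> m)))"

lemma dual_fiber_AE:
  "AE x in lborel. x \<in> {0..<h} \<longrightarrow> (\<forall>k\<in>{1..N}. \<forall>i<M. (\<Sum>j=1..N. gram_entry k j x * \<phi>_hat j (x + \<sigma> i)) = \<phi>_hat k (x + \<sigma> i))"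
proof -
  have "AE x in lborel. \<forall>k\<in>{1..N}. \<forall>i<M. fiber_op (dual_hat k) (x + \<sigma> i) = \<phi>_hat k (x + \<sigma> i)"
    unfolding dual_hat_def by (intro AE_finite_allI AE_on_cells dual_generator_spectrum) auto
  then show ?thesis
  proof eventually_elim
    case (elim x)
    show ?case
    proof (intro impI ballI allI)
      fix k i assume x: "x \<in> {0..<h}" and k: "k \<in> {1..N}" and i: "i < M"
      have "gram_entry k j x = of_real h * bracket (dual_hat k) j x" for j
        using x by (simp add: gram_entry_def bracket_def)
      then have "fiber_op (dual_hat k) (x + \<sigma> i) = (\<Sum>j=1..N. gram_entry k j x * \<phi>_hat j (x + \<sigma> i))"
        unfolding fiber_op_def assemble_cell[OF x i] by (simp add: sum_distrib_left mult.assoc)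
      then show "(\<Sum>j=1..N. gram_entry k j x * \<phi>_hat j (x + \<sigma> i)) = \<phi>_hat k (x + \<sigma> i)"
        using elim k i by simp
    qed
  qed
qed

text \<open>
  Makes the sum over all integers in the mixed Gramian finite: only the cells meet the band.
\<close>

lemma cell_int:
  assumes "x \<in> {0..<h}" "x + of_int m * h \<in> {-\<omega>..\<omega>}"
  shows "m \<in> (\<lambda>i. int i - int l) ` {..<M}"
proof -
  have "x + of_int m * h < real l * h" "- (real l * h) < x + of_int m * h" "0 \<le> x" "x < h"
    using assms \<omega>_less by auto
  moreover have "(- real l - 1) * h = - (real l * h) - h" by (simp add: algebra_simps)
  ultimately have "of_int m * h < real l * h" "(- real l - 1) * h < of_int m * h"
    by linarith+
  then have "of_int m < real l" "- real l - 1 < of_int m"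
    using h by (simp_all only: mult_less_cancel_right_pos)
  then have "m < int l" "- int l \<le> m" by linarith+
  then show ?thesis
    by (intro image_eqI[of _ _ "nat (m + int l)"]) (auto simp: M_def)
qed

lemma fourier_shifts_AE:
  assumes "j \<in> {1..N}"
  shows "AE x in lborel. \<forall>m::int. fourier (\<phi> j) (x + of_int m * h) = \<phi>_hat j (x + of_int m * h)"
  unfolding AE_all_countable \<phi>_hat_def
  by (intro allI AE_lborel_shift fourier_eq_spectrum \<phi> assms)

lemma mixed_gramian_AE:
  "AE x in lborel. x \<in> {0..<h} \<longrightarrow> (\<forall>j<N. \<forall>k<N.
     mixed_gramian t\<^sub>0 N \<phi> (dual_generator \<omega> t\<^sub>0 N \<phi>) x $$ (j, k) = gram_entry (Suc k) (Suc j) x)"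
proof -
  have "AE x in lborel. \<forall>k\<in>{1..N}. \<forall>m::int. fourier (dual_generator \<omega> t\<^sub>0 N \<phi> k) (x + of_int m * h) = dual_hat k (x + of_int m * h)"
    by (intro AE_finite_allI) (auto simp: AE_all_countable dual_hat_def
        intro!: AE_lborel_shift fourier_eq_spectrum dual_generator_spectrum(1))
  moreover have "AE x in lborel. \<forall>j\<in>{1..N}. \<forall>m::int. fourier (\<phi> j) (x + of_int m * h) = \<phi>_hat j (x + of_int m * h)"
    by (intro AE_finite_allI fourier_shifts_AE) auto
  ultimately show ?thesis
  proof eventually_elim
    case (elim x)
    show ?case
    proof (intro impI allI)
      fix j k assume x: "x \<in> {0..<h}" and j: "j < N" and k: "k < N"
      let ?K = "(\<lambda>i. int i - int l) ` {..<M}"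
      have jk: "Suc j \<in> {1..N}" "Suc k \<in> {1..N}" using j k by auto
      have "(\<Sum>\<^sub>\<infinity>m::int. fourier (dual_generator \<omega> t\<^sub>0 N \<phi> (Suc k)) (x + of_int m * h) * cnj (fourier (\<phi> (Suc j)) (x + of_int m * h)))
          = (\<Sum>\<^sub>\<infinity>m::int. dual_hat (Suc k) (x + of_int m * h) * cnj (\<phi>_hat (Suc j) (x + of_int m * h)))"
        using elim jk by (intro infsum_cong) simp
      also have "\<dots> = (\<Sum>\<^sub>\<infinity>m\<in>?K. dual_hat (Suc k) (x + of_int m * h) * cnj (\<phi>_hat (Suc j) (x + of_int m * h)))"
        using cell_int[OF x] \<phi>_hat_support by (intro infsum_cong_neutral) fastforce+
      also have "\<dots> = (\<Sum>m\<in>?K. dual_hat (Suc k) (x + of_int m * h) * cnj (\<phi>_hat (Suc j) (x + of_int m * h)))"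
        by (rule infsum_finite) simp
      also have "\<dots> = (\<Sum>i<M. dual_hat (Suc k) (x + \<sigma> i) * cnj (\<phi>_hat (Suc j) (x + \<sigma> i)))"
        by (subst sum.reindex) (auto simp: inj_on_def \<sigma>_def)
      finally show "mixed_gramian t\<^sub>0 N \<phi> (dual_generator \<omega> t\<^sub>0 N \<phi>) x $$ (j, k) = gram_entry (Suc k) (Suc j) x"
        using j k by (simp add: mixed_gramian_def Let_def gram_entry_def flip: t\<^sub>0(2))
    qed
  qed
qed

end

section \<open>The mixed Gramian\<close>

context frame_setup
begin

definition dual_gramian :: "real \<Rightarrow> complex mat" where
  "dual_gramian x = mixed_gramian t\<^sub>0 N \<phi> (dual_generator \<omega> t\<^sub>0 N \<phi>) x"

lemma dual_gramian_dim: "dim_row (dual_gramian x) = N" "dim_col (dual_gramian x) = N"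
  by (simp_all add: dual_gramian_def mixed_gramian_def Let_def)

text \<open>The properties of a generic point \<open>x\<close> of the period that determine the Gramian there.\<close>

definition generic :: "real \<Rightarrow> bool" where
  "generic x \<longleftrightarrow>
     (\<forall>c. (\<forall>j\<in>{1..N}. (\<Sum>i<M. c i * cnj (\<phi>_hat j (x + \<sigma> i))) = 0) \<longrightarrow> (\<forall>i<M. band i x = 1 \<longrightarrow> c i = 0)) \<and>
     (\<forall>k\<in>{1..N}. \<forall>i<M. (\<Sum>j=1..N. gram_entry k j x * \<phi>_hat j (x + \<sigma> i)) = \<phi>_hat k (x + \<sigma> i)) \<and>
     (\<forall>j<N. \<forall>k<N. dual_gramian x $$ (j, k) = gram_entry (Suc k) (Suc j) x) \<and>
     (\<forall>j\<in>{1..N}. \<forall>m::int. fourier (\<phi> j) (x + of_int m * h) = \<phi>_hat j (x + of_int m * h))"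

lemma band_cases: "band i x = 0 \<or> band i x = 1"
  by (simp add: band_def indicator_def)

lemma generic_AE: "AE x in lborel. x \<in> {0..<h} \<longrightarrow> generic x"
proof -
  obtain A B where A: "A > 0" and bounds: "AE x in lborel. x \<in> {0..<h} \<longrightarrow> (\<forall>c.
      A * weight c x \<le> energy c x \<and> energy c x \<le> B * weight c x)"
    using frame_bounds_AE by blast
  have "AE x in lborel. \<forall>j\<in>{1..N}. \<forall>m::int. fourier (\<phi> j) (x + of_int m * h) = \<phi>_hat j (x + of_int m * h)"
    by (intro AE_finite_allI fourier_shifts_AE) auto
  with bounds dual_fiber_AE mixed_gramian_AE show ?thesis
  proof eventually_elim
    case (elim x)
    show ?case
    proof
      assume x: "x \<in> {0..<h}"
      have indep: "c i = 0" if c: "\<forall>j\<in>{1..N}. (\<Sum>i<M. c i * cnj (\<phi>_hat j (x + \<sigma> i))) = 0" and i: "i < M" "band i x = 1" for c i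
      proof -
        have "A * weight c x \<le> energy c x"
          using elim(1) x by blast
        also have "\<dots> = 0" using c by (simp add: energy_def)
        finally have le: "weight c x \<le> 0" using A by (simp add: mult_le_0_iff)
        have nonneg: "0 \<le> (cmod (c i))\<^sup>2 * band i x" for i using band_cases[of i x] by auto
        have "(cmod (c i))\<^sup>2 * band i x \<le> weight c x"
          unfolding weight_def using i nonneg by (intro member_le_sum) auto
        with le have "(cmod (c i))\<^sup>2 * band i x \<le> 0" by linarith
        then show ?thesis using i(2) by simp
      qed
      show "generic x"
        unfolding generic_def dual_gramian_def using indep elim x by blast
    qed
  qed
qed

lemma generic_kernel:
  assumes g: "generic x" and k: "k < N" and i: "i < M"
  shows "(\<Sum>j<N. ((if j = k then 1 else 0) - dual_gramian x $$ (j, k)) * \<phi>_hat (Suc j) (x + \<sigma> i)) = 0"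
proof -
  have "(\<Sum>j<N. dual_gramian x $$ (j, k) * \<phi>_hat (Suc j) (x + \<sigma> i)) = (\<Sum>j<N. gram_entry (Suc k) (Suc j) x * \<phi>_hat (Suc j) (x + \<sigma> i))"
    using g k by (intro sum.cong) (auto simp: generic_def)
  also have "\<dots> = (\<Sum>j=1..N. gram_entry (Suc k) j x * \<phi>_hat j (x + \<sigma> i))"
    by (simp add: sum.atLeast1_atMost_eq)
  also have "\<dots> = \<phi>_hat (Suc k) (x + \<sigma> i)" using g k i by (auto simp: generic_def)
  finally have "(\<Sum>j<N. dual_gramian x $$ (j, k) * \<phi>_hat (Suc j) (x + \<sigma> i)) = \<phi>_hat (Suc k) (x + \<sigma> i)" .
  moreover have "(\<Sum>j<N. (if j = k then 1 else 0) * \<phi>_hat (Suc j) (x + \<sigma> i))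
      = (\<Sum>j<N. if j = k then \<phi>_hat (Suc k) (x + \<sigma> i) else 0)"
    by (intro sum.cong) auto
  ultimately show ?thesis using k by (simp add: left_diff_distrib sum_subtractf)
qed

text \<open>Where all cells lie in the band, the fibers form a square system with trivial kernel.\<close>

lemma gramian_full:
  assumes g: "generic x" and NM: "N = M" and full: "\<And>i. i < M \<Longrightarrow> band i x = 1"
  shows "dual_gramian x = 1\<^sub>m N"
proof -
  define A where "A = Matrix.mat N N (\<lambda>(i, j). \<phi>_hat (Suc j) (x + \<sigma> i))"
  have A: "A \<in> carrier_mat N N" by (simp add: A_def)
  have "Determinant.det A \<noteq> 0"
  proof
    assume "Determinant.det A = 0"
    then have "Determinant.det (transpose_mat A) = 0" using det_transpose[OF A] by simp
    then obtain v where v: "v \<in> carrier_vec N" "v \<noteq> 0\<^sub>v N" "transpose_mat A *\<^sub>v v = 0\<^sub>v N"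
      using det_0_iff_vec_prod_zero[of "transpose_mat A" N] A by auto
    have "(\<Sum>i<M. cnj (v $ i) * cnj (\<phi>_hat j (x + \<sigma> i))) = 0" if j: "j \<in> {1..N}" for j
    proof -
      have j': "j - 1 < N" "Suc (j - 1) = j" using j by auto
      have "(transpose_mat A *\<^sub>v v) $ (j - 1) = (\<Sum>i<M. \<phi>_hat j (x + \<sigma> i) * v $ i)"
        using j' v(1) NM by (auto simp: A_def scalar_prod_def atLeast0LessThan intro!: sum.cong)
      then have "(\<Sum>i<M. \<phi>_hat j (x + \<sigma> i) * v $ i) = 0" using v(3) j' by simp
      then have "cnj (\<Sum>i<M. \<phi>_hat j (x + \<sigma> i) * v $ i) = 0" by simp
      then show ?thesis by (simp add: mult.commute)
    qed
    then have "\<forall>i<M. cnj (v $ i) = 0"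
      using g full unfolding generic_def by meson
    then have "v = 0\<^sub>v N" using v(1) NM by (intro eq_vecI) auto
    then show False using v(2) by simp
  qed
  then have inj: "v = 0\<^sub>v N" if "v \<in> carrier_vec N" "A *\<^sub>v v = 0\<^sub>v N" for v
    using det_0_iff_vec_prod_zero[OF A] that by blast
  have zero: "(if j = k then 1 else 0) - dual_gramian x $$ (j, k) = 0" if jk: "j < N" "k < N" for j k
  proof -
    define z where "z = Matrix.vec N (\<lambda>j. (if j = k then 1 else 0) - dual_gramian x $$ (j, k))"
    have z: "z \<in> carrier_vec N" by (simp add: z_def)
    have "A *\<^sub>v z = 0\<^sub>v N"
    proof (rule eq_vecI)
      fix i assume "i < dim_vec (0\<^sub>v N :: complex Matrix.vec)"
      then have i: "i < N" by simp
      have "(A *\<^sub>v z) $ i = (\<Sum>j<N. ((if j = k then 1 else 0) - dual_gramian x $$ (j, k)) * \<phi>_hat (Suc j) (x + \<sigma> i))"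
        using i by (auto simp: A_def z_def scalar_prod_def atLeast0LessThan mult.commute intro!: sum.cong)
      then show "(A *\<^sub>v z) $ i = 0\<^sub>v N $ i"
        using generic_kernel[OF g jk(2)] i NM by simp
    qed (simp add: A_def)
    then have "z = 0\<^sub>v N" by (rule inj[OF z])
    then have "z $ j = 0" using jk by simp
    then show ?thesis using jk by (simp add: z_def)
  qed
  show ?thesis
  proof (rule eq_matI)
    fix j k assume "j < dim_row (1\<^sub>m N :: complex mat)" "k < dim_col (1\<^sub>m N :: complex mat)"
    then show "dual_gramian x $$ (j, k) = 1\<^sub>m N $$ (j, k)" using zero[of j k] by (auto split: if_splits)
  qed (simp_all add: dual_gramian_dim)
qed

text \<open>
  Where one cell is outside the band, the kernel is spanned by the cross product \<open>W\<close> of the fibers,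
  while the columns of the Gramian are combinations of conjugated fibers and hence orthogonal to \<open>W\<close>.
\<close>

lemma gramian_projection:
  assumes g: "generic x" and N: "N \<ge> 1"
    and js: "length js = N - 1" "\<And>r. r < N - 1 \<Longrightarrow> js ! r = int (s r) - int l"
    and s: "\<And>r. r < N - 1 \<Longrightarrow> s r < M" "\<And>r. r < N - 1 \<Longrightarrow> band (s r) x = 1" "inj_on s {..<N - 1}"
    and rest: "\<And>i. i < M \<Longrightarrow> i \<notin> s ` {..<N - 1} \<Longrightarrow> band i x = 0"
  shows "dual_gramian x = 1\<^sub>m N - orth_proj_span (fourier_cross h N \<phi> js x)"
proof -
  define vs where "vs = map (\<lambda>j. Matrix.vec N (\<lambda>k. fourier (\<phi> (Suc k)) (x + of_int j * h))) js"
  have len: "length vs = N - 1" by (simp add: vs_def js(1))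
  have vs: "(vs ! r) $ k = \<phi>_hat (Suc k) (x + \<sigma> (s r))" if r: "r < N - 1" and k: "k < N" for r k
  proof -
    have "vs ! r = Matrix.vec N (\<lambda>k. fourier (\<phi> (Suc k)) (x + of_int (js ! r) * h))"
      unfolding vs_def by (rule nth_map) (simp only: r js(1))
    then have "(vs ! r) $ k = fourier (\<phi> (Suc k)) (x + of_int (int (s r) - int l) * h)"
      unfolding js(2)[OF r] using k by simp
    also have "\<dots> = \<phi>_hat (Suc k) (x + of_int (int (s r) - int l) * h)"
    proof -
      have "Suc k \<in> {1..N}" using k by simp
      with g show ?thesis unfolding generic_def by blast
    qed
    finally show ?thesis by (simp add: \<sigma>_def)
  qed
  define W where "W = cross_product N vs"
  have W_eq: "fourier_cross h N \<phi> js x = W" by (simp add: W_def vs_def fourier_cross_def)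
  have dimW: "dim_vec W = N" by (simp add: W_def cross_product_def)
  have indep: "\<forall>r<N - 1. c r = (0 :: complex)"
    if c: "\<And>k. k < N \<Longrightarrow> (\<Sum>r<N - 1. c r * (vs ! r) $ k) = 0" for c
  proof -
    (* Extend the relation by zero to the cell outside the band; conjugate it, since \<open>generic\<close> speaks of
       relations between the columns of \<open>cnj A(x)\<close>. *)
    define d where "d i = (\<Sum>r<N - 1. if s r = i then cnj (c r) else 0)" for i
    have "(\<Sum>i<M. d i * cnj (\<phi>_hat j (x + \<sigma> i))) = 0" if j: "j \<in> {1..N}" for j
    proof -
      have j': "j - 1 < N" "Suc (j - 1) = j" using j by auto
      have "(\<Sum>i<M. d i * cnj (\<phi>_hat j (x + \<sigma> i)))
          = (\<Sum>r<N - 1. \<Sum>i<M. if s r = i then cnj (c r) * cnj (\<phi>_hat j (x + \<sigma> (s r))) else 0)"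
        unfolding d_def sum_distrib_right
        by (subst sum.swap) (intro sum.cong; auto)
      also have "\<dots> = (\<Sum>r<N - 1. cnj (c r * (vs ! r) $ (j - 1)))"
        using s(1) vs j' by (intro sum.cong) auto
      also have "\<dots> = cnj (\<Sum>r<N - 1. c r * (vs ! r) $ (j - 1))" by simp
      also have "\<dots> = 0" using c[OF j'(1)] by simp
      finally show ?thesis .
    qed
    then have d0: "\<forall>i<M. band i x = 1 \<longrightarrow> d i = 0" using g unfolding generic_def by meson
    show ?thesis
    proof (intro allI impI)
      fix r assume r: "r < N - 1"
      have "d (s r) = (\<Sum>r'<N - 1. if r' = r then cnj (c r) else 0)"
        unfolding d_def using s(3) r by (intro sum.cong) (auto dest: inj_onD)
      then have "d (s r) = cnj (c r)" using r by simp
      then show "c r = 0" using d0 s(1,2)[OF r] by simp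
    qed
  qed
  note W_nz = cross_product_spans_annihilator(1)[OF N len indep, folded W_def]
  define \<rho> where "\<rho> = complex_of_real (\<Sum>k<N. (cmod (W $ k))\<^sup>2)"
  have \<rho>: "\<rho> \<noteq> 0" using W_nz unfolding \<rho>_def by (simp only: of_real_eq_0_iff not_False_eq_True)
  have \<rho>_eq: "\<rho> = (\<Sum>k<N. W $ k * cnj (W $ k))"
    unfolding \<rho>_def by (simp only: of_real_sum complex_norm_square)
  have annih: "(\<Sum>j<N. cnj (\<phi>_hat (Suc j) (x + \<sigma> m)) * cnj (W $ j)) = 0" if m: "m < M" for m
  proof (cases "m \<in> s ` {..<N - 1}")
    case True
    then obtain r where r: "r < N - 1" "m = s r" by auto
    have "(\<Sum>j<N. (vs ! r) $ j * W $ j) = 0"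
      using cross_product_orthogonal[OF N len r(1)] by (simp add: W_def)
    then have "(\<Sum>j<N. \<phi>_hat (Suc j) (x + \<sigma> m) * W $ j) = 0" using vs[OF r(1)] r(2) by simp
    then have "cnj (\<Sum>j<N. \<phi>_hat (Suc j) (x + \<sigma> m) * W $ j) = 0" by simp
    then show ?thesis by simp
  next
    case False
    then have "band m x = 0" using rest m by blast
    then have "\<phi>_hat (Suc j) (x + \<sigma> m) = 0" for j
      by (intro \<phi>_hat_support) (auto simp: band_def indicator_def)
    then show ?thesis by simp
  qed
  have entry_orth: "(\<Sum>j<N. gram_entry k (Suc j) x * cnj (W $ j)) = 0" for k
  proof -
    have "(\<Sum>j<N. gram_entry k (Suc j) x * cnj (W $ j))
        = of_real h * (\<Sum>m<M. dual_hat k (x + \<sigma> m) * (\<Sum>j<N. cnj (\<phi>_hat (Suc j) (x + \<sigma> m)) * cnj (W $ j)))"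
      unfolding gram_entry_def sum_distrib_left sum_distrib_right
      by (subst sum.swap) (simp add: mult_ac)
    then show ?thesis using annih by simp
  qed
  have entry: "(if j = k then 1 else 0) - dual_gramian x $$ (j, k) = W $ j * cnj (W $ k) / \<rho>" if jk: "j < N" "k < N" for j k
  proof -
    define z where "z j = (if j = k then 1 else 0) - dual_gramian x $$ (j, k)" for j
    have "(\<Sum>j<N. z j * (vs ! r) $ j) = 0" if r: "r < N - 1" for r
      using generic_kernel[OF g jk(2) s(1)[OF r]] vs[OF r] by (simp add: z_def)
    then obtain c where c: "\<forall>j<N. z j = c * W $ j"
      using cross_product_spans_annihilator(2)[OF N len indep, folded W_def, of z] by blast
    have "(\<Sum>j<N. z j * cnj (W $ j)) = cnj (W $ k)"
    proof -
      have "(\<Sum>j<N. dual_gramian x $$ (j, k) * cnj (W $ j)) = (\<Sum>j<N. gram_entry (Suc k) (Suc j) x * cnj (W $ j))"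
        using g jk by (intro sum.cong) (auto simp: generic_def)
      moreover have "(\<Sum>j<N. (if j = k then 1 else 0) * cnj (W $ j)) = (\<Sum>j<N. if j = k then cnj (W $ k) else 0)"
        by (intro sum.cong) auto
      ultimately show ?thesis
        using jk entry_orth[of "Suc k"] by (simp add: z_def left_diff_distrib sum_subtractf)
    qed
    moreover have "(\<Sum>j<N. z j * cnj (W $ j)) = c * \<rho>"
      unfolding \<rho>_eq sum_distrib_left using c by (intro sum.cong) (auto simp: mult.assoc)
    ultimately have "c = cnj (W $ k) / \<rho>" using \<rho> by (simp add: field_simps)
    then show ?thesis using c jk by (simp add: z_def)
  qed
  have proj: "orth_proj_span W = Matrix.mat N N (\<lambda>(j, k). W $ j * cnj (W $ k) / \<rho>)"
    using orth_proj_span_eq[of W] W_nz unfolding dimW \<rho>_def by blast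
  show ?thesis
    unfolding W_eq
  proof (rule eq_matI)
    fix j k assume "j < dim_row (1\<^sub>m N - orth_proj_span W)" "k < dim_col (1\<^sub>m N - orth_proj_span W)"
    then have jk: "j < N" "k < N" by (simp_all add: proj)
    have "dual_gramian x $$ (j, k) = (if j = k then 1 else 0) - W $ j * cnj (W $ k) / \<rho>"
      using entry[OF jk] by (simp add: algebra_simps)
    then show "dual_gramian x $$ (j, k) = (1\<^sub>m N - orth_proj_span W) $$ (j, k)"
      using jk by (simp add: proj)
  qed (simp_all add: proj dual_gramian_dim)
qed

end

theorem proposition3p2:
  fixes \<omega> t\<^sub>0 h :: real and l :: nat
    and \<phi> :: "nat \<Rightarrow> real \<Rightarrow> complex"
    and I_minus I_mid I_plus :: "real set"
    and W :: "real \<Rightarrow> complex Matrix.vec"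
  assumes "\<omega> > 0" and "t\<^sub>0 > 0" and "h = 2 * pi / t\<^sub>0"
    and "l \<ge> 1"
    and "\<omega> / real l < h" and "h < \<omega> / (real l - 1 / 2)"
    and "\<And>j. j \<in> {1..2 * l} \<Longrightarrow> \<phi> j \<in> bandlimited \<omega>"
    and "I_minus = {0<..<- \<omega> + real l * h}"
    and "I_mid = {- \<omega> + real l * h<..<\<omega> - (real l - 1) * h}"
    and "I_plus = {\<omega> - (real l - 1) * h<..<h}"
    and "\<And>x. x \<in> I_minus \<Longrightarrow> W x = fourier_cross h (2 * l) \<phi> [- int l + 1..int l - 1] x"
    and "\<And>x. x \<in> I_plus \<Longrightarrow> W x = fourier_cross h (2 * l) \<phi> [- int l..int l - 2] x"
    and "is_frame \<omega> t\<^sub>0 (2 * l) \<phi>"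
  shows "(AE x in lborel. x \<in> I_mid \<longrightarrow>
            mixed_gramian t\<^sub>0 (2 * l) \<phi> (dual_generator \<omega> t\<^sub>0 (2 * l) \<phi>) x = 1\<^sub>m (2 * l)) \<and>
         (AE x in lborel. x \<in> I_minus \<union> I_plus \<longrightarrow>
            mixed_gramian t\<^sub>0 (2 * l) \<phi> (dual_generator \<omega> t\<^sub>0 (2 * l) \<phi>) x
              = 1\<^sub>m (2 * l) - orth_proj_span (W x))"
proof -
  have h: "h > 0" using assms(2,3) by simp
  have upper: "\<omega> < real l * h" using assms(4,5) by (simp add: field_simps)
  have lower: "(2 * real l - 1) * h < 2 * \<omega>"
  proof -
    have "real l - 1 / 2 > 0" using assms(4) by simp
    then have "h * (real l - 1 / 2) < \<omega>" using assms(6) by (simp add: pos_less_divide_eq)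
    then show ?thesis by (simp add: algebra_simps)
  qed
  interpret frame_setup \<omega> h l t\<^sub>0 "2 * l" \<phi>
    by unfold_locales (use h upper assms in auto)
  have M_eq: "M = 2 * l" by (simp add: M_def)
  have bandI: "band i x = 1" if "- \<omega> \<le> x + \<sigma> i" "x + \<sigma> i \<le> \<omega>" for i x
    using that by (simp add: band_def)
  have bandI0: "band i x = 0" if "x + \<sigma> i < - \<omega> \<or> \<omega> < x + \<sigma> i" for i x
    using that by (auto simp: band_def indicator_def)
  have \<sigma>_mono: "\<sigma> i \<le> \<sigma> k" if "i \<le> k" for i k
    unfolding \<sigma>_def using that h by (intro mult_right_mono) auto
  have \<sigma>_vals: "\<sigma> 0 = - (real l * h)" "\<sigma> 1 = h - real l * h"
      "\<sigma> (2 * l - 1) = real l * h - h" "\<sigma> (2 * l - 2) = real l * h - 2 * h"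
    using assms(4) by (simp_all add: \<sigma>_def of_nat_diff algebra_simps)
  have expand: "(real l - 1) * h = real l * h - h" "(2 * real l - 1) * h = 2 * (real l * h) - h"
    by (simp_all add: algebra_simps)
  note bounds = h upper lower[unfolded expand]
  have "AE x in lborel. x \<in> I_mid \<longrightarrow> dual_gramian x = 1\<^sub>m (2 * l)"
    using generic_AE
  proof eventually_elim
    case (elim x)
    show ?case
    proof
      assume "x \<in> I_mid"
      then have x: "real l * h - \<omega> < x" "x < \<omega> - (real l * h - h)" using assms(9) by (auto simp: expand)
      then have "x \<in> {0..<h}" using bounds by simp
      then have gen: "generic x" using elim by blast
      show "dual_gramian x = 1\<^sub>m (2 * l)"
      proof (rule gramian_full[OF gen M_eq[symmetric]])
        fix i assume "i < M"
        then have "\<sigma> 0 \<le> \<sigma> i" "\<sigma> i \<le> \<sigma> (2 * l - 1)" by (auto intro!: \<sigma>_mono simp: M_eq)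
        then show "band i x = 1" using x unfolding \<sigma>_vals by (intro bandI) linarith+
      qed
    qed
  qed
  moreover have "AE x in lborel. x \<in> I_minus \<union> I_plus \<longrightarrow> dual_gramian x = 1\<^sub>m (2 * l) - orth_proj_span (W x)"
    using generic_AE
  proof eventually_elim
    case (elim x)
    show ?case
    proof
      assume "x \<in> I_minus \<union> I_plus"
      then consider "x \<in> I_minus" | "x \<in> I_plus" by blast
      then show "dual_gramian x = 1\<^sub>m (2 * l) - orth_proj_span (W x)"
      proof cases
        (* Here cell \<open>0\<close>, that is \<open>m = -l\<close>, leaves the band. *)
        case 1
        then have x: "0 < x" "x < real l * h - \<omega>" using assms(8) by auto
        then have "x \<in> {0..<h}" using bounds by simp
        then have gen: "generic x" using elim by blast
        show ?thesis
          unfolding assms(11)[OF 1]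
        proof (rule gramian_projection[OF gen, where s = Suc])
          fix r assume r: "r < 2 * l - 1"
          then show "Suc r < M" by (simp add: M_eq)
          have "\<sigma> 1 \<le> \<sigma> (Suc r)" "\<sigma> (Suc r) \<le> \<sigma> (2 * l - 1)" using r by (auto intro!: \<sigma>_mono)
          then show "band (Suc r) x = 1" using x bounds unfolding \<sigma>_vals by (intro bandI) linarith+
          show "[- int l + 1..int l - 1] ! r = int (Suc r) - int l"
            using r by (subst nth_upto) auto
        next
          fix i assume i: "i < M" "i \<notin> Suc ` {..<2 * l - 1}"
          have "i = 0"
          proof (rule ccontr)
            assume "i \<noteq> 0"
            then have "i = Suc (i - 1)" "i - 1 \<in> {..<2 * l - 1}" using i(1) by (auto simp: M_eq)
            then show False using i(2) by blast
          qed
          then show "band i x = 0" using x by (intro bandI0) (simp add: \<sigma>_vals)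
        qed (use assms(4) in auto)
      next
        (* Here the last cell, that is \<open>m = l - 1\<close>, leaves the band. *)
        case 2
        then have x: "\<omega> - (real l * h - h) < x" "x < h" using assms(10) by (auto simp: expand)
        then have "x \<in> {0..<h}" using bounds by simp
        then have gen: "generic x" using elim by blast
        show ?thesis
          unfolding assms(12)[OF 2]
        proof (rule gramian_projection[OF gen, where s = "\<lambda>r. r"])
          fix r assume r: "r < 2 * l - 1"
          then show "r < M" by (simp add: M_eq)
          have "\<sigma> 0 \<le> \<sigma> r" "\<sigma> r \<le> \<sigma> (2 * l - 2)" using r by (auto intro!: \<sigma>_mono)
          then show "band r x = 1" using x bounds unfolding \<sigma>_vals by (intro bandI) linarith+
          show "[- int l..int l - 2] ! r = int (r) - int l"
            using r by (subst nth_upto) auto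
        next
          fix i assume i: "i < M" "i \<notin> (\<lambda>r. r) ` {..<2 * l - 1}"
          then have i: "i = 2 * l - 1" by (auto simp: M_eq)
          have "\<omega> < x + \<sigma> i" using x unfolding i \<sigma>_vals by linarith
          then show "band i x = 0" by (intro bandI0) simp
        qed (use assms(4) in auto)
      qed
    qed
  qed
  ultimately show ?thesis unfolding dual_gramian_def by blast
qed

end
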